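(* Let $M$ be a smooth compact manifold of dimension $d\geq 2$ and let $0\leq \alpha<1$. Then in the space $\mathcal{H}^{1}_{\alpha}(M)$, endowed with the (weak) $\alpha$-Hölder-Whitney topology, infinite topological entropy is a generic property; that is, the set of $f\in\mathcal{H}^1_\alpha(M)$ with $h_{\mathrm{top}}(f)=+\infty$ contains a countable intersection of open dense subsets of $\mathcal{H}^1_\alpha(M)$.
   Context: For $0<\alpha<1$, a continuous map $f\colon M\to M$ is $\alpha$-Hölder if for every pair of charts $(U,\varphi)$, $(V,\psi)$ of $M$ the map $\psi\circ f\circ\varphi^{-1}$ is $\alpha$-Hölder on $\varphi(U\cap f^{-1}(V))$; Lipschitz maps are defined in the same way. $\mathcal{H}^\alpha(M)$ denotes the homeomorphisms $f$ of $M$ with $f$ and $f^{-1}$ both $\alpha$-Hölder (for $\alpha=0$: all homeomorphisms), and $\mathcal{H}^1(M)$ the bi-Lipschitz homeomorphisms (Lipschitz with Lipschitz inverse, in all charts). For a domain $\Omega\subset\mathbb{R}^d$ and $h\colon\Omega\to\mathbb{R}^d$ put $\|h\|_{C^\alpha(\Omega)}=\sup_\Omega|h|+\sup_{x\neq y}|h(x)-h(y)|/|x-y|^\alpha$ (for $\alpha=0$ only the sup term). The $\alpha$-Hölder-Whitney topology on $\mathcal{H}^\alpha(M)$ is the topology with subbasis the sets $\mathcal{N}(f;(U,\varphi),(V,\psi),K,L,\epsilon)$, where $f\in\mathcal{H}^\alpha(M)$, $\epsilon>0$, $(U,\varphi),(V,\psi)$ are charts with $f(U)\cap V\neq\emptyset$,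 $K\subset U\cap f^{-1}(V)$ and $L\subset f(U)\cap V$ are compact sets which are closures of open sets, consisting of all $g\in\mathcal{H}^\alpha(M)$ with $g(K)\subseteq V$, $g^{-1}(L)\subseteq U$, $\|\psi\circ f\circ\varphi^{-1}-\psi\circ g\circ\varphi^{-1}\|_{C^\alpha(\varphi(K))}<\epsilon$ and $\|\varphi\circ f^{-1}\circ\psi^{-1}-\varphi\circ g^{-1}\circ\psi^{-1}\|_{C^\alpha(\psi(L))}<\epsilon$. For $0\le\alpha<\beta\le1$, $\mathcal{H}^\beta_\alpha(M)$ is the closure of $\mathcal{H}^\beta(M)$ in $\mathcal{H}^\alpha(M)$ with respect to this topology. *)

theory Defs
  imports "HOL-Analysis.Analysis"
begin

fun iter_partial :: "'n list \<Rightarrow> (real^'n::finite \<Rightarrow> real^'m::finite) \<Rightarrow> real^'n \<Rightarrow> real^'m" where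
  "iter_partial [] g = g"
| "iter_partial (i # is) g = (\<lambda>x. frechet_derivative (iter_partial is g) (at x) (axis i 1))"

definition smooth_on :: "(real^'n::finite) set \<Rightarrow> (real^'n \<Rightarrow> real^'m::finite) \<Rightarrow> bool" where
  "smooth_on S g \<longleftrightarrow> (\<forall>is. continuous_on S (iter_partial is g) \<and>
                          (\<forall>x\<in>S. iter_partial is g differentiable (at x)))"

type_synonym ('a, 'n) chart = "'a set \<times> ('a \<Rightarrow> real^'n)"

definition is_chart :: "('a::topological_space, 'n::finite) chart \<Rightarrow> bool" where
  "is_chart c \<longleftrightarrow> (case c of (U, \<phi>) \<Rightarrow>
     open U \<and> open (\<phi> ` U) \<and> inj_on \<phi> U \<and> continuous_on U \<phi> \<and>
     continuous_on (\<phi> ` U) (inv_into U \<phi>))"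

definition smooth_compat :: "('a::topological_space, 'n::finite) chart \<Rightarrow> ('a, 'n) chart \<Rightarrow> bool" where
  "smooth_compat c d \<longleftrightarrow> (case c of (U, \<phi>) \<Rightarrow> case d of (V, \<psi>) \<Rightarrow>
     smooth_on (\<phi> ` (U \<inter> V)) (\<psi> \<circ> inv_into U \<phi>) \<and>
     smooth_on (\<psi> ` (U \<inter> V)) (\<phi> \<circ> inv_into V \<psi>))"

definition smooth_atlas :: "('a::topological_space, 'n::finite) chart set \<Rightarrow> bool" where
  "smooth_atlas \<A> \<longleftrightarrow> (\<forall>c\<in>\<A>. is_chart c) \<and> (\<Union>(fst ` \<A>) = UNIV) \<and>
     (\<forall>c\<in>\<A>. \<forall>d\<in>\<A>. smooth_compat c d)"

definition mcharts :: "('a::topological_space, 'n::finite) chart set \<Rightarrow> ('a, 'n) chart set" where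
  "mcharts \<A> = {c. is_chart c \<and> (\<forall>d\<in>\<A>. smooth_compat c d)}"

definition holder_on :: "real \<Rightarrow> (real^'n::finite) set \<Rightarrow> (real^'n \<Rightarrow> real^'m::finite) \<Rightarrow> bool" where
  "holder_on \<alpha> S h \<longleftrightarrow> (\<exists>C. \<forall>x\<in>S. \<forall>y\<in>S. norm (h x - h y) \<le> C * dist x y powr \<alpha>)"

definition holder_map :: "('a::topological_space, 'n::finite) chart set \<Rightarrow> real \<Rightarrow> ('a \<Rightarrow> 'a) \<Rightarrow> bool" where
  "holder_map \<A> \<alpha> f \<longleftrightarrow>
     (\<forall>(U, \<phi>)\<in>mcharts \<A>. \<forall>(V, \<psi>)\<in>mcharts \<A>. \<forall>K. compact K \<and> K \<subseteq> \<phi> ` (U \<inter> f -` V) \<longrightarrow>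
        holder_on \<alpha> K (\<psi> \<circ> f \<circ> inv_into U \<phi>))"

definition Hset :: "('a::topological_space, 'n::finite) chart set \<Rightarrow> real \<Rightarrow> ('a \<Rightarrow> 'a) set" where
  "Hset \<A> \<alpha> = {f. bij f \<and> continuous_on UNIV f \<and> continuous_on UNIV (inv f) \<and>
                   (\<alpha> \<noteq> 0 \<longrightarrow> holder_map \<A> \<alpha> f \<and> holder_map \<A> \<alpha> (inv f))}"

definition holder_norm :: "real \<Rightarrow> (real^'n::finite) set \<Rightarrow> (real^'n \<Rightarrow> real^'m::finite) \<Rightarrow> ereal" where
  "holder_norm \<alpha> S h =
     (SUP x\<in>S. ereal (norm (h x))) +
     (if \<alpha> = 0 then 0 else
        (SUP p\<in>{(x, y). x \<in> S \<and> y \<in> S \<and> x \<noteq> y}.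
           ereal (norm (h (fst p) - h (snd p)) / dist (fst p) (snd p) powr \<alpha>)))"

definition HW_nbhd :: "('a::topological_space, 'n::finite) chart set \<Rightarrow> real \<Rightarrow> ('a \<Rightarrow> 'a) \<Rightarrow>
    ('a, 'n) chart \<Rightarrow> ('a, 'n) chart \<Rightarrow> 'a set \<Rightarrow> 'a set \<Rightarrow> real \<Rightarrow> ('a \<Rightarrow> 'a) set" where
  "HW_nbhd \<A> \<alpha> f c d K L \<epsilon> = (case c of (U, \<phi>) \<Rightarrow> case d of (V, \<psi>) \<Rightarrow>
     {g \<in> Hset \<A> \<alpha>. g ` K \<subseteq> V \<and> inv g ` L \<subseteq> U \<and>
        holder_norm \<alpha> (\<phi> ` K)
          (\<lambda>x. \<psi> (f (inv_into U \<phi> x)) - \<psi> (g (inv_into U \<phi> x))) < ereal \<epsilon> \<and>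
        holder_norm \<alpha> (\<psi> ` L)
          (\<lambda>y. \<phi> (inv f (inv_into V \<psi> y)) - \<phi> (inv g (inv_into V \<psi> y))) < ereal \<epsilon>})"

definition HW_subbasis :: "('a::topological_space, 'n::finite) chart set \<Rightarrow> real \<Rightarrow> ('a \<Rightarrow> 'a) set set" where
  "HW_subbasis \<A> \<alpha> = {HW_nbhd \<A> \<alpha> f (U, \<phi>) (V, \<psi>) K L \<epsilon> | f U \<phi> V \<psi> K L \<epsilon>.
      f \<in> Hset \<A> \<alpha> \<and> \<epsilon> > 0 \<and> (U, \<phi>) \<in> mcharts \<A> \<and> (V, \<psi>) \<in> mcharts \<A> \<and>
      f ` U \<inter> V \<noteq> {} \<and>
      compact K \<and> K \<subseteq> U \<inter> f -` V \<and> (\<exists>W. open W \<and> K = closure W) \<and>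
      compact L \<and> L \<subseteq> f ` U \<inter> V \<and> (\<exists>W. open W \<and> L = closure W)}"

text \<open>Topology on H^alpha(M) with the given subbasis (H^alpha(M) itself added so that
  the carrier is exactly H^alpha(M)).\<close>
definition HW_top :: "('a::topological_space, 'n::finite) chart set \<Rightarrow> real \<Rightarrow> ('a \<Rightarrow> 'a) topology" where
  "HW_top \<A> \<alpha> = topology_generated_by (insert (Hset \<A> \<alpha>) (HW_subbasis \<A> \<alpha>))"

definition Hclos :: "('a::topological_space, 'n::finite) chart set \<Rightarrow> real \<Rightarrow> real \<Rightarrow> ('a \<Rightarrow> 'a) set" where
  "Hclos \<A> \<beta> \<alpha> = HW_top \<A> \<alpha> closure_of Hset \<A> \<beta>"

section \<open>Topological entropy (Adler-Konheim-McAndrew) on a compact space\<close>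

definition join_cover :: "('a \<Rightarrow> 'a) \<Rightarrow> 'a set set \<Rightarrow> nat \<Rightarrow> 'a set set" where
  "join_cover f \<U> n = {(\<Inter>i<n. (f ^^ i) -` u i) | u. \<forall>i<n. u i \<in> \<U>}"

definition min_subcover_card :: "'a set set \<Rightarrow> nat" where
  "min_subcover_card \<V> = Inf {card \<W> | \<W>. \<W> \<subseteq> \<V> \<and> finite \<W> \<and> \<Union>\<W> = UNIV}"

definition cover_entropy :: "('a \<Rightarrow> 'a) \<Rightarrow> 'a set set \<Rightarrow> ereal" where
  "cover_entropy f \<U> =
     limsup (\<lambda>n. ereal (ln (real (min_subcover_card (join_cover f \<U> n))) / real n))"

definition htop :: "('a::topological_space \<Rightarrow> 'a) \<Rightarrow> ereal" where
  "htop f = (SUP \<U>\<in>{\<U>. (\<forall>U\<in>\<U>. open U) \<and> \<Union>\<U> = UNIV}. cover_entropy f \<U>)"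

definition generic_in :: "'b topology \<Rightarrow> 'b set \<Rightarrow> bool" where
  "generic_in X P \<longleftrightarrow> (\<exists>\<G>. countable \<G> \<and>
     (\<forall>G\<in>\<G>. openin X G \<and> X closure_of G = topspace X) \<and>
     topspace X \<inter> \<Inter>\<G> \<subseteq> P)"

end

theory Submission
  imports Defs
begin

text \<open>
  A compact smooth manifold carries a metric \<open>D\<close> that is bi-Lipschitz to every chart on compact sets, so
  that \<open>H^1(M)\<close> is the set of \<open>D\<close>-bi-Lipschitz homeomorphisms. By interpolation between the sup norm and
  Lipschitz bounds, \<open>D\<close>-uniform convergence with uniform bi-Lipschitz constants implies convergence in
  the \<open>\<alpha>\<close>-Hoelder-Whitney topology for every \<open>\<alpha> < 1\<close>. Hence perturbations of a bi-Lipschitz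
  homeomorphism that are supported in small balls and have bounded Lipschitz constants are small.

  Two such perturbations are used. Among the returns of an orbit to a chart one chooses a closest
  pair, relative to the distance to the boundary of the chart ball; then a ball containing the pair
  misses the orbit segment between them, and pushing one point to the other inside it creates a
  periodic point, of some period \<open>n\<close>. Near a periodic point the return map \<open>G\<close> is merely bi-Lipschitz,
  but at every scale one can move the images under \<open>G\<close> of \<open>2m\<close> points of a segment alternately to its
  left and right (by a shear) and then squeeze everything onto a thin tube around the segment, with
  bounds independent of the scale. This produces a topological horseshoe with \<open>m\<close> legs for the \<open>n\<close>-th
  iterate. Horseshoes defined by path crossings persist in the compact-open topology, hence in the
  Hoelder-Whitney topology, and give entropy at least \<open>ln m / n\<close>, where \<open>m\<close> was arbitrary.
\<close>

section \<open>Bi-Lipschitz perturbations of Euclidean space\<close>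

text \<open>Openness is used in one form only: given a bi-Lipschitz \<open>f\<close> in an open set
  and a constant \<Lambda> fixed beforehand, all \<Lambda>-bi-Lipschitz maps uniformly close to
  \<open>f\<close> lie in the set. Hence every perturbation result reads: one \<Lambda>, then for
  every \<delta> a map. Constants must not degrade as supports shrink, so displacements comparable
  to the support are composed of boundedly many steps of constant 2, and similarities carry the
  result to every scale. The other obstacle is the lack of derivatives: the rescalings of a return
  map need not converge, and all that survives rescaling is the bi-Lipschitz constant. The horseshoe
  is therefore built uniformly for all maps with a given constant. It uses finitely many image
  points, which that constant keeps apart, and a functional separating them quantitatively; pushing
  along the kernel of this functional is where dimension at least 2 enters.\<close>

definition supported_bilip :: "real \<Rightarrow> 'v::metric_space set \<Rightarrow> ('v \<Rightarrow> 'v) \<Rightarrow> bool" where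
  "supported_bilip C S h \<longleftrightarrow> 0 \<le> C \<and> bij h \<and> (\<forall>x y. dist (h x) (h y) \<le> C * dist x y) \<and>
     (\<forall>x y. dist x y \<le> C * dist (h x) (h y)) \<and> (\<forall>x. x \<notin> S \<longrightarrow> h x = x)"

text \<open>If \<open>h x\<close> were outside \<open>S\<close>, then \<open>h\<close> would fix
  \<open>h x\<close>, and injectivity would give \<open>h x = x\<close>, a point of
  \<open>S\<close>.\<close>

lemma supported_bilip_maps_into:
  assumes "supported_bilip C S h" "x \<in> S"
  shows "h x \<in> S"
  using assms unfolding supported_bilip_def by (metis bij_is_inj injD)

lemma supported_bilip_comp:
  assumes g: "supported_bilip C S g" and h: "supported_bilip C' S h"
  shows "supported_bilip (C * C') S (g \<circ> h)"
proof -
  have nn: "0 \<le> C" "0 \<le> C'" using g h by (auto simp: supported_bilip_def)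
  have "dist (g (h x)) (g (h y)) \<le> C * C' * dist x y" for x y
  proof -
    have "dist (g (h x)) (g (h y)) \<le> C * dist (h x) (h y)"
      using g by (auto simp: supported_bilip_def)
    also have "\<dots> \<le> C * (C' * dist x y)"
      using h nn by (intro mult_left_mono) (auto simp: supported_bilip_def)
    finally show ?thesis by (simp add: mult.assoc)
  qed
  moreover have "dist x y \<le> C * C' * dist (g (h x)) (g (h y))" for x y
  proof -
    have "dist x y \<le> C' * dist (h x) (h y)"
      using h by (auto simp: supported_bilip_def)
    also have "\<dots> \<le> C' * (C * dist (g (h x)) (g (h y)))"
      using g nn by (intro mult_left_mono) (auto simp: supported_bilip_def)
    finally show ?thesis by (simp add: mult_ac)
  qed
  moreover have "bij (g \<circ> h)" using g h by (auto simp: supported_bilip_def intro: bij_comp)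
  ultimately show ?thesis
    using g h nn by (auto simp: supported_bilip_def)
qed

lemma supported_bilip_id: "supported_bilip 1 S id"
  by (auto simp: supported_bilip_def)

lemma supported_bilip_funpow:
  assumes "supported_bilip C S h"
  shows "supported_bilip (C ^ k) S (h ^^ k)"
proof (induction k)
  case 0
  show ?case using supported_bilip_id[of S] by (simp add: id_def)
next
  case (Suc k)
  show ?case using supported_bilip_comp[OF assms Suc] by (simp only: power_Suc funpow.simps)
qed

text \<open>A 1/2-Lipschitz field leaves at least half of every distance, which gives injectivity
  and the constant 2. Surjectivity: a solution of \<open>x + v x = y\<close> is a fixed point of the
  contraction \<open>\<lambda>x. y - v x\<close>.\<close>

lemma supported_bilip_add_contraction:
  fixes v :: "'v::euclidean_space \<Rightarrow> 'v"
  assumes lip: "\<And>x y. norm (v x - v y) \<le> 1/2 * norm (x - y)"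
    and supp: "\<And>x. x \<notin> S \<Longrightarrow> v x = 0"
  shows "supported_bilip 2 S (\<lambda>x. x + v x)"
proof -
  have low: "dist x y \<le> 2 * dist (x + v x) (y + v y)" for x y
  proof -
    have "norm (x - y) \<le> norm ((x + v x) - (y + v y)) + norm (v x - v y)"
      using norm_triangle_ineq[of "(x + v x) - (y + v y)" "- (v x - v y)"]
      by (simp add: algebra_simps norm_minus_commute)
    with lip[of x y] show ?thesis by (simp add: dist_norm)
  qed
  have up: "dist (x + v x) (y + v y) \<le> 2 * dist x y" for x y
  proof -
    have "norm ((x + v x) - (y + v y)) \<le> norm (x - y) + norm (v x - v y)"
      using norm_triangle_ineq[of "x - y" "v x - v y"] by (simp add: algebra_simps)
    with lip[of x y] norm_ge_zero[of "x - y"] show ?thesis unfolding dist_norm by linarith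
  qed
  have inj: "inj (\<lambda>x. x + v x)"
    using low by (intro injI) (metis dist_self dist_le_zero_iff mult_zero_right)
  have "\<exists>x. x + v x = y" for y
  proof -
    have "\<exists>!x\<in>UNIV. y - v x = x"
    proof (rule Banach_fix[where c = "1/2"])
      fix a b show "dist (y - v a) (y - v b) \<le> 1/2 * dist a b"
        using lip[of b a] by (simp add: dist_norm norm_minus_commute)
    qed (auto simp: complete_UNIV)
    then show ?thesis by (metis diff_add_cancel)
  qed
  then have "surj (\<lambda>x. x + v x)" by (metis surjI)
  with inj low up supp show ?thesis by (auto simp: supported_bilip_def bij_def)
qed

section \<open>Piecewise-linear cut-offs and cut-off vector fields\<close>

definition cutoff :: "'v::real_normed_vector \<Rightarrow> real \<Rightarrow> real \<Rightarrow> 'v \<Rightarrow> real" where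
  "cutoff z r R x = max 0 (min 1 ((R - norm (x - z)) / (R - r)))"

lemma cutoff_eq_1: "r < R \<Longrightarrow> norm (x - z) \<le> r \<Longrightarrow> cutoff z r R x = 1"
  by (auto simp: cutoff_def field_simps)

lemma cutoff_eq_0: "r < R \<Longrightarrow> R \<le> norm (x - z) \<Longrightarrow> cutoff z r R x = 0"
  by (auto simp: cutoff_def field_simps max_def min_def)

lemma cutoff_bounds: "0 \<le> cutoff z r R x" "cutoff z r R x \<le> 1"
  by (auto simp: cutoff_def)

lemma cutoff_lipschitz:
  assumes "r < R"
  shows "\<bar>cutoff z r R x - cutoff z r R y\<bar> \<le> norm (x - y) / (R - r)"
proof -
  have "\<bar>cutoff z r R x - cutoff z r R y\<bar>
      \<le> \<bar>(R - norm (x - z)) / (R - r) - (R - norm (y - z)) / (R - r)\<bar>"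
    unfolding cutoff_def by (auto simp: max_def min_def)
  also have "\<dots> = \<bar>norm (x - z) - norm (y - z)\<bar> / (R - r)"
    using assms by (simp add: abs_divide abs_minus_commute flip: diff_divide_distrib)
  also have "\<dots> \<le> norm (x - y) / (R - r)"
    using assms norm_triangle_ineq3[of "x - z" "y - z"] by (intro divide_right_mono) auto
  finally show ?thesis .
qed

text \<open>The product rule in \<open>in_y\<close> needs a bound on \<open>w\<close> at one of the
  two points only, so it applies whenever one of them lies in the ball of radius \<open>R\<close>;
  if neither does, both values are 0. Thus \<open>w\<close> may be unbounded far away.\<close>

lemma cutoff_scaleR_lipschitz:
  assumes rR: "r < R" and B0: "0 \<le> B"
    and w: "\<And>x y. norm (w x - w y) \<le> Lw * norm (x - y)"
    and B: "\<And>x. norm (x - z) \<le> R \<Longrightarrow> norm (w x) \<le> B"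
  shows "norm (cutoff z r R x *\<^sub>R w x - cutoff z r R y *\<^sub>R w y) \<le> (Lw + B / (R - r)) * norm (x - y)"
proof -
  have in_y: "norm (cutoff z r R x *\<^sub>R w x - cutoff z r R y *\<^sub>R w y) \<le> (Lw + B / (R - r)) * norm (x - y)"
    if y: "norm (y - z) \<le> R" for x y
  proof -
    have "cutoff z r R x *\<^sub>R w x - cutoff z r R y *\<^sub>R w y
       = cutoff z r R x *\<^sub>R (w x - w y) + (cutoff z r R x - cutoff z r R y) *\<^sub>R w y"
      by (simp add: algebra_simps)
    also have "norm \<dots> \<le> \<bar>cutoff z r R x\<bar> * norm (w x - w y)
         + \<bar>cutoff z r R x - cutoff z r R y\<bar> * norm (w y)"
      by (metis norm_scaleR norm_triangle_ineq)
    also have "\<dots> \<le> 1 * (Lw * norm (x - y)) + (norm (x - y) / (R - r)) * B"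
      using w B[OF y] cutoff_bounds[of z r R x] cutoff_lipschitz[OF rR, of z x y] rR
      by (intro add_mono mult_mono) (auto intro: order_trans[OF norm_ge_zero])
    finally show ?thesis by (simp add: algebra_simps)
  qed
  consider "norm (y - z) \<le> R" | "norm (x - z) \<le> R" | "R < norm (y - z)" "R < norm (x - z)"
    by linarith
  then show ?thesis
  proof cases
    case 1 then show ?thesis by (rule in_y)
  next
    case 2 from in_y[OF 2, of y] show ?thesis by (simp add: norm_minus_commute)
  next
    case 3
    have "0 \<le> Lw * norm (x - y)" using w[of x y] norm_ge_zero order_trans by blast
    then show ?thesis using 3 rR B0 by (simp add: cutoff_eq_0 algebra_simps)
  qed
qed
lemma supported_bilip_cutoff_field:
  fixes w :: "'v::euclidean_space \<Rightarrow> 'v"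
  assumes "r < R" "0 \<le> B"
    and "\<And>x y. norm (w x - w y) \<le> Lw * norm (x - y)"
    and "\<And>x. norm (x - z) \<le> R \<Longrightarrow> norm (w x) \<le> B"
    and small: "Lw + B / (R - r) \<le> 1/2"
  shows "supported_bilip 2 (cball z R) (\<lambda>x. x + cutoff z r R x *\<^sub>R w x)"
proof (rule supported_bilip_add_contraction)
  fix x y
  have "norm (cutoff z r R x *\<^sub>R w x - cutoff z r R y *\<^sub>R w y) \<le> (Lw + B / (R - r)) * norm (x - y)"
    by (rule cutoff_scaleR_lipschitz) (use assms in auto)
  also have "\<dots> \<le> 1/2 * norm (x - y)"
    using small by (intro mult_right_mono) auto
  finally show "norm (cutoff z r R x *\<^sub>R w x - cutoff z r R y *\<^sub>R w y) \<le> 1/2 * norm (x - y)" .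
next
  fix x assume "x \<notin> cball z R"
  then show "cutoff z r R x *\<^sub>R w x = 0"
    using assms(1) by (simp add: cutoff_eq_0 dist_norm norm_minus_commute)
qed

text \<open>With \<open>d = dist v w\<close>, a translation by \<open>v - w\<close> cut off at scale
  \<open>d\<close> is no small perturbation of the identity, so it is split into 20 moves of length
  \<open>d / 20\<close>. The cut-off falls from 1 to 0 over a width
  \<open>3/5 * d - d / 2 = d / 10\<close>, so each field has Lipschitz constant 1/2. The orbit of
  \<open>w\<close> runs along the segment to \<open>v\<close>, within \<open>d / 2\<close> of the
  midpoint, where the cut-off is 1.\<close>

lemma supported_bilip_push:
  fixes v w :: "'v::euclidean_space"
  assumes "v \<noteq> w"
  shows "\<exists>h. supported_bilip (2 ^ 20) (cball (midpoint v w) (3/5 * dist v w)) h \<and> h w = v"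
proof -
  let ?m = "midpoint v w" and ?d = "dist v w"
  let ?\<beta> = "cutoff ?m (?d / 2) (3/5 * ?d)"
  define S where "S x = x + ?\<beta> x *\<^sub>R ((1/20) *\<^sub>R (v - w))" for x
  have d: "?d > 0" using assms by simp
  have "supported_bilip 2 (cball ?m (3/5 * ?d)) S"
    unfolding S_def
  proof (rule supported_bilip_cutoff_field[where Lw = 0 and B = "?d / 20"])
    show "norm ((1 / 20) *\<^sub>R (v - w)) \<le> ?d / 20" by (simp add: dist_norm)
    show "0 + ?d / 20 / (3/5 * ?d - ?d / 2) \<le> 1/2" using d by (simp add: field_simps)
  qed (use d in auto)
  then have sb: "supported_bilip (2 ^ 20) (cball ?m (3/5 * ?d)) (S ^^ 20)"
    by (rule supported_bilip_funpow)
  have "(S ^^ k) w = w + (real k / 20) *\<^sub>R (v - w)" if "k \<le> 20" for k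
    using that
  proof (induction k)
    case (Suc k)
    let ?p = "w + (real k / 20) *\<^sub>R (v - w)"
    have "?p - ?m = (real k / 20 - 1/2) *\<^sub>R (v - w)"
      by (rule euclidean_eqI) (simp add: midpoint_def inner_simps field_simps)
    then have "norm (?p - ?m) = \<bar>real k / 20 - 1/2\<bar> * ?d"
      by (simp add: dist_norm)
    also have "\<dots> \<le> 1/2 * ?d"
    proof (intro mult_right_mono)
      have "real k \<le> 20" using Suc.prems by linarith
      then show "\<bar>real k / 20 - 1/2\<bar> \<le> 1/2" unfolding abs_le_iff by simp
    qed simp
    finally have "?\<beta> ?p = 1" using d by (intro cutoff_eq_1) auto
    then have "S ?p = w + (real (Suc k) / 20) *\<^sub>R (v - w)"
      by (simp add: S_def algebra_simps add_divide_distrib)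
    then show ?case using Suc by simp
  qed simp
  from this[of 20] have "(S ^^ 20) w = v" by simp
  with sb show ?thesis by blast
qed

text \<open>A similarity multiplies all distances by one factor, which cancels: \<open>C\<close>
  survives while the support shrinks with \<open>s\<close>. This makes bounds found at unit scale
  valid at every scale.\<close>

lemma scaleR_conjugate_supported_bilip:
  fixes z :: "'v::real_normed_vector"
  assumes h: "supported_bilip C (cball 0 A) h" and s: "0 < s"
  shows "supported_bilip C (cball z (s * A)) (\<lambda>x. z + s *\<^sub>R h ((1/s) *\<^sub>R (x - z)))"
proof -
  let ?g = "\<lambda>x. z + s *\<^sub>R h ((1/s) *\<^sub>R (x - z))"
  have "?g = (\<lambda>x. z + s *\<^sub>R x) \<circ> h \<circ> (\<lambda>x. (1/s) *\<^sub>R (x - z))" by (simp add: o_def)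
  moreover have "bij (\<lambda>x. z + s *\<^sub>R x)"
    by (rule bij_betw_byWitness[where f' = "\<lambda>x. (1/s) *\<^sub>R (x - z)"]) (use s in auto)
  moreover have "bij (\<lambda>x. (1/s) *\<^sub>R (x - z))"
    by (rule bij_betw_byWitness[where f' = "\<lambda>x. z + s *\<^sub>R x"]) (use s in auto)
  ultimately have "bij ?g" using h by (auto simp: supported_bilip_def intro: bij_comp)
  have dg: "dist (?g x) (?g y) = s * dist (h ((1/s) *\<^sub>R (x - z))) (h ((1/s) *\<^sub>R (y - z)))" for x y
    using s by (simp add: dist_norm flip: scaleR_diff_right)
  have ds: "dist x y = s * dist ((1/s) *\<^sub>R (x - z)) ((1/s) *\<^sub>R (y - z))" for x y
    using s by (simp add: dist_norm flip: scaleR_diff_right)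
  have up: "dist (?g x) (?g y) \<le> C * dist x y" for x y
    unfolding dg ds[of x y] using h s by (simp add: supported_bilip_def mult.left_commute)
  have low: "dist x y \<le> C * dist (?g x) (?g y)" for x y
    unfolding dg ds[of x y] using h s by (simp add: supported_bilip_def mult.left_commute)
  have "?g x = x" if "x \<notin> cball z (s * A)" for x
  proof -
    have "s * A < norm (x - z)" using that by (simp add: dist_norm norm_minus_commute)
    then have "A < norm (x - z) / s" using s by (simp add: field_simps)
    also have "\<dots> = norm ((1/s) *\<^sub>R (x - z))" using s by simp
    finally have "A < norm ((1/s) *\<^sub>R (x - z))" .
    then have "h ((1/s) *\<^sub>R (x - z)) = (1/s) *\<^sub>R (x - z)"
      using h by (simp add: supported_bilip_def)
    then show ?thesis using s by simp
  qed
  with \<open>bij ?g\<close> up low h show ?thesis unfolding supported_bilip_def by blast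
qed

text \<open>Induction by tilting, with \<open>c = (1/4) ^ length vs\<close>: if \<open>l\<close>
  nearly annihilates the new vector, adding \<open>c / 2\<close> times its direction leaves at least
  \<open>c / 4\<close> there and costs the old vectors at most half of their bound \<open>c\<close>.
  The norm bound \<open>1 - c\<close> makes room for the tilt. The bounds depend on the number of
  vectors only, which keeps the shear below uniform.\<close>

lemma exists_separating_functional:
  fixes vs :: "'v::real_inner list"
  shows "\<exists>l. norm l \<le> 1 - (1/4) ^ length vs \<and>
    (\<forall>v\<in>set vs. (1/4) ^ length vs * norm v \<le> \<bar>l \<bullet> v\<bar>)"
proof (induction vs)
  case Nil
  show ?case by (rule exI[of _ 0]) simp
next
  case (Cons v vs)
  let ?c = "(1/4 :: real) ^ length vs"
  obtain l where l: "norm l \<le> 1 - ?c" "\<forall>v\<in>set vs. ?c * norm v \<le> \<bar>l \<bullet> v\<bar>"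
    using Cons.IH by blast
  have c: "?c > 0" by simp
  show ?case
  proof (cases "?c / 4 * norm v \<le> \<bar>l \<bullet> v\<bar>")
    case True
    have "?c / 4 * norm u \<le> \<bar>l \<bullet> u\<bar>" if "u \<in> set vs" for u
    proof -
      have "?c / 4 * norm u \<le> ?c * norm u" by (intro mult_right_mono) auto
      then show ?thesis using l(2) that by force
    qed
    moreover have "norm l \<le> 1 - ?c / 4" using l c by linarith
    ultimately show ?thesis using True by (intro exI[of _ l]) auto
  next
    case False
    let ?l = "l + (?c / 2) *\<^sub>R sgn v"
    have "norm ?l \<le> norm l + ?c / 2"
      using norm_triangle_ineq[of l "(?c / 2) *\<^sub>R sgn v"] by (auto simp: norm_sgn split: if_splits)
    moreover have "?c / 4 * norm u \<le> \<bar>?l \<bullet> u\<bar>" if u: "u \<in> set vs" for u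
    proof -
      have "\<bar>sgn v \<bullet> u\<bar> \<le> norm (sgn v) * norm u" by (rule Cauchy_Schwarz_ineq2)
      also have "\<dots> \<le> 1 * norm u" by (intro mult_right_mono) (auto simp: norm_sgn)
      finally have "?c / 2 * \<bar>sgn v \<bullet> u\<bar> \<le> ?c / 2 * norm u" by (intro mult_left_mono) auto
      moreover have "\<bar>?l \<bullet> u\<bar> \<ge> \<bar>l \<bullet> u\<bar> - ?c / 2 * \<bar>sgn v \<bullet> u\<bar>"
        using abs_triangle_ineq2_sym[of "l \<bullet> u" "- (?c / 2 * (sgn v \<bullet> u))"] c
        by (simp add: inner_add_left abs_mult)
      moreover have "?c / 4 * norm u \<le> ?c * norm u - ?c / 2 * norm u"
        using c by (simp add: field_simps)
      moreover have "?c * norm u \<le> \<bar>l \<bullet> u\<bar>" using l(2) u by blast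
      ultimately show ?thesis by linarith
    qed
    moreover have "?c / 4 * norm v \<le> \<bar>?l \<bullet> v\<bar>"
    proof -
      have "sgn v \<bullet> v = norm v"
        by (cases "v = 0") (auto simp: sgn_div_norm power2_norm_eq_inner[symmetric] power2_eq_square)
      then have "?l \<bullet> v = l \<bullet> v + ?c / 2 * norm v" by (simp add: inner_add_left)
      with False show ?thesis by linarith
    qed
    moreover from calculation(1) have "norm ?l \<le> 1 - ?c / 4" using l c by linarith
    ultimately show ?thesis by (intro exI[of _ ?l]) auto
  qed
qed
text \<open>A sum of tents of half-width \<open>c\<close>: nodes at distance at least
  \<open>c\<close> from \<open>t i\<close> have tents vanishing there, so \<open>f\<close>
  interpolates the value \<open>m i\<close>. The bounds count every tent, because tents may
  overlap.\<close>

lemma hat_sum_lipschitz: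
  fixes t m :: "'i \<Rightarrow> real" and f :: "real \<Rightarrow> real" and S c :: real
  assumes "finite I" "0 < c" "\<And>i. i \<in> I \<Longrightarrow> \<bar>m i\<bar> \<le> S"
  defines "f \<equiv> \<lambda>x. \<Sum>i\<in>I. m i * max 0 (1 - \<bar>x - t i\<bar> / c)"
  shows "\<bar>f x - f y\<bar> \<le> (card I * S / c) * \<bar>x - y\<bar>" "\<bar>f x\<bar> \<le> card I * S"
    "\<And>i. i \<in> I \<Longrightarrow> (\<And>j. j \<in> I \<Longrightarrow> j \<noteq> i \<Longrightarrow> c \<le> \<bar>t i - t j\<bar>) \<Longrightarrow> f (t i) = m i"
proof -
  have "\<bar>f x - f y\<bar> \<le> (\<Sum>i\<in>I. \<bar>m i * max 0 (1 - \<bar>x - t i\<bar> / c) - m i * max 0 (1 - \<bar>y - t i\<bar> / c)\<bar>)"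
    unfolding f_def by (simp flip: sum_subtractf)
  also have "\<dots> \<le> (\<Sum>i\<in>I. S * (\<bar>x - y\<bar> / c))"
  proof (rule sum_mono)
    fix i assume i: "i \<in> I"
    have "\<bar>max 0 (1 - \<bar>x - t i\<bar> / c) - max 0 (1 - \<bar>y - t i\<bar> / c)\<bar> \<le> \<bar>\<bar>x - t i\<bar> / c - \<bar>y - t i\<bar> / c\<bar>"
      by (auto simp: max_def)
    also have "\<dots> = \<bar>\<bar>x - t i\<bar> - \<bar>y - t i\<bar>\<bar> / c"
      using assms(2) by (simp add: abs_divide flip: diff_divide_distrib)
    also have "\<dots> \<le> \<bar>x - y\<bar> / c"
      using assms(2) by (intro divide_right_mono) auto
    finally show "\<bar>m i * max 0 (1 - \<bar>x - t i\<bar> / c) - m i * max 0 (1 - \<bar>y - t i\<bar> / c)\<bar> \<le> S * (\<bar>x - y\<bar> / c)"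
      unfolding right_diff_distrib[symmetric] abs_mult
      using assms(3)[OF i] by (intro mult_mono) auto
  qed
  finally show "\<bar>f x - f y\<bar> \<le> (card I * S / c) * \<bar>x - y\<bar>" by simp
  have "\<bar>f x\<bar> \<le> (\<Sum>i\<in>I. \<bar>m i * max 0 (1 - \<bar>x - t i\<bar> / c)\<bar>)"
    unfolding f_def by (rule sum_abs)
  also have "\<dots> \<le> (\<Sum>i\<in>I. S * 1)"
    unfolding abs_mult using assms by (intro sum_mono mult_mono) (auto intro: order_trans[OF abs_ge_zero])
  finally show "\<bar>f x\<bar> \<le> card I * S" by simp
  fix i assume i: "i \<in> I" and sep: "\<And>j. j \<in> I \<Longrightarrow> j \<noteq> i \<Longrightarrow> c \<le> \<bar>t i - t j\<bar>"
  have "f (t i) = (\<Sum>j\<in>I. if j = i then m i else 0)"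
    unfolding f_def
  proof (intro sum.cong refl)
    fix j assume j: "j \<in> I"
    show "m j * max 0 (1 - \<bar>t i - t j\<bar> / c) = (if j = i then m i else 0)"
      using sep[OF j] assms(2) by (cases "j = i") (auto simp: max_def field_simps)
  qed
  then show "f (t i) = m i" using assms(1) i by simp
qed

text \<open>The map is a cut-off shear \<open>x + \<lambda>(l \<bullet> x) u\<close> with \<open>l \<bullet> u = 0\<close>, split into
  many small steps so that each of them is a Lipschitz perturbation of the identity.\<close>

lemma shear_points:
  fixes e1 e2 :: "'v::euclidean_space"
  assumes e: "norm e1 = 1" "norm e2 = 1" "e1 \<bullet> e2 = 0" and c: "0 < c" and S: "0 \<le> S" and A0: "0 \<le> A0"
  shows "\<exists>C A. \<forall>(P :: nat \<Rightarrow> 'v) \<sigma>.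
     (\<forall>i<M. norm (P i) \<le> A0 \<and> \<bar>\<sigma> i\<bar> \<le> S) \<and> (\<forall>i<M. \<forall>j<M. i \<noteq> j \<longrightarrow> c \<le> norm (P i - P j)) \<longrightarrow>
     (\<exists>H. supported_bilip C (cball 0 A) H \<and> (\<forall>i<M. H (P i) \<bullet> e1 = P i \<bullet> e1 + \<sigma> i))"
proof -
  \<comment> \<open>\<delta> is the separation constant for \<open>M * M\<close> differences
    together with \<open>e2\<close>. \<open>U\<close> will bound the shear direction
    \<open>u\<close>, \<Lambda> the Lipschitz constant of the profile \<open>f\<close>, and
    \<open>B\<close> the total displacement.\<close>
  define \<delta> :: real where "\<delta> = (1/4) ^ Suc (M * M)"
  define U where "U = 1 + 1 / \<delta>"
  define \<Lambda> where "\<Lambda> = M * S / (\<delta> * c)"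
  define B where "B = M * S * U"
  define A where "A = A0 + B"
  have \<delta>: "\<delta> > 0" "\<delta> \<le> 1" unfolding \<delta>_def by (simp, rule power_le_one) auto
  have U: "U > 0" using \<delta> by (simp add: U_def add_pos_pos)
  have nn: "\<Lambda> \<ge> 0" "B \<ge> 0" "A \<ge> 0" using \<delta> U c S A0 by (auto simp: \<Lambda>_def B_def A_def)
  \<comment> \<open>Each of \<open>K\<close> steps has a field with Lipschitz constant
    \<open>(\<Lambda> * U + B) / K \<le> 1/2\<close>; the term \<open>B / K\<close> comes from a
    cut-off collar of width 1.\<close>
  obtain K :: nat where K: "2 * (\<Lambda> * U + B) \<le> K" "K > 0"
  proof -
    obtain K :: nat where "2 * (\<Lambda> * U + B) \<le> K" using real_arch_simple by blast
    then show ?thesis using that[of "Suc K"] by simp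
  qed
  show ?thesis
  proof (rule exI[of _ "2 ^ K"], rule exI[of _ "A + 1"], intro allI impI, elim conjE)
    fix P :: "nat \<Rightarrow> 'v" and \<sigma> :: "nat \<Rightarrow> real"
    assume P: "\<forall>i<M. norm (P i) \<le> A0 \<and> \<bar>\<sigma> i\<bar> \<le> S"
      and sep: "\<forall>i<M. \<forall>j<M. i \<noteq> j \<longrightarrow> c \<le> norm (P i - P j)"
    \<comment> \<open>The differences make \<open>l\<close> separate the points. Including
      \<open>e2\<close> keeps \<open>l \<bullet> e2\<close> away from 0, so that correcting
      \<open>e1\<close> to a kernel vector of \<open>l\<close> costs a bounded multiple of
      \<open>e2\<close>.\<close>
    define vs where "vs = e2 # map (\<lambda>(i, j). P i - P j) (List.product [0..<M] [0..<M])"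
    have len: "length vs = Suc (M * M)" by (simp add: vs_def)
    obtain l where l: "norm l \<le> 1" "\<And>v. v \<in> set vs \<Longrightarrow> \<delta> * norm v \<le> \<bar>l \<bullet> v\<bar>"
    proof -
      obtain l where "norm l \<le> 1 - \<delta>" "\<forall>v\<in>set vs. \<delta> * norm v \<le> \<bar>l \<bullet> v\<bar>"
        using exists_separating_functional[of vs] unfolding len \<delta>_def by blast
      then show ?thesis using that[of l] \<delta> by auto
    qed
    have le2: "\<delta> \<le> \<bar>l \<bullet> e2\<bar>" using l(2)[of e2] e by (simp add: vs_def)
    then have le2': "l \<bullet> e2 \<noteq> 0" using \<delta> by auto
    define u where "u = e1 - ((l \<bullet> e1) / (l \<bullet> e2)) *\<^sub>R e2"
    have ul: "l \<bullet> u = 0" using le2' by (simp add: u_def inner_diff_right)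
    have ue: "u \<bullet> e1 = 1"
      using e by (simp add: u_def inner_diff_left inner_commute[of e2 e1] power2_norm_eq_inner[symmetric])
    have "norm u \<le> norm e1 + norm (((l \<bullet> e1) / (l \<bullet> e2)) *\<^sub>R e2)"
      unfolding u_def by (rule norm_triangle_ineq4)
    also have "\<dots> = 1 + \<bar>l \<bullet> e1\<bar> / \<bar>l \<bullet> e2\<bar>" using e by (simp add: abs_divide)
    also have "\<dots> \<le> 1 + 1 / \<delta>"
      using Cauchy_Schwarz_ineq2[of l e1] e l(1) le2 \<delta> by (intro add_left_mono frac_le) auto
    finally have nu: "norm u \<le> U" by (simp add: U_def)
    define f where "f x = (\<Sum>i<M. \<sigma> i * max 0 (1 - \<bar>x - l \<bullet> P i\<bar> / (\<delta> * c)))" for x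
    have dc: "0 < \<delta> * c" using \<delta> c by simp
    have sb: "\<And>i. i \<in> {..<M} \<Longrightarrow> \<bar>\<sigma> i\<bar> \<le> S" using P by auto
    have fL: "\<bar>f x - f y\<bar> \<le> \<Lambda> * \<bar>x - y\<bar>" for x y
      using hat_sum_lipschitz(1)[where I = "{..<M}" and c = "\<delta> * c" and m = \<sigma> and S = S and t = "\<lambda>i. l \<bullet> P i" and x = x and y = y, OF _ dc sb]
      by (simp add: f_def \<Lambda>_def)
    have fB: "\<bar>f x\<bar> \<le> M * S" for x
      using hat_sum_lipschitz(2)[where I = "{..<M}" and c = "\<delta> * c" and m = \<sigma> and S = S and t = "\<lambda>i. l \<bullet> P i" and x = x, OF _ dc sb]
      by (simp add: f_def)
    have fP: "f (l \<bullet> P i) = \<sigma> i" if i: "i < M" for i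
      unfolding f_def
    proof (rule hat_sum_lipschitz(3)[where I = "{..<M}" and c = "\<delta> * c" and m = \<sigma> and S = S and t = "\<lambda>i. l \<bullet> P i" and i = i, OF _ dc sb])
      fix j assume j: "j \<in> {..<M}" "j \<noteq> i"
      have "\<delta> * c \<le> \<delta> * norm (P i - P j)"
        using sep i j \<delta> by (intro mult_left_mono) auto
      also have "\<dots> \<le> \<bar>l \<bullet> (P i - P j)\<bar>"
        by (rule l(2)) (use i j in \<open>auto simp: vs_def\<close>)
      finally show "\<delta> * c \<le> \<bar>l \<bullet> P i - l \<bullet> P j\<bar>" by (simp add: inner_diff_right)
    qed (use i in auto)
    define w where "w x = (f (l \<bullet> x) / K) *\<^sub>R u" for x
    define T where "T x = x + cutoff 0 A (A + 1) x *\<^sub>R w x" for x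
    have "supported_bilip 2 (cball 0 (A + 1)) T"
      unfolding T_def
    proof (rule supported_bilip_cutoff_field[where Lw = "\<Lambda> * U / K" and B = "B / K"])
      fix x y
      have "norm (w x - w y) = \<bar>f (l \<bullet> x) - f (l \<bullet> y)\<bar> / K * norm u"
        unfolding w_def by (simp add: abs_divide flip: scaleR_left_diff_distrib diff_divide_distrib)
      also have "\<dots> \<le> (\<Lambda> * norm (x - y)) / K * U"
      proof (intro mult_mono divide_right_mono)
        have "\<bar>l \<bullet> x - l \<bullet> y\<bar> \<le> norm l * norm (x - y)"
          using Cauchy_Schwarz_ineq2[of l "x - y"] by (simp add: inner_diff_right)
        also have "\<dots> \<le> 1 * norm (x - y)" using l by (intro mult_right_mono) auto
        finally have "\<Lambda> * \<bar>l \<bullet> x - l \<bullet> y\<bar> \<le> \<Lambda> * norm (x - y)" using nn by (intro mult_left_mono) auto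
        with fL show "\<bar>f (l \<bullet> x) - f (l \<bullet> y)\<bar> \<le> \<Lambda> * norm (x - y)" by (rule order_trans)
      qed (use nu nn in auto)
      finally show "norm (w x - w y) \<le> \<Lambda> * U / K * norm (x - y)" by (simp add: mult_ac)
      have "norm (w x) = \<bar>f (l \<bullet> x)\<bar> * norm u / K" by (simp add: w_def abs_divide)
      also have "\<dots> \<le> M * S * U / K" using fB[of "l \<bullet> x"] nu S by (intro divide_right_mono mult_mono) auto
      finally show "norm (w x) \<le> B / K" by (simp add: B_def)
    next
      show "\<Lambda> * U / K + B / K / (A + 1 - A) \<le> 1/2"
        using K by (simp add: field_simps)
    qed (use nn in auto)
    then have sT: "supported_bilip (2 ^ K) (cball 0 (A + 1)) (T ^^ K)"
      by (rule supported_bilip_funpow)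
    \<comment> \<open>Since \<open>l \<bullet> u = 0\<close>, moving along \<open>u\<close> does not
      change the value of the profile \<open>f\<close>; every step adds the same vector, and
      \<open>K\<close> steps add \<open>\<sigma> i *\<^sub>R u\<close>.\<close>
    have orbit: "(T ^^ k) (P i) = P i + (real k / K * \<sigma> i) *\<^sub>R u" if "k \<le> K" "i < M" for k i
      using that
    proof (induction k)
      case (Suc k)
      let ?p = "P i + (real k / K * \<sigma> i) *\<^sub>R u"
      have i: "i < M" by fact
      have "norm ?p \<le> norm (P i) + norm ((real k / K * \<sigma> i) *\<^sub>R u)" by (rule norm_triangle_ineq)
      also have "\<dots> \<le> A0 + 1 * S * U"
        unfolding norm_scaleR abs_mult
        using P i nu Suc.prems S K by (intro add_mono mult_mono) auto
      also have "1 * S * U \<le> M * S * U" using i S U by (intro mult_right_mono) auto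
      then have "A0 + 1 * S * U \<le> A" by (simp add: A_def B_def)
      finally have "cutoff 0 A (A + 1) ?p = 1" by (intro cutoff_eq_1) auto
      moreover have "w ?p = (\<sigma> i / K) *\<^sub>R u"
        using fP[OF i] ul by (simp add: w_def inner_add_right)
      ultimately have "T ?p = P i + (real (Suc k) / K * \<sigma> i) *\<^sub>R u"
        by (simp add: T_def algebra_simps add_divide_distrib)
      then show ?case using Suc by simp
    qed simp
    show "\<exists>H. supported_bilip (2 ^ K) (cball 0 (A + 1)) H \<and> (\<forall>i<M. H (P i) \<bullet> e1 = P i \<bullet> e1 + \<sigma> i)"
      using sT orbit[of K] K ue by (intro exI[of _ "T ^^ K"]) (auto simp: inner_add_left)
  qed
qed

text \<open>Iteration of a map that, on the ball of radius \<open>A\<close>, multiplies the part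
  orthogonal to \<open>e1\<close> by 5/6 and keeps the part along \<open>e1\<close>. Norms do not
  grow, so orbits stay where the cut-off is 1, and enough iterations make the orthogonal part
  smaller than \<tau>.\<close>

lemma squeeze:
  fixes e1 :: "'v::euclidean_space"
  assumes e: "norm e1 = 1" and A: "0 < A" and \<tau>: "0 < \<tau>"
  shows "\<exists>C T. supported_bilip C (cball 0 (2 * A)) T \<and>
    (\<forall>x. norm x \<le> A \<longrightarrow> T x \<bullet> e1 = x \<bullet> e1 \<and> norm (T x - (T x \<bullet> e1) *\<^sub>R e1) < \<tau>)"
proof -
  define p where "p x = x - (x \<bullet> e1) *\<^sub>R e1" for x
  have e11: "e1 \<bullet> e1 = 1" using e by (simp add: power2_norm_eq_inner[symmetric])
  have pe: "p x \<bullet> e1 = 0" for x by (simp add: p_def inner_diff_left e11)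
  have padd: "p (x + y) = p x + p y" "p (c *\<^sub>R x) = c *\<^sub>R p x" "p (x - y) = p x - p y" "p (p x) = p x" for x y c
    using pe[of x] by (auto simp: p_def algebra_simps inner_add_left inner_diff_left)
  have pn: "norm (p x) \<le> norm x" for x
  proof -
    have "x = p x + (x \<bullet> e1) *\<^sub>R e1" by (simp add: p_def)
    moreover have "orthogonal (p x) ((x \<bullet> e1) *\<^sub>R e1)" using pe[of x] by (simp add: orthogonal_def)
    ultimately have "(norm x)\<^sup>2 = (norm (p x))\<^sup>2 + (norm ((x \<bullet> e1) *\<^sub>R e1))\<^sup>2"
      by (metis norm_add_Pythagorean)
    then have "(norm (p x))\<^sup>2 \<le> (norm x)\<^sup>2" by simp
    then show ?thesis by (rule power2_le_imp_le) simp
  qed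
  \<comment> \<open>The factor 1/6 exhausts the admissible Lipschitz constant 1/2: the field itself
    has 1/6, and the cut-off over a collar of width \<open>A\<close>, where the field is at most
    \<open>A / 3\<close>, adds 1/3.\<close>
  define S where "S x = x + cutoff 0 A (2 * A) x *\<^sub>R (- (1/6) *\<^sub>R p x)" for x
  have S: "supported_bilip 2 (cball 0 (2 * A)) S"
    unfolding S_def
  proof (rule supported_bilip_cutoff_field[where Lw = "1/6" and B = "A / 3"])
    fix x y
    have "- (1/6) *\<^sub>R p x - - (1/6) *\<^sub>R p y = - (1/6) *\<^sub>R p (x - y)" by (simp add: padd algebra_simps)
    then show "norm (- (1/6) *\<^sub>R p x - - (1/6) *\<^sub>R p y) \<le> 1/6 * norm (x - y)"
      using pn[of "x - y"] by simp
    show "norm (- (1/6) *\<^sub>R p x) \<le> A / 3" if "norm (x - 0) \<le> 2 * A"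
      using pn[of x] that by simp
  qed (use A in \<open>auto simp: field_simps\<close>)
  obtain K where K: "(5/6 :: real) ^ K * A < \<tau>"
  proof -
    obtain K where "(5/6 :: real) ^ K < \<tau> / A"
      using real_arch_pow_inv[of "\<tau> / A" "5/6"] A \<tau> by auto
    then show ?thesis using that[of K] A by (simp add: field_simps)
  qed
  have orbit: "(S ^^ k) x = (x \<bullet> e1) *\<^sub>R e1 + ((5/6) ^ k) *\<^sub>R p x" if x: "norm x \<le> A" for k x
  proof (induction k)
    case 0
    show ?case by (simp add: p_def)
  next
    case (Suc k)
    let ?q = "(x \<bullet> e1) *\<^sub>R e1 + ((5/6) ^ k) *\<^sub>R p x"
    have pq: "p ?q = ((5/6) ^ k) *\<^sub>R p x"
      by (simp add: padd) (simp add: p_def e11)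
    have o: "orthogonal ((x \<bullet> e1) *\<^sub>R e1) (c *\<^sub>R p x)" for c
      using pe[of x] by (simp add: orthogonal_def inner_commute)
    have "(norm ?q)\<^sup>2 = (norm ((x \<bullet> e1) *\<^sub>R e1))\<^sup>2 + (norm (((5/6) ^ k) *\<^sub>R p x))\<^sup>2"
      by (rule norm_add_Pythagorean[OF o])
    also have "\<dots> \<le> (norm ((x \<bullet> e1) *\<^sub>R e1))\<^sup>2 + (norm (1 *\<^sub>R p x))\<^sup>2"
      by (intro add_left_mono power_mono) (auto simp: power_le_one mult_left_le_one_le)
    also have "\<dots> = (norm x)\<^sup>2"
      by (subst norm_add_Pythagorean[OF o, symmetric]) (simp add: p_def)
    finally have "norm ?q \<le> norm x" by (rule power2_le_imp_le) simp
    then have "cutoff 0 A (2 * A) ?q = 1" using x A by (intro cutoff_eq_1) auto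
    then have "S ?q = ?q - (1/6) *\<^sub>R p ?q" by (simp add: S_def)
    also have "\<dots> = (x \<bullet> e1) *\<^sub>R e1 + ((5/6) ^ Suc k) *\<^sub>R p x"
      unfolding pq by (rule euclidean_eqI) (simp add: inner_simps algebra_simps)
    finally show ?case using Suc by simp
  qed
  have "(S ^^ K) x \<bullet> e1 = x \<bullet> e1 \<and> norm ((S ^^ K) x - ((S ^^ K) x \<bullet> e1) *\<^sub>R e1) < \<tau>"
    if x: "norm x \<le> A" for x
  proof -
    have i: "(S ^^ K) x \<bullet> e1 = x \<bullet> e1" by (simp add: orbit[OF x] inner_add_left e11 pe)
    have "norm ((S ^^ K) x - ((S ^^ K) x \<bullet> e1) *\<^sub>R e1) = (5/6) ^ K * norm (p x)"
      unfolding i by (simp add: orbit[OF x])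
    also have "\<dots> \<le> (5/6) ^ K * A" using pn[of x] x by (intro mult_left_mono) auto
    finally show ?thesis using i K by simp
  qed
  with supported_bilip_funpow[OF S, of K] show ?thesis by blast
qed

text \<open>The constants come before \<Gamma>, so they serve all rescalings of a return map at
  once. The shear sends the images of \<open>2 * m\<close> points of the segment alternately to
  \<open>e1\<close>-coordinates at most -2 and at least 2. Over a cross-section of radius \<tau>
  through such a point the result varies by at most 1/2, so it stays beyond -1 or 1. The squeeze
  keeps \<open>e1\<close>-coordinates and brings everything back into the tube of radius \<tau>. Leg
  \<open>k\<close> lies between the points with indices \<open>2 * k\<close> and
  \<open>2 * k + 1\<close>.\<close>

lemma horseshoe_perturbation:
  fixes e1 e2 :: "'v::euclidean_space"
  assumes e: "norm e1 = 1" "norm e2 = 1" "e1 \<bullet> e2 = 0" and L: "1 \<le> L" and m: "0 < m"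
  shows "\<exists>C A \<tau>. 2 \<le> A \<and> 0 < \<tau> \<and> \<tau> \<le> 1 \<and>
    (\<forall>\<Gamma>. \<Gamma> 0 = 0 \<and> (\<forall>x\<in>cball 0 2. \<forall>y\<in>cball 0 2. norm (\<Gamma> x - \<Gamma> y) \<le> L * norm (x - y) \<and>
              norm (x - y) \<le> L * norm (\<Gamma> x - \<Gamma> y)) \<longrightarrow>
      (\<exists>h. supported_bilip C (cball 0 A) h \<and>
        (\<forall>x. \<bar>x \<bullet> e1\<bar> \<le> 1 \<and> norm (x - (x \<bullet> e1) *\<^sub>R e1) \<le> \<tau> \<longrightarrow>
            norm (h (\<Gamma> x)) \<le> A \<and> norm (h (\<Gamma> x) - (h (\<Gamma> x) \<bullet> e1) *\<^sub>R e1) < \<tau> \<and>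
            (\<forall>k<m. (x \<bullet> e1 = real (2 * k) / real (2 * m) \<longrightarrow> h (\<Gamma> x) \<bullet> e1 < -1) \<and>
                   (x \<bullet> e1 = real (2 * k + 1) / real (2 * m) \<longrightarrow> 1 < h (\<Gamma> x) \<bullet> e1)))))"
  (is "\<exists>C A \<tau>. _ \<and> _ \<and> _ \<and> (\<forall>\<Gamma>. _ \<longrightarrow> ?P C A \<tau> \<Gamma>)")
proof -
  define M where "M = 2 * m"
  define t where "t i = real i / real M" for i
  define c where "c = 1 / (real M * L)"
  have M: "0 < M" using m by (simp add: M_def)
  have c: "0 < c" using M L by (simp add: c_def)
  obtain C1 A1 where CA: "\<And>(P :: nat \<Rightarrow> 'v) \<sigma>.
     (\<forall>i<M. norm (P i) \<le> L \<and> \<bar>\<sigma> i\<bar> \<le> L + 2) \<Longrightarrow> (\<forall>i<M. \<forall>j<M. i \<noteq> j \<longrightarrow> c \<le> norm (P i - P j)) \<Longrightarrow>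
     (\<exists>H. supported_bilip C1 (cball 0 A1) H \<and> (\<forall>i<M. H (P i) \<bullet> e1 = P i \<bullet> e1 + \<sigma> i))"
    using shear_points[OF e c, of "L + 2" L M] L by auto metis
  \<comment> \<open>The ball of radius \<open>A\<close> contains the \<Gamma>-image of the tube
    (norm at most \<open>2 * L\<close>) and is preserved by the shear, whose support has radius
    \<open>A1\<close>. The value of \<tau> makes \<open>(1 + \<bar>C1\<bar>) * (L * \<tau>)\<close>
    equal to 1/2.\<close>
  define A where "A = max A1 (2 * L)"
  define \<tau> where "\<tau> = 1 / (2 * (1 + \<bar>C1\<bar>) * L)"
  have "1 \<le> (1 + \<bar>C1\<bar>) * L" using mult_mono[of 1 "1 + \<bar>C1\<bar>" 1 L] L by simp
  then have \<tau>: "0 < \<tau>" "\<tau> \<le> 1" using L by (auto simp: \<tau>_def field_simps)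
  have A: "2 \<le> A" "A1 \<le> A" "2 * L \<le> A" using L by (auto simp: A_def)
  obtain C2 T where T: "supported_bilip C2 (cball 0 (2 * A)) T"
    "\<And>x. norm x \<le> A \<Longrightarrow> T x \<bullet> e1 = x \<bullet> e1 \<and> norm (T x - (T x \<bullet> e1) *\<^sub>R e1) < \<tau>"
    using squeeze[OF e(1), of A \<tau>] \<tau> A by auto
  have e11: "e1 \<bullet> e1 = 1" using e by (simp add: power2_norm_eq_inner[symmetric])
  show ?thesis
  \<comment> \<open>The radius handed out is \<open>2 * A\<close>: the squeeze is exact on radius
    \<open>A\<close>, but its support is twice as large.\<close>
  proof (rule exI[of _ "C2 * C1"], rule exI[of _ "2 * A"], rule exI[of _ \<tau>], intro conjI allI impI)
    fix \<Gamma> :: "'v \<Rightarrow> 'v"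
    assume \<Gamma>: "\<Gamma> 0 = 0 \<and> (\<forall>x\<in>cball 0 2. \<forall>y\<in>cball 0 2. norm (\<Gamma> x - \<Gamma> y) \<le> L * norm (x - y) \<and>
              norm (x - y) \<le> L * norm (\<Gamma> x - \<Gamma> y))"
    then have up: "norm (\<Gamma> x - \<Gamma> y) \<le> L * norm (x - y)" and lo: "norm (x - y) \<le> L * norm (\<Gamma> x - \<Gamma> y)"
      if "norm x \<le> 2" "norm y \<le> 2" for x y using that by auto
    define P where "P i = \<Gamma> (t i *\<^sub>R e1)" for i
    define \<sigma> where "\<sigma> i = (if even i then - (L + 2) else L + 2)" for i :: nat
    have tb: "0 \<le> t i" "t i \<le> 1" if "i < M" for i using that by (auto simp: t_def)
    have te: "norm (t i *\<^sub>R e1) \<le> 1" if "i < M" for i using tb[OF that] e by simp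
    have PL: "norm (P i) \<le> L" if "i < M" for i
    proof -
      have "norm (P i) \<le> L * norm (t i *\<^sub>R e1)" using up[of "t i *\<^sub>R e1" 0] te[OF that] \<Gamma> by (simp add: P_def)
      also have "\<dots> \<le> L * 1" using te[OF that] L by (intro mult_left_mono) auto
      finally show ?thesis by simp
    qed
    have sep: "c \<le> norm (P i - P j)" if "i < M" "j < M" "i \<noteq> j" for i j
    proof -
      have "1 / real M \<le> \<bar>real i - real j\<bar> / real M" using that by (intro divide_right_mono) auto
      also have "\<dots> = norm (t i *\<^sub>R e1 - t j *\<^sub>R e1)"
        using e by (simp add: t_def abs_divide flip: scaleR_left_diff_distrib diff_divide_distrib)
      also have "\<dots> \<le> L * norm (P i - P j)"
        unfolding P_def by (rule lo) (use te[OF that(1)] te[OF that(2)] in linarith)+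
      finally show ?thesis using M L by (simp add: c_def field_simps)
    qed
    have "\<bar>\<sigma> i\<bar> \<le> L + 2" for i using L by (simp add: \<sigma>_def)
    then obtain H where H: "supported_bilip C1 (cball 0 A1) H" "\<And>i. i < M \<Longrightarrow> H (P i) \<bullet> e1 = P i \<bullet> e1 + \<sigma> i"
      using CA[of P \<sigma>] PL sep by blast
    have HA: "norm (H x) \<le> A" if "norm x \<le> A" for x
      using supported_bilip_maps_into[OF H(1), of x] H(1) that A
      by (cases "x \<in> cball 0 A1") (auto simp: supported_bilip_def)
    have H': "supported_bilip C1 (cball 0 (2 * A)) H"
      using H(1) A by (auto simp: supported_bilip_def)
    show "?P (C2 * C1) (2 * A) \<tau> \<Gamma>"
    proof (rule exI[of _ "T \<circ> H"], intro conjI allI impI supported_bilip_comp[OF T(1) H'])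
      fix x assume "\<bar>x \<bullet> e1\<bar> \<le> 1 \<and> norm (x - (x \<bullet> e1) *\<^sub>R e1) \<le> \<tau>"
      then have x: "\<bar>x \<bullet> e1\<bar> \<le> 1" "norm (x - (x \<bullet> e1) *\<^sub>R e1) \<le> \<tau>" by auto
      have "norm x \<le> norm ((x \<bullet> e1) *\<^sub>R e1) + norm (x - (x \<bullet> e1) *\<^sub>R e1)"
        by (rule norm_triangle_sub)
      then have nx: "norm x \<le> 2" using x \<tau> e by simp
      have "norm (\<Gamma> x) \<le> L * norm x" using up[OF nx, of 0] \<Gamma> by simp
      also have "\<dots> \<le> L * 2" using nx L by (intro mult_left_mono) auto
      finally have "norm (\<Gamma> x) \<le> A" using A by simp
      then have HG: "norm (H (\<Gamma> x)) \<le> A" by (rule HA)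
      have "T (H (\<Gamma> x)) \<in> cball 0 (2 * A)"
        by (rule supported_bilip_maps_into[OF T(1)]) (use HG A in auto)
      then show "norm ((T \<circ> H) (\<Gamma> x)) \<le> 2 * A" by simp
      show "norm ((T \<circ> H) (\<Gamma> x) - ((T \<circ> H) (\<Gamma> x) \<bullet> e1) *\<^sub>R e1) < \<tau>"
        using T(2)[OF HG] unfolding o_def by blast
      have near: "\<bar>(T \<circ> H) (\<Gamma> x) \<bullet> e1 - (P i \<bullet> e1 + \<sigma> i)\<bar> < 1" if i: "i < M" and xi: "x \<bullet> e1 = t i" for i
      proof -
        have "norm (H (\<Gamma> x) - H (P i)) \<le> C1 * norm (\<Gamma> x - P i)"
          using H(1) by (auto simp: supported_bilip_def dist_norm)
        also have "\<dots> \<le> (1 + \<bar>C1\<bar>) * (L * \<tau>)"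
        proof (intro mult_mono)
          have "norm (\<Gamma> x - P i) \<le> L * norm (x - t i *\<^sub>R e1)"
            unfolding P_def by (rule up[OF nx]) (use te[OF i] in linarith)
          also have "\<dots> \<le> L * \<tau>" using x xi L by (intro mult_left_mono) auto
          finally show "norm (\<Gamma> x - P i) \<le> L * \<tau>" .
        qed auto
        also have "\<dots> = 1/2" using L unfolding \<tau>_def by (simp add: divide_simps)
        finally have "norm (H (\<Gamma> x) - H (P i)) \<le> 1/2" .
        moreover have "\<bar>(H (\<Gamma> x) - H (P i)) \<bullet> e1\<bar> \<le> norm (H (\<Gamma> x) - H (P i))"
          using Cauchy_Schwarz_ineq2[of "H (\<Gamma> x) - H (P i)" e1] e by simp
        ultimately show ?thesis
          using T(2)[OF HG] H(2)[OF i] by (simp add: inner_diff_left)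
      qed
      have Pe: "\<bar>P i \<bullet> e1\<bar> \<le> L" if "i < M" for i
        using Cauchy_Schwarz_ineq2[of "P i" e1] e PL[OF that] by simp
      fix k assume k: "k < m"
      show "(T \<circ> H) (\<Gamma> x) \<bullet> e1 < -1" if "x \<bullet> e1 = real (2 * k) / real (2 * m)"
      proof -
        have "2 * k < M" using k by (simp add: M_def)
        moreover have "x \<bullet> e1 = t (2 * k)" using that by (simp add: t_def M_def)
        moreover have "\<sigma> (2 * k) = - (L + 2)" by (simp add: \<sigma>_def)
        ultimately show ?thesis using near[of "2 * k"] Pe[of "2 * k"] by linarith
      qed
      show "1 < (T \<circ> H) (\<Gamma> x) \<bullet> e1" if "x \<bullet> e1 = real (2 * k + 1) / real (2 * m)"
      proof -
        have "2 * k + 1 < M" using k by (simp add: M_def)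
        moreover have "x \<bullet> e1 = t (2 * k + 1)" using that by (simp add: t_def M_def)
        moreover have "\<sigma> (2 * k + 1) = L + 2" by (simp add: \<sigma>_def)
        ultimately show ?thesis using near[of "2 * k + 1"] Pe[of "2 * k + 1"] by linarith
      qed
    qed
  qed (use \<tau> A in auto)
qed

section \<open>Topological horseshoes and entropy\<close>

text \<open>Take the first time \<open>v'\<close> at which \<open>b\<close> is reached and the last
  time \<open>u'\<close> before it at which \<open>a\<close> is reached. A value outside
  \<open>{a..b}\<close> in between would, by the intermediate value theorem, force an earlier visit
  to \<open>b\<close> or a later one to \<open>a\<close>. Descending paths are handled through
  \<open>- \<psi>\<close>.\<close>

lemma crossing_subinterval:
  fixes \<psi> :: "real \<Rightarrow> real"
  assumes cont: "continuous_on {u..v} \<psi>" and uv: "u \<le> v"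
    and ends: "\<psi> u < a \<and> b < \<psi> v \<or> \<psi> v < a \<and> b < \<psi> u" and ab: "a \<le> b"
  shows "\<exists>u' v'. u \<le> u' \<and> u' \<le> v' \<and> v' \<le> v \<and> \<psi> ` {u'..v'} \<subseteq> {a..b} \<and>
    (\<psi> u' = a \<and> \<psi> v' = b \<or> \<psi> u' = b \<and> \<psi> v' = a)"
proof -
  have up: "\<exists>u' v'. u \<le> u' \<and> u' \<le> v' \<and> v' \<le> v \<and> \<psi> ` {u'..v'} \<subseteq> {a..b} \<and> \<psi> u' = a \<and> \<psi> v' = b"
    if cont: "continuous_on {u..v} \<psi>" and ends: "\<psi> u < a" "b < \<psi> v" and ab: "a \<le> b" for a b and \<psi> :: "real \<Rightarrow> real"
  proof -
    let ?B = "{t \<in> {u..v}. \<psi> t = b}"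
    have "compact ?B"
      by (rule closedin_compact[OF compact_Icc continuous_closedin_preimage_constant[OF cont]])
    moreover have "?B \<noteq> {}" using IVT'[of \<psi> u b v] cont ends ab uv by force
    ultimately obtain v' where v': "v' \<in> ?B" "\<And>t. t \<in> ?B \<Longrightarrow> v' \<le> t"
      by (meson compact_attains_inf)
    have cont': "continuous_on {u..v'} \<psi>" using cont v' by (auto intro: continuous_on_subset)
    let ?A = "{t \<in> {u..v'}. \<psi> t = a}"
    have "compact ?A"
      by (rule closedin_compact[OF compact_Icc continuous_closedin_preimage_constant[OF cont']])
    moreover have "?A \<noteq> {}" using IVT'[of \<psi> u a v'] cont' ends ab v' by force
    ultimately obtain u' where u': "u' \<in> ?A" "\<And>t. t \<in> ?A \<Longrightarrow> t \<le> u'"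
      by (meson compact_attains_sup)
    have "a \<le> \<psi> t \<and> \<psi> t \<le> b" if t: "t \<in> {u'..v'}" for t
    proof (intro conjI; rule ccontr)
      assume "\<not> a \<le> \<psi> t"
      then obtain s where "t \<le> s" "s \<le> v'" "\<psi> s = a"
        using IVT'[of \<psi> t a v'] continuous_on_subset[OF cont', of "{t..v'}"] t u' v' ab by auto
      moreover from this have "s \<le> u'" using u' t by auto
      ultimately have "s = t" using t by simp
      with \<open>\<psi> s = a\<close> \<open>\<not> a \<le> \<psi> t\<close> show False by simp
    next
      assume "\<not> \<psi> t \<le> b"
      then obtain s where "u' \<le> s" "s \<le> t" "\<psi> s = b"
        using IVT'[of \<psi> u' b t] continuous_on_subset[OF cont', of "{u'..t}"] t u' v' ab by auto
      moreover from this have "v' \<le> s" using u' v' t by auto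
      ultimately have "s = t" using t by simp
      with \<open>\<psi> s = b\<close> \<open>\<not> \<psi> t \<le> b\<close> show False by simp
    qed
    then show ?thesis using u' v' by (intro exI[of _ u'] exI[of _ v']) auto
  qed
  from ends show ?thesis
  proof
    assume "\<psi> u < a \<and> b < \<psi> v"
    then show ?thesis using up[OF cont, of a b] ab by blast
  next
    assume "\<psi> v < a \<and> b < \<psi> u"
    then obtain u' v' where *: "u \<le> u'" "u' \<le> v'" "v' \<le> v" "(\<lambda>t. - \<psi> t) ` {u'..v'} \<subseteq> {- b..- a}"
       "- \<psi> u' = - b" "- \<psi> v' = - a"
      using up[of "\<lambda>t. - \<psi> t" "- b" "- a"] cont ab by (auto intro: continuous_on_minus)
    then have "\<psi> ` {u'..v'} \<subseteq> {a..b}" by force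
    with * show ?thesis by auto
  qed
qed

text \<open>A topological horseshoe in the sense of Kennedy and Yorke: a path in \<open>Q\<close> along which
  \<open>\<xi>\<close> runs from below \<open>-1\<close> to above \<open>1\<close> contains, for every \<open>k < m\<close>, a subpath in
  \<open>{x \<in> D. a k \<le> \<xi> x \<le> b k}\<close> whose image is again such a path, up to orientation.\<close>

definition horseshoe_frame ::
  "nat \<Rightarrow> 'a::topological_space set \<Rightarrow> 'a set \<Rightarrow> ('a \<Rightarrow> real) \<Rightarrow> (nat \<Rightarrow> real) \<Rightarrow> (nat \<Rightarrow> real) \<Rightarrow> bool" where
  "horseshoe_frame m D Q \<xi> a b \<longleftrightarrow> compact D \<and> open Q \<and> continuous_on (D \<union> Q) \<xi> \<and>
     {x \<in> Q. \<bar>\<xi> x\<bar> \<le> 1} \<subseteq> D \<and>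
     (\<forall>k<m. -1 \<le> a k \<and> a k \<le> b k \<and> b k \<le> 1) \<and>
     (\<forall>j<m. \<forall>k<m. j \<noteq> k \<longrightarrow> {a j..b j} \<inter> {a k..b k} = {}) \<and>
     (\<exists>p::real \<Rightarrow> 'a. continuous_on {0..1} p \<and> p ` {0..1} \<subseteq> Q \<and> \<xi> (p 0) < -1 \<and> 1 < \<xi> (p 1))"

text \<open>Every condition says that a compact set (\<open>D\<close>, or a level set of \<xi> in
  it) is mapped into an open set, and \<open>horseshoe_frame\<close> does not mention the map. So
  for a fixed frame this is an open condition in the compact-open topology.\<close>

definition crosses ::
  "nat \<Rightarrow> 'a::topological_space set \<Rightarrow> 'a set \<Rightarrow> ('a \<Rightarrow> real) \<Rightarrow> (nat \<Rightarrow> real) \<Rightarrow> (nat \<Rightarrow> real) \<Rightarrow> ('a \<Rightarrow> 'a) \<Rightarrow> bool" where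
  "crosses m D Q \<xi> a b F \<longleftrightarrow> F ` D \<subseteq> Q \<and>
     (\<forall>k<m. F ` {x \<in> D. \<xi> x = a k} \<subseteq> {y \<in> Q. \<xi> y < -1} \<and>
            F ` {x \<in> D. \<xi> x = b k} \<subseteq> {y \<in> Q. 1 < \<xi> y})"

section \<open>Symbolic itineraries and the entropy bound\<close>

lemma continuous_on_funpow:
  fixes F :: "'a::topological_space \<Rightarrow> 'a"
  assumes "continuous_on UNIV F"
  shows "continuous_on UNIV (F ^^ n)"
proof (induction n)
  case (Suc n)
  then show ?case unfolding funpow.simps
    by (rule continuous_on_compose) (rule continuous_on_subset[OF assms], simp)
qed (simp add: id_def continuous_on_id)

text \<open>Induction on the length, carrying a parameter interval whose points follow the word so
  far and whose image path under \<open>F ^^ n\<close> lies in \<open>Q\<close> and runs across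
  [-1, 1] in one of the two directions. \<open>crossing_subinterval\<close> cuts out the part in leg
  \<open>w n\<close>, and \<open>crosses\<close> turns its ends into the ends of a new crossing
  path.\<close>

lemma horseshoe_itinerary:
  fixes F :: "'a::topological_space \<Rightarrow> 'a"
  assumes fr: "horseshoe_frame m D Q \<xi> a b" and cr: "crosses m D Q \<xi> a b F"
    and F: "continuous_on UNIV F" and w: "\<And>i. w i < m"
  shows "\<exists>x. \<forall>i<n. (F ^^ i) x \<in> {y \<in> D. a (w i) \<le> \<xi> y \<and> \<xi> y \<le> b (w i)}"
proof -
  obtain p :: "real \<Rightarrow> 'a" where p: "continuous_on {0..1} p" "p ` {0..1} \<subseteq> Q" "\<xi> (p 0) < -1" "1 < \<xi> (p 1)"
    using fr by (auto simp: horseshoe_frame_def)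
  have contF: "continuous_on UNIV (F ^^ n)" for n
    by (rule continuous_on_funpow[OF F])
  have "\<exists>u v. 0 \<le> u \<and> u \<le> v \<and> v \<le> 1 \<and>
      (\<forall>t\<in>{u..v}. (\<forall>i<n. (F ^^ i) (p t) \<in> {y \<in> D. a (w i) \<le> \<xi> y \<and> \<xi> y \<le> b (w i)}) \<and> (F ^^ n) (p t) \<in> Q) \<and>
      (let \<psi> = \<lambda>t. \<xi> ((F ^^ n) (p t)) in \<psi> u < -1 \<and> 1 < \<psi> v \<or> \<psi> v < -1 \<and> 1 < \<psi> u)" for n
  proof (induction n)
    case 0
    show ?case by (rule exI[of _ 0], rule exI[of _ 1]) (use p in auto)
  next
    case (Suc n)
    let ?\<psi> = "\<lambda>t. \<xi> ((F ^^ n) (p t))"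
    obtain u v where uv: "0 \<le> u" "u \<le> v" "v \<le> 1"
      and itin: "\<And>t i. t \<in> {u..v} \<Longrightarrow> i < n \<Longrightarrow> (F ^^ i) (p t) \<in> {y \<in> D. a (w i) \<le> \<xi> y \<and> \<xi> y \<le> b (w i)}"
      and Q: "\<And>t. t \<in> {u..v} \<Longrightarrow> (F ^^ n) (p t) \<in> Q"
      and ends: "?\<psi> u < -1 \<and> 1 < ?\<psi> v \<or> ?\<psi> v < -1 \<and> 1 < ?\<psi> u"
      using Suc.IH unfolding Let_def by blast
    have ab: "-1 \<le> a (w n)" "a (w n) \<le> b (w n)" "b (w n) \<le> 1"
      using fr w[of n] by (auto simp: horseshoe_frame_def)
    have "continuous_on {u..v} (\<lambda>t. (F ^^ n) (p t))"
    proof (rule continuous_on_compose2[OF contF[of n]])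
      show "continuous_on {u..v} p" by (rule continuous_on_subset[OF p(1)]) (use uv in auto)
    qed simp
    moreover have contQ: "continuous_on Q \<xi>" using fr unfolding horseshoe_frame_def by (elim conjE) (erule continuous_on_subset, blast)
    ultimately have "continuous_on {u..v} ?\<psi>"
      by (intro continuous_on_compose2[OF contQ]) (use Q in auto)
    then obtain u' v' where uv': "u \<le> u'" "u' \<le> v'" "v' \<le> v" "?\<psi> ` {u'..v'} \<subseteq> {a (w n)..b (w n)}"
      "?\<psi> u' = a (w n) \<and> ?\<psi> v' = b (w n) \<or> ?\<psi> u' = b (w n) \<and> ?\<psi> v' = a (w n)"
      using crossing_subinterval[of u v ?\<psi> "a (w n)" "b (w n)"] uv ab ends by auto
    have S: "(F ^^ n) (p t) \<in> {y \<in> D. a (w n) \<le> \<xi> y \<and> \<xi> y \<le> b (w n)}" if t: "t \<in> {u'..v'}" for t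
    proof -
      have "a (w n) \<le> ?\<psi> t" "?\<psi> t \<le> b (w n)" using uv'(4)[THEN subsetD, OF imageI[OF t]] by auto
      moreover from this ab have "\<bar>?\<psi> t\<bar> \<le> 1" by linarith
      then have "(F ^^ n) (p t) \<in> D"
        using Q[of t] t uv' fr unfolding horseshoe_frame_def by auto
      ultimately show ?thesis by simp
    qed
    have inQ: "(F ^^ Suc n) (p t) \<in> Q" if t: "t \<in> {u'..v'}" for t
      using S[OF t] cr by (auto simp: crosses_def)
    have it: "(F ^^ i) (p t) \<in> {y \<in> D. a (w i) \<le> \<xi> y \<and> \<xi> y \<le> b (w i)}" if "t \<in> {u'..v'}" "i < Suc n" for t i
      using itin[of t i] S[of t] that uv' by (cases "i = n") auto
    have cross: "\<xi> ((F ^^ Suc n) (p t)) < -1" if "t \<in> {u'..v'}" "?\<psi> t = a (w n)" for t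
      using S[OF that(1)] that(2) cr w[of n] by (auto simp: crosses_def image_subset_iff)
    have cross': "1 < \<xi> ((F ^^ Suc n) (p t))" if "t \<in> {u'..v'}" "?\<psi> t = b (w n)" for t
      using S[OF that(1)] that(2) cr w[of n] by (auto simp: crosses_def image_subset_iff)
    have mem: "u' \<in> {u'..v'}" "v' \<in> {u'..v'}" using uv' by auto
    show ?case
    proof (rule exI[of _ u'], rule exI[of _ v'], intro conjI ballI allI impI)
      show "let \<psi> = \<lambda>t. \<xi> ((F ^^ Suc n) (p t)) in \<psi> u' < -1 \<and> 1 < \<psi> v' \<or> \<psi> v' < -1 \<and> 1 < \<psi> u'"
        unfolding Let_def using uv'(5) cross[OF mem(1)] cross[OF mem(2)] cross'[OF mem(1)] cross'[OF mem(2)]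
        by blast
      show "0 \<le> u'" "u' \<le> v'" "v' \<le> 1" using uv uv' by linarith+
    qed (fact it inQ)+
  qed
  from this[of n] obtain u v where "u \<le> v" "\<forall>t\<in>{u..v}. \<forall>i<n. (F ^^ i) (p t) \<in> {y \<in> D. a (w i) \<le> \<xi> y \<and> \<xi> y \<le> b (w i)}"
    by blast
  then show ?thesis by (intro exI[of _ "p u"]) auto
qed

lemma finite_join_cover:
  assumes "finite \<U>"
  shows "finite (join_cover f \<U> n)"
proof -
  have "join_cover f \<U> n \<subseteq> (\<lambda>u. \<Inter>i<n. (f ^^ i) -` u i) ` ({..<n} \<rightarrow>\<^sub>E \<U>)"
  proof
    fix V assume "V \<in> join_cover f \<U> n"
    then obtain u where u: "V = (\<Inter>i<n. (f ^^ i) -` u i)" "\<forall>i<n. u i \<in> \<U>"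
      by (auto simp: join_cover_def)
    show "V \<in> (\<lambda>u. \<Inter>i<n. (f ^^ i) -` u i) ` ({..<n} \<rightarrow>\<^sub>E \<U>)"
    proof (rule image_eqI)
      show "V = (\<Inter>i<n. (f ^^ i) -` restrict u {..<n} i)"
        unfolding u(1) by (rule INF_cong) simp_all
      show "restrict u {..<n} \<in> {..<n} \<rightarrow>\<^sub>E \<U>" using u(2) by (simp add: restrict_PiE_iff)
    qed
  qed
  then show ?thesis by (rule finite_subset) (simp add: finite_PiE assms)
qed

lemma Union_join_cover:
  assumes "\<Union>\<U> = UNIV"
  shows "\<Union>(join_cover f \<U> n) = UNIV"
proof -
  have "x \<in> \<Union>(join_cover f \<U> n)" for x
  proof -
    have "\<exists>U. U \<in> \<U> \<and> (f ^^ i) x \<in> U" for i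
      using UNIV_I[of "(f ^^ i) x"] unfolding assms[symmetric] by auto
    then obtain u where u: "\<And>i. u i \<in> \<U> \<and> (f ^^ i) x \<in> u i" by metis
    then have "x \<in> (\<Inter>i<n. (f ^^ i) -` u i)" by simp
    moreover have "(\<Inter>i<n. (f ^^ i) -` u i) \<in> join_cover f \<U> n"
      unfolding join_cover_def using u by (intro CollectI exI[of _ u]) simp
    ultimately show ?thesis by (rule UnionI[rotated])
  qed
  then show ?thesis by blast
qed

text \<open>The \<open>k\<close>-th member of the cover is the complement of all legs but the
  \<open>k\<close>-th, so it meets no other leg. A member of the join therefore determines the leg
  visited at each of the times 0, \<open>p\<close>, \<open>2 * p\<close> and so on. Points realising
  different words of length \<open>n\<close> lie in different members, and there are
  \<open>m ^ n\<close> words.\<close>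

lemma horseshoe_min_subcover_card:
  fixes f :: "'a::t2_space \<Rightarrow> 'a"
  assumes fr: "horseshoe_frame m D Q \<xi> a b" and cr: "crosses m D Q \<xi> a b (f ^^ p)"
    and f: "continuous_on UNIV f" and p: "0 < p" and m: "0 < m"
  defines "S \<equiv> \<lambda>k. {y \<in> D. a k \<le> \<xi> y \<and> \<xi> y \<le> b k}"
  defines "\<U> \<equiv> (\<lambda>k. - (\<Union>j\<in>{..<m} - {k}. S j)) ` {..<m}"
  shows "\<forall>U\<in>\<U>. open U" "\<Union>\<U> = UNIV" "m ^ n \<le> min_subcover_card (join_cover f \<U> (n * p))"
proof -
  have D: "compact D" using fr unfolding horseshoe_frame_def by blast
  have cont: "continuous_on D \<xi>"
    using fr unfolding horseshoe_frame_def by (elim conjE) (erule continuous_on_subset, blast)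
  have "closed (S k)" for k
  proof -
    have "S k = D \<inter> \<xi> -` {a k..b k}" by (auto simp: S_def)
    moreover have "closed \<dots>"
      by (rule continuous_closed_preimage[OF cont compact_imp_closed[OF D]]) simp
    ultimately show ?thesis by simp
  qed
  then show "\<forall>U\<in>\<U>. open U" by (auto simp: \<U>_def intro!: open_Compl closed_UN)
  have disj: "S j \<inter> S k = {}" if "j < m" "k < m" "j \<noteq> k" for j k
  proof -
    have "{a j..b j} \<inter> {a k..b k} = {}" using fr that unfolding horseshoe_frame_def by blast
    moreover have "\<xi> x \<in> {a j..b j} \<inter> {a k..b k}" if "x \<in> S j \<inter> S k" for x using that by (auto simp: S_def)
    ultimately show ?thesis by blast
  qed
  have "x \<in> \<Union>\<U>" for x
  proof (cases "\<exists>k<m. x \<in> S k")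
    case True
    then obtain k where k: "k < m" "x \<in> S k" by blast
    then have "x \<in> - (\<Union>j\<in>{..<m} - {k}. S j)" using disj by blast
    then show ?thesis using k by (auto simp: \<U>_def)
  next
    case False
    then have "x \<in> - (\<Union>j\<in>{..<m} - {0}. S j)" by auto
    then show ?thesis using m by (auto simp: \<U>_def)
  qed
  then show U: "\<Union>\<U> = UNIV" by blast
  let ?\<C> = "{card \<W> | \<W>. \<W> \<subseteq> join_cover f \<U> (n * p) \<and> finite \<W> \<and> \<Union>\<W> = UNIV}"
  \<comment> \<open>Finiteness of the join makes this set of cardinalities nonempty, so that
    \<open>Inf\<close> is attained; for an empty set of naturals it would be 0.\<close>
  have "card (join_cover f \<U> (n * p)) \<in> ?\<C>"
    using finite_join_cover[of \<U> f "n * p"] Union_join_cover[OF U, of f "n * p"] by (auto simp: \<U>_def)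
  then have "Inf ?\<C> \<in> ?\<C>" by (intro Inf_nat_def1) blast
  then obtain \<W> where W: "\<W> \<subseteq> join_cover f \<U> (n * p)" "finite \<W>" "\<Union>\<W> = UNIV"
    and card: "min_subcover_card (join_cover f \<U> (n * p)) = card \<W>"
    unfolding min_subcover_card_def by auto
  define wd where "wd = ({..<n} \<rightarrow>\<^sub>E {..<m})"
  have "\<exists>x. \<forall>i<n. ((f ^^ p) ^^ i) x \<in> S (w i)" if "w \<in> wd" for w
  proof -
    \<comment> \<open>Itineraries are stated for infinite words; the letter 0 fills the positions
      from \<open>n\<close> on.\<close>
    have "\<exists>x. \<forall>i<n. ((f ^^ p) ^^ i) x \<in> {y \<in> D. a ((\<lambda>i. if i < n then w i else 0) i) \<le> \<xi> y \<and>
        \<xi> y \<le> b ((\<lambda>i. if i < n then w i else 0) i)}"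
      by (rule horseshoe_itinerary[OF fr cr continuous_on_funpow[OF f]])
        (use that m in \<open>auto simp: wd_def PiE_iff\<close>)
    then show ?thesis by (auto simp: S_def)
  qed
  then obtain x where x: "\<And>w i. w \<in> wd \<Longrightarrow> i < n \<Longrightarrow> ((f ^^ p) ^^ i) (x w) \<in> S (w i)"
    by metis
  have "\<exists>V\<in>\<W>. x w \<in> V" for w using W(3) by blast
  then obtain V where V: "\<And>w. V w \<in> \<W> \<and> x w \<in> V w" by metis
  have symb: "\<exists>u. \<forall>w\<in>wd. x w \<in> V v \<longrightarrow> (\<forall>i<n. w i = u i)" for v
  proof -
    obtain u where u: "V v = (\<Inter>i<n * p. (f ^^ i) -` u i)" "\<forall>i<n * p. u i \<in> \<U>"
      using V[of v] W(1) unfolding join_cover_def by blast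
    have "\<forall>i<n. \<exists>k<m. u (p * i) = - (\<Union>j\<in>{..<m} - {k}. S j)"
    proof (intro allI impI)
      fix i assume "i < n"
      then have "p * i < n * p" using p by simp
      then have "u (p * i) \<in> \<U>" using u(2) by blast
      then show "\<exists>k<m. u (p * i) = - (\<Union>j\<in>{..<m} - {k}. S j)" unfolding \<U>_def by blast
    qed
    then obtain k where k: "\<And>i. i < n \<Longrightarrow> u (p * i) = - (\<Union>j\<in>{..<m} - {k i}. S j)" by metis
    have "w i = k i" if w: "w \<in> wd" "x w \<in> V v" "i < n" for w i
    proof (rule ccontr)
      assume "w i \<noteq> k i"
      moreover have "w i < m" using w by (auto simp: wd_def PiE_iff)
      moreover have "p * i < n * p" using w p by simp
      then have "(f ^^ (p * i)) (x w) \<in> u (p * i)" using w(2) u(1) by blast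
      ultimately show False
        using k[OF w(3)] x[OF w(1,3)] by (auto simp: funpow_mult)
    qed
    then show ?thesis by blast
  qed
  have "inj_on V wd"
  proof (rule inj_onI)
    fix w w' assume w: "w \<in> wd" "w' \<in> wd" "V w = V w'"
    then obtain u where "\<forall>i<n. w i = u i" "\<forall>i<n. w' i = u i"
      using symb[of w] V[of w] V[of w'] by metis
    then show "w = w'" using w by (intro PiE_ext[of w "{..<n}" _ w']) (auto simp: wd_def)
  qed
  then have "card wd \<le> card \<W>"
    by (rule card_inj_on_le) (use V W in auto)
  moreover have "card wd = m ^ n" by (simp add: wd_def card_PiE)
  ultimately show "m ^ n \<le> min_subcover_card (join_cover f \<U> (n * p))" by (simp add: card)
qed

lemma htop_ge_horseshoe:
  fixes f :: "'a::t2_space \<Rightarrow> 'a"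
  assumes fr: "horseshoe_frame m D Q \<xi> a b" and cr: "crosses m D Q \<xi> a b (f ^^ p)"
    and f: "continuous_on UNIV f" and p: "0 < p" and m: "0 < m"
  shows "ereal (ln (real m) / real p) \<le> htop f"
proof -
  note U = horseshoe_min_subcover_card[OF assms]
  define \<U> where "\<U> = (\<lambda>k. - (\<Union>j\<in>{..<m} - {k}. {y \<in> D. a j \<le> \<xi> y \<and> \<xi> y \<le> b j})) ` {..<m}"
  define X where "X n = ereal (ln (real (min_subcover_card (join_cover f \<U> n))) / real n)" for n
  have "ereal (ln (real m) / real p) \<le> X (n * p)" if "0 < n" for n
  proof -
    have "real (m ^ n) \<le> real (min_subcover_card (join_cover f \<U> (n * p)))"
      using U(3)[of n] unfolding \<U>_def by (rule of_nat_mono)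
    moreover have "0 < real (m ^ n)" using m by simp
    ultimately have "ln (real (m ^ n)) \<le> ln (real (min_subcover_card (join_cover f \<U> (n * p))))"
      by (subst ln_le_cancel_iff) linarith+
    then have "real n * ln m / (real n * p) \<le> ln (real (min_subcover_card (join_cover f \<U> (n * p)))) / (real n * p)"
      using m by (intro divide_right_mono) (auto simp: ln_realpow)
    then show ?thesis using that by (simp add: X_def)
  qed
  then have "ereal (ln (real m) / real p) \<le> limsup (X \<circ> (\<lambda>n. n * p))"
    by (intro le_Limsup) (auto simp: eventually_sequentially intro!: exI[of _ 1])
  also have "\<dots> \<le> limsup X" by (rule limsup_subseq_mono) (use p in \<open>auto simp: strict_mono_def\<close>)
  also have "\<dots> = cover_entropy f \<U>" by (simp add: cover_entropy_def X_def[abs_def])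
  also have "\<dots> \<le> htop f"
    unfolding htop_def by (rule SUP_upper) (use U(1,2) in \<open>auto simp: \<U>_def\<close>)
  finally show ?thesis .
qed

section \<open>A metric compatible with the charts\<close>

text \<open>Continuous first partial derivatives are bounded on a closed ball; expanding vectors in
  the standard basis bounds the operator norm of the derivative, and the mean value inequality
  applies because balls are convex.\<close>

lemma smooth_on_locally_lipschitz:
  fixes g :: "real^'n::finite \<Rightarrow> real^'m::finite"
  assumes g: "smooth_on S g" and S: "open S" and x: "x \<in> S"
  shows "\<exists>r>0. \<exists>L. ball x r \<subseteq> S \<and> (\<forall>y\<in>ball x r. \<forall>z\<in>ball x r. norm (g y - g z) \<le> L * norm (y - z))"
proof -
  obtain r where r: "r > 0" "cball x r \<subseteq> S" using S x open_contains_cball by blast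
  define d where "d i y = frechet_derivative g (at y) (axis i 1)" for i y
  have diff: "g differentiable (at y)" if "y \<in> S" for y
    using g that unfolding smooth_on_def by (metis iter_partial.simps(1))
  have "\<exists>B. \<forall>y\<in>cball x r. norm (d i y) \<le> B" for i
  proof -
    have "continuous_on S (iter_partial [i] g)" using g unfolding smooth_on_def by blast
    then have "continuous_on (cball x r) (d i)"
      using r(2) by (simp add: d_def[abs_def] continuous_on_subset)
    then have "compact (d i ` cball x r)" by (rule compact_continuous_image) simp
    then show ?thesis using compact_imp_bounded bounded_iff by (metis imageI)
  qed
  then obtain B where B: "\<And>i y. y \<in> cball x r \<Longrightarrow> norm (d i y) \<le> B i" by metis
  have on: "onorm (frechet_derivative g (at y)) \<le> (\<Sum>i\<in>UNIV. B i)" if y: "y \<in> cball x r" for y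
  proof (rule onorm_le)
    fix v :: "real^'n"
    have lin: "linear (frechet_derivative g (at y))"
      using diff y r(2) by (intro linear_frechet_derivative) auto
    have "frechet_derivative g (at y) v = frechet_derivative g (at y) (\<Sum>i\<in>UNIV. v $ i *\<^sub>R axis i 1)"
      using basis_expansion[of v] by (simp add: scalar_mult_eq_scaleR)
    also have "\<dots> = (\<Sum>i\<in>UNIV. v $ i *\<^sub>R d i y)"
      by (simp add: linear_sum[OF lin] linear_scale[OF lin] d_def)
    also have "norm \<dots> \<le> (\<Sum>i\<in>UNIV. norm (v $ i *\<^sub>R d i y))" by (rule norm_sum)
    also have "\<dots> \<le> (\<Sum>i\<in>UNIV. norm v * B i)"
      unfolding norm_scaleR using B[OF y] component_le_norm_cart[of v]
      by (intro sum_mono mult_mono) auto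
    finally show "norm (frechet_derivative g (at y) v) \<le> (\<Sum>i\<in>UNIV. B i) * norm v"
      by (simp add: sum_distrib_left mult.commute)
  qed
  have "norm (g y - g z) \<le> (\<Sum>i\<in>UNIV. B i) * norm (y - z)" if "y \<in> ball x r" "z \<in> ball x r" for y z
  proof (rule differentiable_bound[where S = "ball x r" and f' = "\<lambda>y. frechet_derivative g (at y)"])
    fix y assume y: "y \<in> ball x r"
    then have "y \<in> S" using r(2) ball_subset_cball by blast
    then have "(g has_derivative frechet_derivative g (at y)) (at y)"
      using diff frechet_derivative_works by blast
    then show "(g has_derivative frechet_derivative g (at y)) (at y within ball x r)"
      by (rule has_derivative_at_withinI)
    show "onorm (frechet_derivative g (at y)) \<le> (\<Sum>i\<in>UNIV. B i)" using on y by auto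
  qed (use that in auto)
  moreover have "ball x r \<subseteq> S" using r by auto
  ultimately show ?thesis using r(1) by blast
qed

section \<open>Charts and the passage from local to global estimates\<close>

lemma is_chartD:
  assumes "is_chart (U, \<phi>)"
  shows "open U" "open (\<phi> ` U)" "inj_on \<phi> U" "continuous_on U \<phi>" "continuous_on (\<phi> ` U) (inv_into U \<phi>)"
  using assms by (auto simp: is_chart_def)

lemma open_chart_preimage:
  assumes "is_chart (U, \<phi>)" "open W"
  shows "open {x \<in> U. \<phi> x \<in> W}"
proof -
  have "{x \<in> U. \<phi> x \<in> W} = U \<inter> \<phi> -` W" by auto
  then show ?thesis
    using continuous_open_preimage[OF is_chartD(4)[OF assms(1)] is_chartD(1)[OF assms(1)] assms(2)] by simp
qed

lemma compact_chart_preimage: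
  assumes c: "is_chart (U, \<phi>)" and K: "compact K" "K \<subseteq> \<phi> ` U"
  shows "compact {x \<in> U. \<phi> x \<in> K}"
proof -
  have "{x \<in> U. \<phi> x \<in> K} = inv_into U \<phi> ` K"
    using K(2) is_chartD(3)[OF c] by (auto simp: inv_into_into f_inv_into_f image_iff inv_into_f_f Bex_def)
      (metis inv_into_f_f)
  moreover have "compact \<dots>"
    by (rule compact_continuous_image[OF continuous_on_subset[OF is_chartD(5)[OF c] K(2)] K(1)])
  ultimately show ?thesis by simp
qed

lemma compact_neighbourhood_in_open:
  fixes C W :: "'a::t2_space set"
  assumes M: "compact (UNIV :: 'a set)" and C: "compact C" "C \<subseteq> W" "open W"
  shows "\<exists>N. open N \<and> C \<subseteq> N \<and> closure N \<subseteq> W"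
proof -
  have "compact (- W)" using compact_Int_closed[OF M, of "- W"] C(3) by (simp add: closed_def)
  moreover have "C \<inter> - W = {}" using C by auto
  moreover have "Hausdorff_space (euclidean :: 'a topology)"
    unfolding Hausdorff_space_def using separation_t2 by (auto simp: disjnt_def)
  ultimately obtain N N' where N: "open N" "open N'" "C \<subseteq> N" "- W \<subseteq> N'" "N \<inter> N' = {}"
    using Hausdorff_space_compact_separation[of euclidean C "- W"] C(1) by (auto simp: disjnt_def)
  then have "closure N \<subseteq> - N'" by (intro closure_minimal) (auto simp: closed_Compl)
  with N show ?thesis by blast
qed

text \<open>Off the diagonal \<open>b\<close> is positive, so \<open>a / b\<close> is locally
  bounded by continuity; near the diagonal this is the hypothesis \<open>diag\<close>; compactness
  of \<open>K \<times> K\<close> makes the bound global. With distances for \<open>a\<close> and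
  \<open>b\<close>, local Lipschitz estimates become Lipschitz estimates on all of
  \<open>K\<close>.\<close>

lemma compact_square_comparison:
  fixes a b :: "'a::t2_space \<times> 'a \<Rightarrow> real"
  assumes K: "compact K" and a: "continuous_on (K \<times> K) a" and b: "continuous_on (K \<times> K) b"
    and nn: "\<And>x y. x \<in> K \<Longrightarrow> y \<in> K \<Longrightarrow> 0 \<le> b (x, y)"
    and pos: "\<And>x y. x \<in> K \<Longrightarrow> y \<in> K \<Longrightarrow> x \<noteq> y \<Longrightarrow> 0 < b (x, y)"
    and diag: "\<And>p. p \<in> K \<Longrightarrow> \<exists>N C. open N \<and> p \<in> N \<and> (\<forall>x\<in>N \<inter> K. \<forall>y\<in>N \<inter> K. a (x, y) \<le> C * b (x, y))"
  shows "\<exists>C>0. \<forall>x\<in>K. \<forall>y\<in>K. a (x, y) \<le> C * b (x, y)"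
proof -
  have "\<exists>N C. open N \<and> q \<in> N \<and> (\<forall>r\<in>N \<inter> K \<times> K. a r \<le> C * b r)" if q: "q \<in> K \<times> K" for q
  proof (cases "fst q = snd q")
    case True
    then obtain N C where "open N" "fst q \<in> N" "\<forall>x\<in>N \<inter> K. \<forall>y\<in>N \<inter> K. a (x, y) \<le> C * b (x, y)"
      using diag[of "fst q"] q by auto
    then show ?thesis using True by (intro exI[of _ "N \<times> N"] exI[of _ C]) (auto simp: open_Times mem_Times_iff)
  next
    case False
    then have bq: "0 < b q" using pos[of "fst q" "snd q"] q by auto
    obtain A1 where A1: "open A1" "A1 \<inter> (K \<times> K) = a -` {..< a q + 1} \<inter> (K \<times> K)"
      using a open_lessThan unfolding continuous_on_open_invariant by blast
    obtain A2 where A2: "open A2" "A2 \<inter> (K \<times> K) = b -` {b q / 2 <..} \<inter> (K \<times> K)"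
      using b open_greaterThan unfolding continuous_on_open_invariant by blast
    have qA: "q \<in> A1" "q \<in> A2" using A1 A2 q bq by auto
    let ?C = "(\<bar>a q\<bar> + 1) / (b q / 2)"
    have "a r \<le> ?C * b r" if "r \<in> (A1 \<inter> A2) \<inter> K \<times> K" for r
    proof -
      have "a r < a q + 1" "b q / 2 < b r" using that A1 A2 by blast+
      then have "a r \<le> (\<bar>a q\<bar> + 1) * 1" by simp
      also have "\<dots> \<le> (\<bar>a q\<bar> + 1) * (b r / (b q / 2))"
        using bq \<open>b q / 2 < b r\<close> by (intro mult_left_mono) auto
      also have "\<dots> = ?C * b r" by simp
      finally show ?thesis .
    qed
    then show ?thesis using A1 A2 qA by (intro exI[of _ "A1 \<inter> A2"] exI[of _ ?C]) auto
  qed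
  then obtain N C where NC: "\<And>q. q \<in> K \<times> K \<Longrightarrow> open (N q) \<and> q \<in> N q \<and> (\<forall>r\<in>N q \<inter> K \<times> K. a r \<le> C q * b r)"
    by metis
  have "compact (K \<times> K)" using K by (rule compact_Times[OF _ K])
  then obtain T where T: "T \<subseteq> K \<times> K" "finite T" "K \<times> K \<subseteq> (\<Union>q\<in>T. N q)"
    using compactE_image[of "K \<times> K" "K \<times> K" N] NC by blast
  define C' where "C' = 1 + (\<Sum>q\<in>T. \<bar>C q\<bar>)"
  have "a (x, y) \<le> C' * b (x, y)" if xy: "x \<in> K" "y \<in> K" for x y
  proof -
    obtain q where q: "q \<in> T" "(x, y) \<in> N q" using T xy by blast
    then have "a (x, y) \<le> C q * b (x, y)" using NC[of q] T xy by blast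
    also have "\<bar>C q\<bar> \<le> (\<Sum>q\<in>T. \<bar>C q\<bar>)" using q T by (intro member_le_sum) auto
    then have "C q * b (x, y) \<le> C' * b (x, y)" using nn xy by (intro mult_right_mono) (auto simp: C'_def)
    finally show ?thesis .
  qed
  moreover have "C' > 0" unfolding C'_def by (simp add: add_pos_nonneg sum_nonneg)
  ultimately show ?thesis by blast
qed

text \<open>The type of points carries only a topology, so the distance is a parameter. It is merely
  required to be continuous; compactness then forces it to induce the given topology, as
  \<open>D_nbhd\<close> shows.\<close>

locale lipschitz_manifold =
  fixes D :: "'a::t2_space \<Rightarrow> 'a \<Rightarrow> real" and \<A> :: "('a, 'n::finite) chart set"
  assumes compact_UNIV: "compact (UNIV :: 'a set)"
    and D_eq_0: "D x y = 0 \<longleftrightarrow> x = y"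
    and D_sym: "D x y = D y x"
    and D_triangle: "D x z \<le> D x y + D y z"
    and D_continuous: "continuous_on UNIV (\<lambda>p. D (fst p) (snd p))"
    and chart_cover: "\<exists>U \<phi>. (U, \<phi>) \<in> mcharts \<A> \<and> x \<in> U"
    and chart_bilip: "(U, \<phi>) \<in> mcharts \<A> \<Longrightarrow> compact K \<Longrightarrow> K \<subseteq> U \<Longrightarrow>
      \<exists>C>0. \<forall>x\<in>K. \<forall>y\<in>K. D x y \<le> C * dist (\<phi> x) (\<phi> y) \<and> dist (\<phi> x) (\<phi> y) \<le> C * D x y"

text \<open>A block of the usual embedding of a compact manifold into Euclidean space: a cut-off
  together with the cut-off chart. The first entry detects whether a point belongs to the chart
  ball; on the inner ball of radius \<open>r\<close> the value is \<open>(1, \<phi> x - z)\<close>,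
  an isometric copy of the chart.\<close>

definition bump_embedding :: "('a, 'n::finite) chart \<Rightarrow> real^'n \<Rightarrow> real \<Rightarrow> 'a \<Rightarrow> real \<times> (real^'n)" where
  "bump_embedding c z r x = (case c of (U, \<phi>) \<Rightarrow>
     if x \<in> U then (cutoff z r (2 * r) (\<phi> x), cutoff z r (2 * r) (\<phi> x) *\<^sub>R (\<phi> x - z)) else 0)"

lemma bump_embedding_lipschitz:
  fixes \<phi> :: "'a \<Rightarrow> real^'n::finite"
  assumes r: "0 < r" and U: "x \<in> U" "y \<in> U"
  shows "norm (bump_embedding (U, \<phi>) z r x - bump_embedding (U, \<phi>) z r y) \<le> (1 / r + 3) * norm (\<phi> x - \<phi> y)"
proof -
  let ?\<beta> = "cutoff z r (2 * r)"
  have "norm (bump_embedding (U, \<phi>) z r x - bump_embedding (U, \<phi>) z r y)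
      \<le> norm (?\<beta> (\<phi> x) - ?\<beta> (\<phi> y)) + norm (?\<beta> (\<phi> x) *\<^sub>R (\<phi> x - z) - ?\<beta> (\<phi> y) *\<^sub>R (\<phi> y - z))"
    using U norm_Pair_le[of "?\<beta> (\<phi> x) - ?\<beta> (\<phi> y)" "?\<beta> (\<phi> x) *\<^sub>R (\<phi> x - z) - ?\<beta> (\<phi> y) *\<^sub>R (\<phi> y - z)"]
    by (simp add: bump_embedding_def)
  also have "norm (?\<beta> (\<phi> x) - ?\<beta> (\<phi> y)) \<le> norm (\<phi> x - \<phi> y) / r"
    using cutoff_lipschitz[of r "2 * r" z "\<phi> x" "\<phi> y"] r by simp
  also have "norm (?\<beta> (\<phi> x) *\<^sub>R (\<phi> x - z) - ?\<beta> (\<phi> y) *\<^sub>R (\<phi> y - z)) \<le> (1 + 2 * r / (2 * r - r)) * norm (\<phi> x - \<phi> y)"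
    by (rule cutoff_scaleR_lipschitz) (use r in auto)
  finally show ?thesis using r by (simp add: algebra_simps)
qed

lemma bump_embedding_zero:
  assumes r: "0 < r" and x: "x \<notin> {x \<in> U. \<phi> x \<in> cball z (2 * r)}"
  shows "bump_embedding (U, \<phi>) z r x = 0"
  using x r by (auto simp: bump_embedding_def cutoff_eq_0 dist_norm norm_minus_commute zero_prod_def)

lemma bump_embedding_separates:
  assumes c: "is_chart (U, \<phi>)" and r: "0 < r" and x: "x \<in> U" "\<phi> x \<in> cball z r"
    and eq: "bump_embedding (U, \<phi>) z r x = bump_embedding (U, \<phi>) z r y"
  shows "x = y"
proof -
  have \<beta>x: "cutoff z r (2 * r) (\<phi> x) = 1"
    using x r by (intro cutoff_eq_1) (auto simp: dist_norm norm_minus_commute)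
  have y: "y \<in> U"
  proof (rule ccontr)
    assume "y \<notin> U"
    then show False using eq x \<beta>x by (simp add: bump_embedding_def zero_prod_def)
  qed
  with eq x \<beta>x have "\<phi> x = \<phi> y" by (auto simp: bump_embedding_def)
  with x y is_chartD(3)[OF c] show ?thesis by (auto dest: inj_onD)
qed

lemma bump_embedding_continuous:
  fixes \<phi> :: "'a::t2_space \<Rightarrow> real^'n::finite"
  assumes c: "is_chart (U, \<phi>)" and r: "0 < r" and sub: "cball z (2 * r) \<subseteq> \<phi> ` U"
  shows "continuous_on UNIV (bump_embedding (U, \<phi>) z r)"
proof -
  let ?u = "bump_embedding (U, \<phi>) z r"
  let ?P = "{x \<in> U. \<phi> x \<in> cball z (2 * r)}"
  have "closed ?P" by (rule compact_imp_closed[OF compact_chart_preimage[OF c _ sub]]) simp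
  then have oP: "open (- ?P)" by auto
  let ?\<beta> = "\<lambda>v. max 0 (min 1 ((2 * r - norm (v - z)) / (2 * r - r)))"
  have "continuous_on U (\<lambda>x. (?\<beta> (\<phi> x), ?\<beta> (\<phi> x) *\<^sub>R (\<phi> x - z)))"
    using r by (intro continuous_intros is_chartD(4)[OF c]) auto
  then have 1: "continuous_on U ?u"
    by (rule continuous_on_eq) (simp add: bump_embedding_def cutoff_def)
  have 2: "continuous_on (- ?P) ?u"
    by (rule continuous_on_eq[OF continuous_on_const[of _ 0]]) (use bump_embedding_zero[OF r, where U = U and \<phi> = \<phi> and z = z] in auto)
  have "continuous_on (U \<union> - ?P) ?u"
    by (rule continuous_on_open_Un[OF is_chartD(1)[OF c] oP 1 2])
  moreover have "U \<union> - ?P = UNIV" by auto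
  ultimately show ?thesis by simp
qed

lemma open_chart_image:
  assumes c: "is_chart (V, \<psi>)" and W: "open W"
  shows "open (\<psi> ` (V \<inter> W))"
proof -
  have "\<psi> ` (V \<inter> W) = \<psi> ` V \<inter> inv_into V \<psi> -` W"
    using is_chartD(3)[OF c] by (auto simp: inv_into_f_f f_inv_into_f inv_into_into image_iff)
  then show ?thesis
    using continuous_open_preimage[OF is_chartD(5)[OF c] is_chartD(2)[OF c] W] by simp
qed

lemma smooth_compat_transition_lipschitz:
  fixes c d :: "('a::topological_space, 'n::finite) chart"
  assumes c: "is_chart (V, \<psi>)" and d: "is_chart (U, \<phi>)" and cd: "smooth_compat (V, \<psi>) (U, \<phi>)"
    and p: "p \<in> U \<inter> V"
  shows "\<exists>N L. open N \<and> p \<in> N \<and> N \<subseteq> U \<inter> V \<and> 0 \<le> L \<and> (\<forall>x\<in>N. \<forall>y\<in>N. norm (\<phi> x - \<phi> y) \<le> L * norm (\<psi> x - \<psi> y))"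
proof -
  let ?S = "\<psi> ` (V \<inter> U)"
  have inj: "inj_on \<psi> V" by (rule is_chartD[OF c])
  have S: "open ?S" by (rule open_chart_image[OF c is_chartD(1)[OF d]])
  have "smooth_on ?S (\<phi> \<circ> inv_into V \<psi>)" using cd by (simp add: smooth_compat_def)
  then obtain r L where r: "0 < r" "ball (\<psi> p) r \<subseteq> ?S"
    and L: "\<And>y z. y \<in> ball (\<psi> p) r \<Longrightarrow> z \<in> ball (\<psi> p) r \<Longrightarrow>
      norm ((\<phi> \<circ> inv_into V \<psi>) y - (\<phi> \<circ> inv_into V \<psi>) z) \<le> L * norm (y - z)"
    using smooth_on_locally_lipschitz[OF _ S, of _ "\<psi> p"] p by blast
  let ?N = "{x \<in> V. \<psi> x \<in> ball (\<psi> p) r}"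
  have sub: "?N \<subseteq> U \<inter> V"
  proof
    fix x assume x: "x \<in> ?N"
    then obtain x' where "x' \<in> V \<inter> U" "\<psi> x = \<psi> x'" using r by blast
    with x inj have "x = x'" by (auto dest: inj_onD)
    with \<open>x' \<in> V \<inter> U\<close> show "x \<in> U \<inter> V" by blast
  qed
  have "norm (\<phi> x - \<phi> y) \<le> \<bar>L\<bar> * norm (\<psi> x - \<psi> y)" if "x \<in> ?N" "y \<in> ?N" for x y
  proof -
    have "norm (\<phi> x - \<phi> y) \<le> L * norm (\<psi> x - \<psi> y)"
      using L[of "\<psi> x" "\<psi> y"] that inj by (simp add: inv_into_f_f)
    also have "\<dots> \<le> \<bar>L\<bar> * norm (\<psi> x - \<psi> y)" by (intro mult_right_mono) auto
    finally show ?thesis .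
  qed
  moreover have "open ?N" by (rule open_chart_preimage[OF c]) simp
  ultimately show ?thesis using sub p r by (intro exI[of _ ?N] exI[of _ "\<bar>L\<bar>"]) auto
qed

text \<open>At points of \<open>U\<close> the Lipschitz bound in \<phi> is combined with that of the
  coordinate change; a point outside \<open>U\<close> has a neighbourhood missing the compact
  support, and there the function is 0.\<close>

lemma bump_embedding_locally_lipschitz:
  fixes \<phi> :: "'a::t2_space \<Rightarrow> real^'n::finite"
  assumes c: "is_chart (U, \<phi>)" and r: "0 < r" and sub: "cball z (2 * r) \<subseteq> \<phi> ` U"
    and d: "is_chart (V, \<psi>)" and cd: "smooth_compat (V, \<psi>) (U, \<phi>)" and p: "p \<in> V"
  shows "\<exists>N L. open N \<and> p \<in> N \<and> N \<subseteq> V \<and> 0 \<le> L \<and> (\<forall>x\<in>N. \<forall>y\<in>N.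
    norm (bump_embedding (U, \<phi>) z r x - bump_embedding (U, \<phi>) z r y) \<le> L * norm (\<psi> x - \<psi> y))"
proof (cases "p \<in> U")
  case True
  then obtain N L where N: "open N" "p \<in> N" "N \<subseteq> U \<inter> V" "0 \<le> L"
    and L: "\<And>x y. x \<in> N \<Longrightarrow> y \<in> N \<Longrightarrow> norm (\<phi> x - \<phi> y) \<le> L * norm (\<psi> x - \<psi> y)"
    using smooth_compat_transition_lipschitz[OF d c cd, of p] p by blast
  have "norm (bump_embedding (U, \<phi>) z r x - bump_embedding (U, \<phi>) z r y) \<le> (1 / r + 3) * L * norm (\<psi> x - \<psi> y)"
    if xy: "x \<in> N" "y \<in> N" for x y
  proof -
    have "norm (bump_embedding (U, \<phi>) z r x - bump_embedding (U, \<phi>) z r y) \<le> (1 / r + 3) * norm (\<phi> x - \<phi> y)"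
      by (rule bump_embedding_lipschitz[OF r]) (use xy N in auto)
    also have "\<dots> \<le> (1 / r + 3) * (L * norm (\<psi> x - \<psi> y))"
      using r by (intro mult_left_mono L xy) auto
    finally show ?thesis by (simp add: mult.assoc)
  qed
  then show ?thesis using N r by (intro exI[of _ N] exI[of _ "(1 / r + 3) * L"]) auto
next
  case False
  let ?P = "{x \<in> U. \<phi> x \<in> cball z (2 * r)}"
  have "closed ?P" by (rule compact_imp_closed[OF compact_chart_preimage[OF c _ sub]]) simp
  then have "open (V - ?P)" using is_chartD(1)[OF d] by (rule open_Diff[rotated])
  then show ?thesis
    using False p bump_embedding_zero[OF r, where U = U and \<phi> = \<phi> and z = z] by (intro exI[of _ "V - ?P"] exI[of _ 0]) auto
qed

text \<open>\<open>D\<close> is the pull-back of a norm under finitely many bump embeddings whose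
  inner balls cover the manifold. Each is locally Lipschitz in any chart, which bounds
  \<open>D\<close> above; near a given point one of them is an isometric copy of a chart, which
  bounds \<open>D\<close> below. \<open>compact_square_comparison\<close> globalises both. The bumps
  use charts of \<A>, because compatibility of a chart in \<open>mcharts\<close> is given with
  these.\<close>

lemma smooth_atlas_lipschitz_manifold:
  fixes \<A> :: "('a::t2_space, 'n::finite) chart set"
  assumes at: "smooth_atlas \<A>" and M: "compact (UNIV :: 'a set)"
  shows "\<exists>D. lipschitz_manifold D \<A>"
proof -
  have chA: "is_chart c" if "c \<in> \<A>" for c using at that by (auto simp: smooth_atlas_def)
  have sub: "\<A> \<subseteq> mcharts \<A>" using at by (auto simp: smooth_atlas_def mcharts_def)
  define good where "good = {((U, \<phi>), z, r) | U \<phi> z r. (U, \<phi>) \<in> \<A> \<and> 0 < r \<and> cball z (2 * r) \<subseteq> \<phi> ` U}"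
  have goodE: "\<exists>U \<phi> z r. i = ((U, \<phi>), z, r) \<and> (U, \<phi>) \<in> \<A> \<and> 0 < r \<and> cball z (2 * r) \<subseteq> \<phi> ` U"
    if "i \<in> good" for i using that by (simp add: good_def)
  define N :: "('a, 'n) chart \<times> (real^'n) \<times> real \<Rightarrow> 'a set"
    where "N i = (case i of ((U, \<phi>), z, r) \<Rightarrow> {x \<in> U. \<phi> x \<in> ball z r})" for i
  define u :: "('a, 'n) chart \<times> (real^'n) \<times> real \<Rightarrow> 'a \<Rightarrow> real \<times> (real^'n)"
    where "u i = (case i of (c, z, r) \<Rightarrow> bump_embedding c z r)" for i
  have oN: "open (N i)" if i: "i \<in> good" for i
  proof -
    obtain U \<phi> z r where i': "i = ((U, \<phi>), z, r)" "(U, \<phi>) \<in> \<A>" using goodE[OF i] by (elim exE conjE)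
    then show ?thesis using open_chart_preimage[OF chA[OF i'(2)], of "ball z r"] by (simp add: N_def)
  qed
  have cov: "\<exists>i\<in>good. x \<in> N i" for x
  proof -
    have "x \<in> \<Union>(fst ` \<A>)" using at by (auto simp: smooth_atlas_def)
    then obtain U \<phi> where U: "(U, \<phi>) \<in> \<A>" "x \<in> U" by auto
    then obtain e where e: "0 < e" "cball (\<phi> x) e \<subseteq> \<phi> ` U"
      using open_contains_cball_eq[OF is_chartD(2)[OF chA[OF U(1)]]] by blast
    then have "((U, \<phi>), \<phi> x, e / 2) \<in> good" using U unfolding good_def
      by (intro CollectI exI[of _ U] exI[of _ \<phi>] exI[of _ "\<phi> x"] exI[of _ "e / 2"]) simp
    then show ?thesis using U e by (intro bexI[of _ "((U, \<phi>), \<phi> x, e / 2)"]) (auto simp: N_def)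
  qed
  then obtain T where T: "T \<subseteq> good" "finite T" "UNIV \<subseteq> (\<Union>i\<in>T. N i)"
  proof -
    have "UNIV \<subseteq> (\<Union>i\<in>good. N i)" using cov by blast
    from compactE_image[OF M oN this] show ?thesis using that by blast
  qed
  define D where "D x y = (\<Sum>i\<in>T. norm (u i x - u i y))" for x y
  have u_le: "norm (u i x - u i y) \<le> D x y" if "i \<in> T" for i x y
    unfolding D_def using T(2) that member_le_sum[of i T "\<lambda>i. norm (u i x - u i y)"] by simp
  have contu: "continuous_on UNIV (u i)" if i: "i \<in> T" for i
  proof -
    obtain U \<phi> z r where i': "i = ((U, \<phi>), z, r)" "(U, \<phi>) \<in> \<A>" "0 < r" "cball z (2 * r) \<subseteq> \<phi> ` U"
      using goodE[OF subsetD[OF T(1) i]] by (elim exE conjE)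
    then show ?thesis using bump_embedding_continuous[OF chA[OF i'(2)] i'(3,4)] by (simp add: u_def)
  qed
  have contD: "continuous_on UNIV (\<lambda>p. D (fst p) (snd p))"
    unfolding D_def
    by (intro continuous_on_sum continuous_on_norm continuous_on_diff continuous_on_compose2[OF contu] continuous_on_fst
        continuous_on_snd continuous_on_id) auto
  have D0: "D x y = 0 \<longleftrightarrow> x = y" for x y
  proof
    assume D: "D x y = 0"
    obtain i where i: "i \<in> T" "x \<in> N i" using T by blast
    then obtain U \<phi> z r where i': "i = ((U, \<phi>), z, r)" "(U, \<phi>) \<in> \<A>" "0 < r"
      using goodE[OF subsetD[OF T(1) i(1)]] by (elim exE conjE)
    have "u i x = u i y" using u_le[OF i(1), of x y] D by simp
    then show "x = y"
      using bump_embedding_separates[OF chA[OF i'(2)] i'(3), of x z y] i(2) i'(1) by (auto simp: u_def N_def)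
  qed (simp add: D_def)
  have Dnn: "0 \<le> D x y" for x y by (simp add: D_def sum_nonneg)
  show ?thesis
  proof (rule exI[of _ D], unfold_locales)
    fix x y z :: 'a
    show "D x y = D y x" by (simp add: D_def norm_minus_commute)
    show "D x z \<le> D x y + D y z"
      unfolding D_def sum.distrib[symmetric] by (intro sum_mono) (metis dist_norm dist_triangle)
    show "compact (UNIV :: 'a set)" by (rule M)
    show "D x y = 0 \<longleftrightarrow> x = y" by (rule D0)
    show "continuous_on UNIV (\<lambda>p. D (fst p) (snd p))" by (rule contD)
    obtain i where i: "i \<in> good" "x \<in> N i" using cov by blast
    then obtain U \<phi> z r where "i = ((U, \<phi>), z, r)" "(U, \<phi>) \<in> \<A>" using goodE[OF i(1)] by (elim exE conjE)
    with i sub show "\<exists>U \<phi>. (U, \<phi>) \<in> mcharts \<A> \<and> x \<in> U" by (auto simp: N_def)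
  next
    fix V \<psi> and K :: "'a set"
    assume V: "(V, \<psi>) \<in> mcharts \<A>" and K: "compact K" "K \<subseteq> V"
    have c: "is_chart (V, \<psi>)" and cd: "\<And>d. d \<in> \<A> \<Longrightarrow> smooth_compat (V, \<psi>) d"
      using V by (auto simp: mcharts_def)
    have cd': "smooth_compat d (V, \<psi>)" if "d \<in> \<A>" for d
      using cd[OF that] by (cases d) (auto simp: smooth_compat_def Int_commute)
    have cont\<psi>: "continuous_on (K \<times> K) (\<lambda>q. dist (\<psi> (fst q)) (\<psi> (snd q)))"
      using K by (intro continuous_on_dist continuous_on_compose2[OF is_chartD(4)[OF c]] continuous_on_fst
        continuous_on_snd continuous_on_id) auto
    have contDK: "continuous_on (K \<times> K) (\<lambda>q. D (fst q) (snd q))"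
      by (rule continuous_on_subset[OF contD]) simp
    have pos\<psi>: "0 < dist (\<psi> x) (\<psi> y)" if "x \<in> K" "y \<in> K" "x \<noteq> y" for x y
      using is_chartD(3)[OF c] that K by (auto dest: inj_onD)
    have posD: "0 < D x y" if "x \<noteq> y" for x y using D0[of x y] Dnn[of x y] that by linarith
    obtain C1 where C1: "0 < C1" "\<And>x y. x \<in> K \<Longrightarrow> y \<in> K \<Longrightarrow> D x y \<le> C1 * dist (\<psi> x) (\<psi> y)"
    proof -
      have "\<exists>C>0. \<forall>x\<in>K. \<forall>y\<in>K. D (fst (x, y)) (snd (x, y)) \<le> C * dist (\<psi> (fst (x, y))) (\<psi> (snd (x, y)))"
      proof (rule compact_square_comparison[OF K(1) contDK cont\<psi>])
        fix p assume p: "p \<in> K"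
        have "\<forall>i\<in>T. \<exists>NL. open (fst NL) \<and> p \<in> fst NL \<and>
          (\<forall>x\<in>fst NL. \<forall>y\<in>fst NL. norm (u i x - u i y) \<le> snd NL * norm (\<psi> x - \<psi> y))"
        proof
          fix i assume i: "i \<in> T"
          obtain U \<phi> z r where i': "i = ((U, \<phi>), z, r)" "(U, \<phi>) \<in> \<A>" "0 < r" "cball z (2 * r) \<subseteq> \<phi> ` U"
            using goodE[OF subsetD[OF T(1) i]] by (elim exE conjE)
          obtain N L where "open N" "p \<in> N"
            "\<forall>x\<in>N. \<forall>y\<in>N. norm (bump_embedding (U, \<phi>) z r x - bump_embedding (U, \<phi>) z r y) \<le> L * norm (\<psi> x - \<psi> y)"
            using bump_embedding_locally_lipschitz[OF chA[OF i'(2)] i'(3,4) c cd[OF i'(2)] subsetD[OF K(2) p]]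
            by (elim exE conjE)
          then show "\<exists>NL. open (fst NL) \<and> p \<in> fst NL \<and>
            (\<forall>x\<in>fst NL. \<forall>y\<in>fst NL. norm (u i x - u i y) \<le> snd NL * norm (\<psi> x - \<psi> y))"
            by (intro exI[of _ "(N, L)"]) (simp add: u_def i')
        qed
        from bchoice[OF this] obtain NL where NL': "\<forall>i\<in>T. open (fst (NL i)) \<and> p \<in> fst (NL i) \<and>
          (\<forall>x\<in>fst (NL i). \<forall>y\<in>fst (NL i). norm (u i x - u i y) \<le> snd (NL i) * norm (\<psi> x - \<psi> y))" ..
        define N where "N i = fst (NL i)" for i
        define L where "L i = snd (NL i)" for i
        have NL: "\<And>i. i \<in> T \<Longrightarrow> open (N i) \<and> p \<in> N i"
          "\<And>i x y. i \<in> T \<Longrightarrow> x \<in> N i \<Longrightarrow> y \<in> N i \<Longrightarrow> norm (u i x - u i y) \<le> L i * norm (\<psi> x - \<psi> y)"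
          using NL' by (auto simp: N_def L_def)
        have "D x y \<le> (\<Sum>i\<in>T. L i) * dist (\<psi> x) (\<psi> y)" if "x \<in> (\<Inter>i\<in>T. N i)" "y \<in> (\<Inter>i\<in>T. N i)" for x y
          unfolding D_def sum_distrib_right dist_norm using that by (intro sum_mono NL) auto
        moreover have "open (\<Inter>i\<in>T. N i)" using NL T(2) by (intro open_INT) auto
        ultimately show "\<exists>N C. open N \<and> p \<in> N \<and> (\<forall>x\<in>N \<inter> K. \<forall>y\<in>N \<inter> K. D (fst (x, y)) (snd (x, y))
            \<le> C * dist (\<psi> (fst (x, y))) (\<psi> (snd (x, y))))"
          using NL by (intro exI[of _ "\<Inter>i\<in>T. N i"] exI[of _ "\<Sum>i\<in>T. L i"]) auto
      qed (use pos\<psi> in auto)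
      then show ?thesis using that by auto
    qed
    obtain C2 where C2: "0 < C2" "\<And>x y. x \<in> K \<Longrightarrow> y \<in> K \<Longrightarrow> dist (\<psi> x) (\<psi> y) \<le> C2 * D x y"
    proof -
      have "\<exists>C>0. \<forall>x\<in>K. \<forall>y\<in>K. dist (\<psi> (fst (x, y))) (\<psi> (snd (x, y))) \<le> C * D (fst (x, y)) (snd (x, y))"
      proof (rule compact_square_comparison[OF K(1) cont\<psi> contDK])
        fix p assume p: "p \<in> K"
        obtain i where i: "i \<in> T" "p \<in> N i" using T by blast
        then obtain U \<phi> z r where i': "i = ((U, \<phi>), z, r)" "(U, \<phi>) \<in> \<A>" "0 < r"
          using goodE[OF subsetD[OF T(1) i(1)]] by (elim exE conjE)
        have pU: "p \<in> V \<inter> U" using i i' p K by (auto simp: N_def)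
        obtain N' L where N': "open N'" "p \<in> N'" "N' \<subseteq> V \<inter> U" "0 \<le> L"
          and L: "\<And>x y. x \<in> N' \<Longrightarrow> y \<in> N' \<Longrightarrow> norm (\<psi> x - \<psi> y) \<le> L * norm (\<phi> x - \<phi> y)"
          using smooth_compat_transition_lipschitz[OF chA[OF i'(2)] c cd'[OF i'(2)] pU] by blast
        have "dist (\<psi> x) (\<psi> y) \<le> L * D x y" if xy: "x \<in> N' \<inter> N i" "y \<in> N' \<inter> N i" for x y
        proof -
          have one: "cutoff z r (2 * r) (\<phi> v) = 1" "v \<in> U" if "v \<in> N i" for v
            using that i' by (auto simp: N_def dist_norm norm_minus_commute intro!: cutoff_eq_1)
          have "norm (\<phi> x - \<phi> y) \<le> norm (u i x - u i y)"
            using one[of x] one[of y] xy by (simp add: u_def i' bump_embedding_def norm_Pair)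
          also have "\<dots> \<le> D x y" by (rule u_le[OF i(1)])
          finally have "L * norm (\<phi> x - \<phi> y) \<le> L * D x y" using N' by (intro mult_left_mono)
          with L[of x y] xy show ?thesis by (simp add: dist_norm)
        qed
        moreover have "open (N' \<inter> N i)" using N' oN[of i] i T(1) by blast
        ultimately show "\<exists>N C. open N \<and> p \<in> N \<and> (\<forall>x\<in>N \<inter> K. \<forall>y\<in>N \<inter> K. dist (\<psi> (fst (x, y))) (\<psi> (snd (x, y)))
            \<le> C * D (fst (x, y)) (snd (x, y)))"
          using N' i by (intro exI[of _ "N' \<inter> N i"] exI[of _ L]) auto
      qed (use posD Dnn in auto)
      then show ?thesis using that by auto
    qed
    have "D x y \<le> max C1 C2 * dist (\<psi> x) (\<psi> y)" "dist (\<psi> x) (\<psi> y) \<le> max C1 C2 * D x y"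
      if "x \<in> K" "y \<in> K" for x y
    proof -
      have "C1 * dist (\<psi> x) (\<psi> y) \<le> max C1 C2 * dist (\<psi> x) (\<psi> y)" by (intro mult_right_mono) auto
      with C1(2)[OF that] show "D x y \<le> max C1 C2 * dist (\<psi> x) (\<psi> y)" by linarith
      have "C2 * D x y \<le> max C1 C2 * D x y" using Dnn by (intro mult_right_mono) auto
      with C2(2)[OF that] show "dist (\<psi> x) (\<psi> y) \<le> max C1 C2 * D x y" by linarith
    qed
    then show "\<exists>C>0. \<forall>x\<in>K. \<forall>y\<in>K. D x y \<le> C * dist (\<psi> x) (\<psi> y) \<and> dist (\<psi> x) (\<psi> y) \<le> C * D x y"
      using C1(1) by (intro exI[of _ "max C1 C2"]) auto
  qed
qed

section \<open>The Hoelder-Whitney topology in terms of the metric\<close>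

lemma powr_split_le:
  fixes t B :: real
  assumes "0 \<le> t" "t \<le> B" "a \<le> 1"
  shows "t \<le> B powr (1 - a) * t powr a"
proof (cases "t = 0")
  case False
  then have "t = t powr (1 - a) * t powr a" using assms by (simp flip: powr_add)
  also have "\<dots> \<le> B powr (1 - a) * t powr a"
    using assms by (intro mult_right_mono powr_mono2) auto
  finally show ?thesis .
qed simp

lemma holder_norm_add_small:
  assumes e: "0 \<le> e" and sup: "\<And>x. x \<in> S \<Longrightarrow> norm (u x) \<le> e"
    and hol: "\<And>x y. \<alpha> \<noteq> 0 \<Longrightarrow> x \<in> S \<Longrightarrow> y \<in> S \<Longrightarrow> x \<noteq> y \<Longrightarrow> norm (u x - u y) \<le> e * dist x y powr \<alpha>"
  shows "holder_norm \<alpha> S (\<lambda>x. h x + u x) \<le> holder_norm \<alpha> S h + ereal (2 * e)"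
proof -
  let ?P = "{(x, y). x \<in> S \<and> y \<in> S \<and> x \<noteq> y}"
  let ?q = "\<lambda>h p. ereal (norm (h (fst p) - h (snd p)) / dist (fst p) (snd p) powr \<alpha>)"
  have 1: "(SUP x\<in>S. ereal (norm (h x + u x))) \<le> (SUP x\<in>S. ereal (norm (h x))) + ereal e"
  proof (rule SUP_least)
    fix x assume x: "x \<in> S"
    have "ereal (norm (h x + u x)) \<le> ereal (norm (h x)) + ereal e"
      using norm_triangle_ineq[of "h x" "u x"] sup[OF x] by simp
    also have "\<dots> \<le> (SUP x\<in>S. ereal (norm (h x))) + ereal e"
      by (intro add_right_mono SUP_upper x)
    finally show "ereal (norm (h x + u x)) \<le> (SUP x\<in>S. ereal (norm (h x))) + ereal e" .
  qed
  have 2: "(SUP p\<in>?P. ?q (\<lambda>x. h x + u x) p) \<le> (SUP p\<in>?P. ?q h p) + ereal e" if \<alpha>: "\<alpha> \<noteq> 0"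
  proof (rule SUP_least)
    fix p assume p: "p \<in> ?P"
    obtain x y where xy: "p = (x, y)" "x \<in> S" "y \<in> S" "x \<noteq> y" using p by auto
    have pos: "0 < dist x y powr \<alpha>" using xy by simp
    have "norm ((h x + u x) - (h y + u y)) \<le> norm (h x - h y) + norm (u x - u y)"
      using norm_triangle_ineq[of "h x - h y" "u x - u y"] by (simp add: algebra_simps)
    also have "\<dots> \<le> norm (h x - h y) + e * dist x y powr \<alpha>" using hol[OF \<alpha> xy(2,3,4)] by simp
    finally have "norm ((h x + u x) - (h y + u y)) / dist x y powr \<alpha> \<le> (norm (h x - h y) + e * dist x y powr \<alpha>) / dist x y powr \<alpha>"
      by (rule divide_right_mono) simp
    also have "\<dots> = norm (h x - h y) / dist x y powr \<alpha> + e"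
      using pos by (simp add: add_divide_distrib)
    finally have "norm ((h x + u x) - (h y + u y)) / dist x y powr \<alpha> \<le> norm (h x - h y) / dist x y powr \<alpha> + e" .
    then have "?q (\<lambda>x. h x + u x) p \<le> ?q h p + ereal e" by (simp add: xy)
    also have "\<dots> \<le> (SUP p\<in>?P. ?q h p) + ereal e" by (intro add_right_mono SUP_upper p)
    finally show "?q (\<lambda>x. h x + u x) p \<le> (SUP p\<in>?P. ?q h p) + ereal e" .
  qed
  have split: "ereal (2 * e) = ereal e + ereal e" by simp
  show ?thesis
  proof (cases "\<alpha> = 0")
    case True
    have "(SUP x\<in>S. ereal (norm (h x))) + ereal e \<le> (SUP x\<in>S. ereal (norm (h x))) + ereal (2 * e)"
      using e by (intro add_left_mono) simp
    with 1 True show ?thesis by (simp add: holder_norm_def del: ereal_less_eq)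
  next
    case False
    have "holder_norm \<alpha> S (\<lambda>x. h x + u x) \<le> ((SUP x\<in>S. ereal (norm (h x))) + ereal e) + ((SUP p\<in>?P. ?q h p) + ereal e)"
      using add_mono[OF 1 2[OF False]] False by (simp add: holder_norm_def)
    also have "\<dots> = holder_norm \<alpha> S h + ereal (2 * e)"
      using False unfolding split holder_norm_def by (simp only: if_False ac_simps)
    finally show ?thesis .
  qed
qed

text \<open>The second point \<open>y\<close> matters: over a one-point set with
  \<open>\<alpha> \<noteq> 0\<close> the Hoelder quotients form an empty set, its supremum is
  -\<infinity>, and the norm says nothing about \<open>h x\<close>. With two points the quotient
  part is nonnegative.\<close>

lemma norm_less_of_holder_norm_less:
  assumes h: "holder_norm \<alpha> S h < ereal \<epsilon>" and x: "x \<in> S" and y: "y \<in> S" "y \<noteq> x"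
  shows "norm (h x) < \<epsilon>"
proof -
  let ?P = "{(x, y). x \<in> S \<and> y \<in> S \<and> x \<noteq> y}"
  let ?q = "\<lambda>p. ereal (norm (h (fst p) - h (snd p)) / dist (fst p) (snd p) powr \<alpha>)"
  have "0 \<le> ?q (x, y)" by simp
  also have "\<dots> \<le> (SUP p\<in>?P. ?q p)" by (rule SUP_upper) (use x y in auto)
  finally have nn: "0 \<le> (if \<alpha> = 0 then 0 else (SUP p\<in>?P. ?q p))" by simp
  have "ereal (norm (h x)) + 0 \<le> holder_norm \<alpha> S h"
    unfolding holder_norm_def by (intro add_mono SUP_upper x nn)
  also note h
  finally show ?thesis by simp
qed

lemma mcharts_is_chart: "c \<in> mcharts \<A> \<Longrightarrow> is_chart c"
  by (simp add: mcharts_def)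

context lipschitz_manifold
begin

lemma D_self [simp]: "D x x = 0"
  by (simp add: D_eq_0)

lemma D_nonneg [simp]: "0 \<le> D x y"
  using D_triangle[of x x y] D_sym[of x y] by simp

lemma D_pos: "x \<noteq> y \<Longrightarrow> 0 < D x y"
  using D_eq_0[of x y] D_nonneg[of x y] by linarith

text \<open>On the compact product of \<open>C\<close> and the complement of \<open>W\<close>, two
  disjoint sets, the continuous \<open>D\<close> has a positive minimum.\<close>

lemma D_nbhd:
  assumes C: "compact C" "C \<subseteq> W" and W: "open W"
  shows "\<exists>\<eta>>0. \<forall>x\<in>C. \<forall>y. D x y < \<eta> \<longrightarrow> y \<in> W"
proof (cases "C \<times> (- W) = {}")
  case True
  then have "C = {} \<or> W = UNIV" by auto
  then show ?thesis by (intro exI[of _ 1]) auto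
next
  case False
  have "compact (- W)" using compact_Int_closed[OF compact_UNIV, of "- W"] W by (simp add: closed_def)
  then have "compact (C \<times> (- W))" by (rule compact_Times[OF C(1)])
  then obtain q where q: "q \<in> C \<times> (- W)" "\<And>r. r \<in> C \<times> (- W) \<Longrightarrow> D (fst q) (snd q) \<le> D (fst r) (snd r)"
    using continuous_attains_inf[OF _ False continuous_on_subset[OF D_continuous]] by (metis subset_UNIV)
  have "fst q \<noteq> snd q" using q(1) C(2) by auto
  then have "0 < D (fst q) (snd q)" by (rule D_pos)
  moreover have "y \<in> W" if "x \<in> C" "D x y < D (fst q) (snd q)" for x y
    using q(2)[of "(x, y)"] that by force
  ultimately show ?thesis by blast
qed

lemma D_bounded: "\<exists>B>0. \<forall>x y. D x y \<le> B"
proof -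
  have "compact (UNIV :: ('a \<times> 'a) set)"
    using compact_Times[OF compact_UNIV compact_UNIV] by simp
  then have "compact ((\<lambda>p. D (fst p) (snd p)) ` UNIV)"
    by (rule compact_continuous_image[OF D_continuous])
  then have "bounded ((\<lambda>p. D (fst p) (snd p)) ` UNIV)" by (rule compact_imp_bounded)
  then obtain B where B: "\<And>p. \<bar>D (fst p) (snd p)\<bar> \<le> B" by (auto simp: bounded_iff)
  have "D x y \<le> \<bar>B\<bar> + 1" for x y using B[of "(x, y)"] by simp
  then show ?thesis by (intro exI[of _ "\<bar>B\<bar> + 1"]) auto
qed

lemma open_D_ball: "open {y. D x y < r}"
proof -
  have "continuous_on UNIV (\<lambda>y. D (fst (x, y)) (snd (x, y)))"
    by (rule continuous_on_compose2[OF D_continuous]) (auto intro!: continuous_intros)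
  then show ?thesis
    using open_vimage[of "{..<r}" "\<lambda>y. D (fst (x, y)) (snd (x, y))"] by (simp add: vimage_def)
qed

lemma lipschitz_continuous:
  assumes f: "\<And>x y. D (f x) (f y) \<le> L * D x y"
  shows "continuous_on UNIV f"
proof -
  have "open (f -` W)" if W: "open W" for W
  proof (subst open_subopen, intro ballI)
    fix x assume "x \<in> f -` W"
    then obtain \<eta> where \<eta>: "0 < \<eta>" "\<And>y. D (f x) y < \<eta> \<Longrightarrow> y \<in> W"
      using D_nbhd[of "{f x}" W] W by auto
    have "y \<in> f -` W" if y: "D x y < \<eta> / (\<bar>L\<bar> + 1)" for y
    proof -
      have "D (f x) (f y) \<le> L * D x y" by (rule f)
      also have "\<dots> \<le> (\<bar>L\<bar> + 1) * D x y" by (intro mult_right_mono) auto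
      also have "\<dots> < \<eta>" using y by (simp add: pos_less_divide_eq mult.commute)
      finally show ?thesis using \<eta>(2) by auto
    qed
    moreover have "0 < \<eta> / (\<bar>L\<bar> + 1)" using \<eta>(1) by (simp add: add_nonneg_pos)
    ultimately show "\<exists>T. open T \<and> x \<in> T \<and> T \<subseteq> f -` W"
      using open_D_ball[of x "\<eta> / (\<bar>L\<bar> + 1)"] by (intro exI[of _ "{y. D x y < \<eta> / (\<bar>L\<bar> + 1)}"]) auto
  qed
  then show ?thesis by (simp add: continuous_on_open_vimage)
qed

lemma closed_compact: "closed (K :: 'a set) \<Longrightarrow> compact K"
  using compact_Int_closed[OF compact_UNIV, of K] by simp

section \<open>Bi-Lipschitz maps as Hoelder maps\<close>

definition bilip :: "real \<Rightarrow> ('a \<Rightarrow> 'a) \<Rightarrow> bool" where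
  "bilip L f \<longleftrightarrow> 0 \<le> L \<and> bij f \<and> (\<forall>x y. D (f x) (f y) \<le> L * D x y) \<and> (\<forall>x y. D x y \<le> L * D (f x) (f y))"

lemma bilip_comp:
  assumes g: "bilip C g" and h: "bilip C' h"
  shows "bilip (C * C') (g \<circ> h)"
proof -
  have nn: "0 \<le> C" "0 \<le> C'" using g h by (auto simp: bilip_def)
  have "D (g (h x)) (g (h y)) \<le> C * C' * D x y" for x y
  proof -
    have "D (g (h x)) (g (h y)) \<le> C * D (h x) (h y)"
      using g by (auto simp: bilip_def)
    also have "\<dots> \<le> C * (C' * D x y)"
      using h nn by (intro mult_left_mono) (auto simp: bilip_def)
    finally show ?thesis by (simp add: mult.assoc)
  qed
  moreover have "D x y \<le> C * C' * D (g (h x)) (g (h y))" for x y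
  proof -
    have "D x y \<le> C' * D (h x) (h y)"
      using h by (auto simp: bilip_def)
    also have "\<dots> \<le> C' * (C * D (g (h x)) (g (h y)))"
      using g nn by (intro mult_left_mono) (auto simp: bilip_def)
    finally show ?thesis by (simp add: mult_ac)
  qed
  moreover have "bij (g \<circ> h)" using g h by (auto simp: bilip_def intro: bij_comp)
  ultimately show ?thesis using nn by (auto simp: bilip_def)
qed

lemma bilip_funpow: "bilip C f \<Longrightarrow> bilip (C ^ n) (f ^^ n)"
proof (induction n)
  case 0
  then show ?case by (simp add: bilip_def id_def[symmetric])
next
  case (Suc n)
  show ?case using bilip_comp[OF Suc.prems Suc.IH[OF Suc.prems]] by (simp only: power_Suc funpow.simps)
qed

lemma bilip_inv:
  assumes "bilip C f"
  shows "bilip C (inv f)"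
proof -
  have b: "bij f" using assms by (simp add: bilip_def)
  then have "f (inv f x) = x" for x by (simp add: bij_is_surj surj_f_inv_f)
  with assms show ?thesis unfolding bilip_def using bij_imp_bij_inv[OF b] by metis
qed

lemma bilip_continuous: "bilip C f \<Longrightarrow> continuous_on UNIV f"
  by (rule lipschitz_continuous) (auto simp: bilip_def)

text \<open>The chart condition on a compact neighbourhood of a point, placed between the
  bi-Lipschitz comparisons of the source and target charts, gives a local Lipschitz bound;
  \<open>compact_square_comparison\<close>, with \<open>D (f x) (f y)\<close> against
  \<open>D x y\<close>, makes it global.\<close>

lemma holder_map_1_lipschitz:
  assumes f: "continuous_on UNIV f" and h: "holder_map \<A> 1 f"
  shows "\<exists>L>0. \<forall>x y. D (f x) (f y) \<le> L * D x y"
proof -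
  have contf: "continuous_on UNIV (\<lambda>q. D (f (fst q)) (f (snd q)))"
  proof -
    have "continuous_on UNIV (\<lambda>q. (f (fst q), f (snd q)))"
      by (intro continuous_on_Pair continuous_on_compose2[OF f] continuous_on_fst continuous_on_snd continuous_on_id) auto
    from continuous_on_compose2[OF D_continuous this] show ?thesis by simp
  qed
  have "\<exists>C>0. \<forall>x\<in>UNIV. \<forall>y\<in>UNIV. D (f (fst (x, y))) (f (snd (x, y))) \<le> C * D (fst (x, y)) (snd (x, y))"
  proof (rule compact_square_comparison[OF compact_UNIV])
    fix p :: 'a
    obtain U \<phi> where U: "(U, \<phi>) \<in> mcharts \<A>" "p \<in> U" using chart_cover by blast
    obtain V \<psi> where V: "(V, \<psi>) \<in> mcharts \<A>" "f p \<in> V" using chart_cover by blast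
    note cU = mcharts_is_chart[OF U(1)] and cV = mcharts_is_chart[OF V(1)]
    have "open (f -` V)" using f is_chartD(1)[OF cV] by (simp add: continuous_on_open_vimage)
    then have "open (U \<inter> f -` V)" using is_chartD(1)[OF cU] by blast
    then obtain N where N: "open N" "p \<in> N" "closure N \<subseteq> U \<inter> f -` V"
      using compact_neighbourhood_in_open[OF compact_UNIV, of "{p}" "U \<inter> f -` V"] U V by auto
    let ?K = "closure N"
    have K: "compact ?K" by (rule closed_compact) simp
    have fK: "compact (f ` ?K)" by (rule compact_continuous_image[OF continuous_on_subset[OF f] K]) simp
    have "compact (\<phi> ` ?K)"
      by (rule compact_continuous_image[OF continuous_on_subset[OF is_chartD(4)[OF cU]] K]) (use N in auto)
    moreover have "\<phi> ` ?K \<subseteq> \<phi> ` (U \<inter> f -` V)" using N(3) by (rule image_mono)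
    ultimately have "holder_on 1 (\<phi> ` ?K) (\<psi> \<circ> f \<circ> inv_into U \<phi>)"
      using h U(1) V(1) unfolding holder_map_def by blast
    then obtain C where C: "\<And>x y. x \<in> ?K \<Longrightarrow> y \<in> ?K \<Longrightarrow>
        norm (\<psi> (f (inv_into U \<phi> (\<phi> x))) - \<psi> (f (inv_into U \<phi> (\<phi> y)))) \<le> C * dist (\<phi> x) (\<phi> y) powr 1"
      unfolding holder_on_def by auto
    obtain C1 where C1: "C1 > 0" "\<And>x y. x \<in> ?K \<Longrightarrow> y \<in> ?K \<Longrightarrow> dist (\<phi> x) (\<phi> y) \<le> C1 * D x y"
      using chart_bilip[OF U(1) K] N by auto
    obtain C2 where C2: "C2 > 0" "\<And>x y. x \<in> f ` ?K \<Longrightarrow> y \<in> f ` ?K \<Longrightarrow> D x y \<le> C2 * dist (\<psi> x) (\<psi> y)"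
    proof -
      have "f ` ?K \<subseteq> V" using N by auto
      from chart_bilip[OF V(1) fK this] show ?thesis using that by blast
    qed
    have "D (f x) (f y) \<le> C2 * (\<bar>C\<bar> * C1) * D x y" if xy: "x \<in> N" "y \<in> N" for x y
    proof -
      have k: "x \<in> ?K" "y \<in> ?K" using xy closure_subset by auto
      then have i: "inv_into U \<phi> (\<phi> x) = x" "inv_into U \<phi> (\<phi> y) = y"
        using is_chartD(3)[OF cU] N(3) by (auto simp: inv_into_f_f)
      have "D (f x) (f y) \<le> C2 * dist (\<psi> (f x)) (\<psi> (f y))" using C2 k by auto
      also have "dist (\<psi> (f x)) (\<psi> (f y)) \<le> C * dist (\<phi> x) (\<phi> y)"
        using C[OF k] by (simp add: i dist_norm)
      also have "\<dots> \<le> \<bar>C\<bar> * (C1 * D x y)" using C1(2)[OF k] by (intro mult_mono) auto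
      finally show ?thesis using C2(1) by (simp add: mult_ac)
    qed
    then show "\<exists>N C. open N \<and> p \<in> N \<and> (\<forall>x\<in>N \<inter> UNIV. \<forall>y\<in>N \<inter> UNIV.
        D (f (fst (x, y))) (f (snd (x, y))) \<le> C * D (fst (x, y)) (snd (x, y)))"
      using N by (intro exI[of _ N] exI[of _ "C2 * (\<bar>C\<bar> * C1)"]) auto
  qed (use contf D_continuous D_pos in auto)
  then show ?thesis by auto
qed

lemma lipschitz_holder_map:
  assumes f: "\<And>x y. D (f x) (f y) \<le> L * D x y" and L: "0 \<le> L" and \<alpha>: "\<alpha> \<le> 1"
  shows "holder_map \<A> \<alpha> f"
  unfolding holder_map_def
proof (intro ballI allI impI, clarify)
  fix U \<phi> V \<psi> and K :: "(real^'n) set"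
  assume U: "(U, \<phi>) \<in> mcharts \<A>" and V: "(V, \<psi>) \<in> mcharts \<A>"
    and K: "compact K" "K \<subseteq> \<phi> ` (U \<inter> f -` V)"
  note cU = mcharts_is_chart[OF U]
  let ?K = "{x \<in> U. \<phi> x \<in> K}"
  have cK: "compact ?K" by (rule compact_chart_preimage[OF cU K(1)]) (use K(2) in auto)
  have "f ` ?K \<subseteq> V"
  proof (intro subsetI, elim imageE CollectE conjE)
    fix y x assume "y = f x" "x \<in> U" "\<phi> x \<in> K"
    moreover from this obtain x' where "\<phi> x = \<phi> x'" "x' \<in> U" "f x' \<in> V" using K(2) by blast
    ultimately show "y \<in> V" using is_chartD(3)[OF cU] by (auto dest: inj_onD)
  qed
  moreover have fK: "compact (f ` ?K)"
    by (rule compact_continuous_image[OF continuous_on_subset[OF lipschitz_continuous[OF f]] cK]) simp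
  ultimately obtain C2 where C2: "C2 > 0" "\<And>x y. x \<in> f ` ?K \<Longrightarrow> y \<in> f ` ?K \<Longrightarrow> dist (\<psi> x) (\<psi> y) \<le> C2 * D x y"
    using chart_bilip[OF V fK] by blast
  obtain C1 where C1: "C1 > 0" "\<And>x y. x \<in> ?K \<Longrightarrow> y \<in> ?K \<Longrightarrow> D x y \<le> C1 * dist (\<phi> x) (\<phi> y)"
    using chart_bilip[OF U cK] by blast
  obtain B where B: "\<And>x y. x \<in> K \<Longrightarrow> y \<in> K \<Longrightarrow> dist x y \<le> B"
    using compact_imp_bounded[OF K(1)] unfolding bounded_two_points by blast
  let ?g = "inv_into U \<phi>"
  have g: "?g x \<in> ?K" "\<phi> (?g x) = x" if "x \<in> K" for x
    using that K(2) inv_into_into[of x \<phi> U] f_inv_into_f[of x \<phi> U] by auto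
  have "norm ((\<psi> \<circ> f \<circ> ?g) x - (\<psi> \<circ> f \<circ> ?g) y) \<le> (C2 * L * C1 * B powr (1 - \<alpha>)) * dist x y powr \<alpha>"
    if xy: "x \<in> K" "y \<in> K" for x y
  proof -
    have "dist (\<psi> (f (?g x))) (\<psi> (f (?g y))) \<le> C2 * D (f (?g x)) (f (?g y))" using C2 g xy by blast
    also have "\<dots> \<le> C2 * (L * D (?g x) (?g y))" using C2(1) f by (intro mult_left_mono) auto
    also have "\<dots> \<le> C2 * (L * (C1 * dist x y))"
      using C2(1) L C1(2)[OF g(1) g(1), OF xy] g(2) xy by (intro mult_left_mono) auto
    also have "\<dots> \<le> C2 * (L * (C1 * (B powr (1 - \<alpha>) * dist x y powr \<alpha>)))"
      using C2(1) L C1(1) powr_split_le[OF _ B[OF xy] \<alpha>] by (intro mult_left_mono) auto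
    finally show ?thesis by (simp add: dist_norm mult_ac)
  qed
  then show "holder_on \<alpha> K (\<psi> \<circ> f \<circ> ?g)" unfolding holder_on_def by blast
qed

lemma bilip_Hset:
  assumes "bilip L f" "\<alpha> \<le> 1"
  shows "f \<in> Hset \<A> \<alpha>"
  using assms bilip_inv[OF assms(1)] bilip_continuous
  by (auto simp: Hset_def bilip_def intro!: lipschitz_holder_map[of _ L])

lemma Hset_1_bilip:
  assumes "f \<in> Hset \<A> 1"
  shows "\<exists>L. bilip L f"
proof -
  have f: "bij f" "continuous_on UNIV f" "continuous_on UNIV (inv f)" "holder_map \<A> 1 f" "holder_map \<A> 1 (inv f)"
    using assms by (auto simp: Hset_def)
  obtain L1 where L1: "0 < L1" "\<And>x y. D (f x) (f y) \<le> L1 * D x y" using holder_map_1_lipschitz[OF f(2,4)] by blast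
  obtain L2 where L2: "0 < L2" "\<And>x y. D (inv f x) (inv f y) \<le> L2 * D x y" using holder_map_1_lipschitz[OF f(3,5)] by blast
  have "D (f x) (f y) \<le> max L1 L2 * D x y" for x y
  proof -
    have "L1 * D x y \<le> max L1 L2 * D x y" by (intro mult_right_mono) auto
    then show ?thesis using L1(2)[of x y] by linarith
  qed
  moreover have "D x y \<le> max L1 L2 * D (f x) (f y)" for x y
  proof -
    have "inv f (f z) = z" for z using f(1) by (simp add: bij_is_inj inv_f_f)
    then have "D x y \<le> L2 * D (f x) (f y)" using L2(2)[of "f x" "f y"] by simp
    also have "\<dots> \<le> max L1 L2 * D (f x) (f y)" by (intro mult_right_mono) auto
    finally show ?thesis .
  qed
  ultimately show ?thesis using f(1) L1(1) by (intro exI[of _ "max L1 L2"]) (auto simp: bilip_def)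
qed

end

lemma ereal_less_add_gap:
  assumes "X < ereal \<epsilon>"
  shows "\<exists>d>0. X + ereal d < ereal \<epsilon>"
proof (cases X)
  case (real r)
  then show ?thesis using assms by (intro exI[of _ "(\<epsilon> - r) / 2"]) (auto simp: field_simps)
next
  case PInf
  then show ?thesis using assms by simp
next
  case MInf
  then show ?thesis by (intro exI[of _ 1]) simp
qed

text \<open>Below the scale \<open>t0\<close> the Lipschitz bound controls the Hoelder quotient, above it the sup bound
  does; this is where \<open>\<alpha> < 1\<close> is needed.\<close>

lemma holder_interpolation_scale:
  fixes \<alpha> Q e :: real
  assumes \<alpha>: "0 \<le> \<alpha>" "\<alpha> < 1" and Q: "0 \<le> Q" and e: "0 < e"
  shows "\<exists>\<kappa>>0. \<forall>t s. 0 < t \<longrightarrow> s \<le> Q * t \<longrightarrow> s \<le> \<kappa> \<longrightarrow> s \<le> e * t powr \<alpha>"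
proof -
  \<comment> \<open>Chosen so that \<open>(Q + 1) * t0 powr (1 - \<alpha>) = e\<close>; the
    threshold \<kappa> will be \<open>e * t0 powr \<alpha>\<close>.\<close>
  define t0 where "t0 = (e / (Q + 1)) powr (1 / (1 - \<alpha>))"
  have pos: "0 < e / (Q + 1)" using Q e by simp
  have t0: "0 < t0" using Q e by (simp add: t0_def)
  have "t0 powr (1 - \<alpha>) = e / (Q + 1)" using \<alpha> Q e pos by (simp add: t0_def powr_powr)
  then have "t0 powr (1 - \<alpha>) + Q * t0 powr (1 - \<alpha>) = e" using Q e by (simp add: field_simps)
  then have Qt0: "Q * t0 powr (1 - \<alpha>) \<le> e" using powr_ge_zero[of t0 "1 - \<alpha>"] by linarith
  have "s \<le> e * t powr \<alpha>" if t: "0 < t" and s: "s \<le> Q * t" "s \<le> e * t0 powr \<alpha>" for t s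
  proof (cases "t \<le> t0")
    case True
    have "Q * t \<le> Q * (t0 powr (1 - \<alpha>) * t powr \<alpha>)"
      using powr_split_le[of t t0 \<alpha>] True t \<alpha> Q by (intro mult_left_mono) auto
    also have "\<dots> \<le> e * t powr \<alpha>"
      using Qt0 by (simp add: mult_right_mono flip: mult.assoc)
    finally show ?thesis using s by linarith
  next
    case False
    then have "t0 powr \<alpha> \<le> t powr \<alpha>" using t0 \<alpha> by (intro powr_mono2) auto
    then have "e * t0 powr \<alpha> \<le> e * t powr \<alpha>" using e by (intro mult_left_mono) auto
    then show ?thesis using s by linarith
  qed
  moreover have "0 < e * t0 powr \<alpha>" using e t0 by simp
  ultimately show ?thesis by blast
qed

context lipschitz_manifold
begin

text \<open>\<open>F\<close> is the centre of a neighbourhood, and the strict inequality at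
  \<open>f\<close> leaves a gap \<open>d\<close>. In chart coordinates the difference of
  \<open>f\<close> and \<open>g\<close> has a Lipschitz constant \<open>Q\<close> fixed by
  \<open>L\<close> and \<Lambda>, so by interpolation a small sup bound makes its Hoelder quotients
  at most \<open>d / 2\<close>; the sup part takes the other half of the gap.\<close>

lemma holder_norm_stable:
  assumes U: "(U, \<phi>) \<in> mcharts \<A>" and V: "(V, \<psi>) \<in> mcharts \<A>"
    and K: "compact K" "K \<subseteq> U" and fK: "f ` K \<subseteq> V"
    and f: "\<And>x y. D (f x) (f y) \<le> L * D x y" and L: "0 \<le> L" and \<Lambda>: "0 \<le> \<Lambda>" and \<alpha>: "0 \<le> \<alpha>" "\<alpha> < 1"
    and less: "holder_norm \<alpha> (\<phi> ` K) (\<lambda>x. \<psi> (F (inv_into U \<phi> x)) - \<psi> (f (inv_into U \<phi> x))) < ereal \<epsilon>"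
  shows "\<exists>\<delta>>0. \<forall>g. (\<forall>x y. D (g x) (g y) \<le> \<Lambda> * D x y) \<longrightarrow> (\<forall>x. D (f x) (g x) \<le> \<delta>) \<longrightarrow>
    g ` K \<subseteq> V \<and> holder_norm \<alpha> (\<phi> ` K) (\<lambda>x. \<psi> (F (inv_into U \<phi> x)) - \<psi> (g (inv_into U \<phi> x))) < ereal \<epsilon>"
proof -
  let ?i = "inv_into U \<phi>"
  let ?N = "\<lambda>g. holder_norm \<alpha> (\<phi> ` K) (\<lambda>x. \<psi> (F (?i x)) - \<psi> (g (?i x)))"
  note cU = mcharts_is_chart[OF U] and cV = mcharts_is_chart[OF V]
  have cfK: "compact (f ` K)"
    by (rule compact_continuous_image[OF continuous_on_subset[OF lipschitz_continuous[OF f]] K(1)]) simp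
  \<comment> \<open>The compact closure of \<open>N\<close> will contain the images of
    \<open>K\<close> under both \<open>f\<close> and \<open>g\<close>, so that
    \<open>chart_bilip\<close> compares them in one chart.\<close>
  obtain N where N: "open N" "f ` K \<subseteq> N" "closure N \<subseteq> V"
    using compact_neighbourhood_in_open[OF compact_UNIV cfK fK is_chartD(1)[OF cV]] by blast
  have cN: "compact (closure N)" by (rule closed_compact) simp
  obtain C2 where C2: "C2 > 0" "\<And>x y. x \<in> closure N \<Longrightarrow> y \<in> closure N \<Longrightarrow> dist (\<psi> x) (\<psi> y) \<le> C2 * D x y"
    using chart_bilip[OF V cN N(3)] by blast
  obtain C1 where C1: "C1 > 0" "\<And>x y. x \<in> K \<Longrightarrow> y \<in> K \<Longrightarrow> D x y \<le> C1 * dist (\<phi> x) (\<phi> y)"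
    using chart_bilip[OF U K] by blast
  obtain \<eta> where \<eta>: "0 < \<eta>" "\<And>x y. x \<in> f ` K \<Longrightarrow> D x y < \<eta> \<Longrightarrow> y \<in> N"
    using D_nbhd[OF cfK N(2) N(1)] by blast
  obtain d where d: "0 < d" "?N f + ereal d < ereal \<epsilon>"
    using ereal_less_add_gap[OF less] by blast
  define Q where "Q = C2 * (L + \<Lambda>) * C1"
  have Q: "0 \<le> Q" using C1(1) C2(1) L \<Lambda> by (simp add: Q_def)
  obtain \<kappa> where \<kappa>: "0 < \<kappa>" "\<And>t s. 0 < t \<Longrightarrow> s \<le> Q * t \<Longrightarrow> s \<le> \<kappa> \<Longrightarrow> s \<le> d / 2 * t powr \<alpha>"
    using holder_interpolation_scale[OF \<alpha> Q, of "d / 2"] d(1) by auto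
  \<comment> \<open>\<eta> keeps the image under \<open>g\<close> in \<open>N\<close>,
    \<open>C2\<close> converts \<open>D\<close> into chart distances, and the half of \<kappa>
    allows for the two terms of \<open>u v - u w\<close>.\<close>
  define \<delta> where "\<delta> = min (\<eta> / 2) (min (d / 2) (\<kappa> / 2) / C2)"
  have \<delta>: "0 < \<delta>" "\<delta> < \<eta>" using \<eta>(1) d(1) \<kappa>(1) C2(1) by (auto simp: \<delta>_def)
  have C2\<delta>: "C2 * \<delta> \<le> d / 2" "C2 * \<delta> \<le> \<kappa> / 2"
  proof -
    have "C2 * \<delta> \<le> C2 * (min (d / 2) (\<kappa> / 2) / C2)" using C2(1) by (intro mult_left_mono) (auto simp: \<delta>_def)
    also have "\<dots> = min (d / 2) (\<kappa> / 2)" using C2(1) by simp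
    finally show "C2 * \<delta> \<le> d / 2" "C2 * \<delta> \<le> \<kappa> / 2" by auto
  qed
  show ?thesis
  proof (rule exI[of _ \<delta>], intro conjI \<delta>(1) allI impI)
    fix g assume g: "\<forall>x y. D (g x) (g y) \<le> \<Lambda> * D x y" and near: "\<forall>x. D (f x) (g x) \<le> \<delta>"
    have gN: "g x \<in> N" if "x \<in> K" for x
    proof (rule \<eta>(2)[of "f x"])
      show "D (f x) (g x) < \<eta>" using near[rule_format, of x] \<delta>(2) by linarith
    qed (use that in simp)
    then have gN': "g x \<in> closure N" if "x \<in> K" for x using closure_subset that by blast
    have fN': "f x \<in> closure N" if "x \<in> K" for x using closure_subset N(2) that by blast
    show "g ` K \<subseteq> V" using gN' N(3) by blast
    define u where "u x = \<psi> (f (?i x)) - \<psi> (g (?i x))" for x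
    have iK: "?i v \<in> K" "\<phi> (?i v) = v" if v: "v \<in> \<phi> ` K" for v
    proof -
      obtain x where x: "v = \<phi> x" "x \<in> K" using v by blast
      then have "?i v = x" using is_chartD(3)[OF cU] K(2) by (simp add: inv_into_f_f subsetD)
      with x show "?i v \<in> K" "\<phi> (?i v) = v" by auto
    qed
    have nu: "norm (u v) \<le> C2 * \<delta>" if v: "v \<in> \<phi> ` K" for v
    proof -
      have "norm (u v) \<le> C2 * D (f (?i v)) (g (?i v))"
        using C2(2)[OF fN' gN', OF iK(1) iK(1), OF v v] by (simp add: u_def dist_norm)
      also have "\<dots> \<le> C2 * \<delta>" using near C2(1) by (intro mult_left_mono) auto
      finally show ?thesis .
    qed
    have "holder_norm \<alpha> (\<phi> ` K) (\<lambda>x. (\<psi> (F (?i x)) - \<psi> (f (?i x))) + u x)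
        \<le> ?N f + ereal (2 * (d / 2))"
    proof (rule holder_norm_add_small)
      show "norm (u v) \<le> d / 2" if "v \<in> \<phi> ` K" for v using nu[OF that] C2\<delta>(1) by linarith
      fix v w assume v: "v \<in> \<phi> ` K" and w: "w \<in> \<phi> ` K" and vw: "v \<noteq> w"
      have vK: "?i v \<in> K" and wK: "?i w \<in> K" using iK(1) v w by auto
      show "norm (u v - u w) \<le> d / 2 * dist v w powr \<alpha>"
      proof (rule \<kappa>(2))
        have "norm (u v - u w) \<le> norm (\<psi> (f (?i v)) - \<psi> (f (?i w))) + norm (\<psi> (g (?i v)) - \<psi> (g (?i w)))"
          unfolding u_def
          using norm_triangle_ineq4[of "\<psi> (f (?i v)) - \<psi> (f (?i w))" "\<psi> (g (?i v)) - \<psi> (g (?i w))"]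
          by (simp add: algebra_simps)
        also have "\<dots> \<le> C2 * D (f (?i v)) (f (?i w)) + C2 * D (g (?i v)) (g (?i w))"
          using C2(2)[OF fN'[OF vK] fN'[OF wK]] C2(2)[OF gN'[OF vK] gN'[OF wK]] by (simp add: dist_norm)
        also have "\<dots> \<le> C2 * (L * D (?i v) (?i w)) + C2 * (\<Lambda> * D (?i v) (?i w))"
          using f g C2(1) by (intro add_mono mult_left_mono) auto
        also have "\<dots> = C2 * (L + \<Lambda>) * D (?i v) (?i w)" by (simp add: algebra_simps)
        also have "\<dots> \<le> C2 * (L + \<Lambda>) * (C1 * dist v w)"
          using C1(2)[OF vK wK] iK(2)[OF v] iK(2)[OF w] C2(1) L \<Lambda> by (intro mult_left_mono) auto
        finally show "norm (u v - u w) \<le> Q * dist v w" by (simp add: Q_def mult.assoc)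
        have "norm (u v - u w) \<le> norm (u v) + norm (u w)" by (rule norm_triangle_ineq4)
        then show "norm (u v - u w) \<le> \<kappa>" using nu[OF v] nu[OF w] C2\<delta>(2) by linarith
      qed (use vw in simp)
    qed (use d(1) in simp)
    then show "?N g < ereal \<epsilon>"
      using d(2) by (simp add: u_def)
  qed
qed

text \<open>\<open>holder_norm_stable\<close> is used for the maps on \<open>K\<close> and for the
  inverses on \<open>L\<close>. Closeness passes to the inverses because \<open>inv g\<close> is
  \<Lambda>-Lipschitz: with \<open>x = inv f y\<close>, the distance between
  \<open>inv f y = inv g (g x)\<close> and \<open>inv g y = inv g (f x)\<close> is at most \<Lambda>
  times that between \<open>g x\<close> and \<open>f x\<close>.\<close>

lemma HW_subbasis_bilip_stable:
  assumes B: "B \<in> HW_subbasis \<A> \<alpha>" and fB: "f \<in> B" and f: "bilip Lf f" and \<alpha>: "0 \<le> \<alpha>" "\<alpha> < 1" and \<Lambda>: "0 \<le> \<Lambda>"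
  shows "\<exists>\<delta>>0. \<forall>g. bilip \<Lambda> g \<longrightarrow> (\<forall>x. D (f x) (g x) \<le> \<delta>) \<longrightarrow> g \<in> B"
proof -
  obtain f0 U \<phi> V \<psi> K L \<epsilon> where B': "B = HW_nbhd \<A> \<alpha> f0 (U, \<phi>) (V, \<psi>) K L \<epsilon>"
    "(U, \<phi>) \<in> mcharts \<A>" "(V, \<psi>) \<in> mcharts \<A>" "compact K" "K \<subseteq> U \<inter> f0 -` V" "compact L" "L \<subseteq> f0 ` U \<inter> V"
    using B unfolding HW_subbasis_def by (elim CollectE exE conjE)
  let ?N1 = "\<lambda>g. holder_norm \<alpha> (\<phi> ` K) (\<lambda>x. \<psi> (f0 (inv_into U \<phi> x)) - \<psi> (g (inv_into U \<phi> x)))"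
  let ?N2 = "\<lambda>g. holder_norm \<alpha> (\<psi> ` L) (\<lambda>y. \<phi> (inv f0 (inv_into V \<psi> y)) - \<phi> (g (inv_into V \<psi> y)))"
  have fN: "f ` K \<subseteq> V" "inv f ` L \<subseteq> U"
    "?N1 f < ereal \<epsilon>"
    "?N2 (inv f) < ereal \<epsilon>"
    using fB unfolding B'(1) HW_nbhd_def by auto
  have sub: "K \<subseteq> U" "L \<subseteq> V" using B' by auto
  have Lf: "0 \<le> Lf" "\<And>x y. D (f x) (f y) \<le> Lf * D x y" "\<And>x y. D (inv f x) (inv f y) \<le> Lf * D x y"
    using f bilip_inv[OF f] by (auto simp: bilip_def)
  obtain \<delta>1 where \<delta>1: "0 < \<delta>1" "\<And>g. (\<forall>x y. D (g x) (g y) \<le> \<Lambda> * D x y) \<Longrightarrow> (\<forall>x. D (f x) (g x) \<le> \<delta>1) \<Longrightarrow>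
    g ` K \<subseteq> V \<and> ?N1 g < ereal \<epsilon>"
    using holder_norm_stable[OF B'(2,3,4) sub(1) fN(1) Lf(2,1) \<Lambda> \<alpha> fN(3)] by blast
  obtain \<delta>2 where \<delta>2: "0 < \<delta>2" "\<And>g. (\<forall>x y. D (g x) (g y) \<le> \<Lambda> * D x y) \<Longrightarrow> (\<forall>x. D (inv f x) (g x) \<le> \<delta>2) \<Longrightarrow>
    g ` L \<subseteq> U \<and> ?N2 g < ereal \<epsilon>"
    using holder_norm_stable[OF B'(3,2,6) sub(2) fN(2) Lf(3,1) \<Lambda> \<alpha> fN(4)] by blast
  show ?thesis
  proof (rule exI[of _ "min \<delta>1 (\<delta>2 / (\<Lambda> + 1))"], intro conjI allI impI)
    show "0 < min \<delta>1 (\<delta>2 / (\<Lambda> + 1))" using \<delta>1 \<delta>2 \<Lambda> by simp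
    fix g assume g: "bilip \<Lambda> g" and near: "\<forall>x. D (f x) (g x) \<le> min \<delta>1 (\<delta>2 / (\<Lambda> + 1))"
    have gL: "\<forall>x y. D (g x) (g y) \<le> \<Lambda> * D x y" "\<forall>x y. D (inv g x) (inv g y) \<le> \<Lambda> * D x y"
      using g bilip_inv[OF g] by (auto simp: bilip_def)
    have "D (inv f y) (inv g y) \<le> \<delta>2" for y
    proof -
      have bf: "f (inv f y) = y" using f by (simp add: bilip_def bij_is_surj surj_f_inv_f)
      have bg: "inv g (g x) = x" for x using g by (simp add: bilip_def bij_is_inj inv_f_f)
      have "D (inv f y) (inv g y) = D (inv g (g (inv f y))) (inv g (f (inv f y)))"
        by (simp add: bf bg)
      also have "\<dots> \<le> \<Lambda> * D (g (inv f y)) (f (inv f y))" using gL(2) by blast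
      also have "\<dots> \<le> (\<Lambda> + 1) * (\<delta>2 / (\<Lambda> + 1))"
        using near \<Lambda> by (intro mult_mono) (auto simp: D_sym)
      finally show ?thesis using \<Lambda> by simp
    qed
    then have "inv g ` L \<subseteq> U \<and> ?N2 (inv g) < ereal \<epsilon>"
      using \<delta>2(2)[OF gL(2)] by blast
    moreover have "g ` K \<subseteq> V \<and> ?N1 g < ereal \<epsilon>"
      using \<delta>1(2)[OF gL(1)] near by simp
    moreover have "g \<in> Hset \<A> \<alpha>" using bilip_Hset[OF g] \<alpha> by simp
    ultimately show "g \<in> B" unfolding B'(1) HW_nbhd_def by auto
  qed
qed

lemma openin_HW_bilip_stable:
  assumes G: "openin (HW_top \<A> \<alpha>) G" and fG: "f \<in> G" and f: "bilip Lf f" and \<alpha>: "0 \<le> \<alpha>" "\<alpha> < 1" and \<Lambda>: "0 \<le> \<Lambda>"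
  shows "\<exists>\<delta>>0. \<forall>g. bilip \<Lambda> g \<longrightarrow> (\<forall>x. D (f x) (g x) \<le> \<delta>) \<longrightarrow> g \<in> G"
proof -
  have "generate_topology_on (insert (Hset \<A> \<alpha>) (HW_subbasis \<A> \<alpha>)) G"
    using G by (simp add: HW_top_def openin_topology_generated_by_iff)
  then show ?thesis using fG
  proof induction
    case Empty
    then show ?case by simp
  next
    case (Int a b)
    obtain d1 where d1: "0 < d1" "\<And>g. bilip \<Lambda> g \<Longrightarrow> (\<forall>x. D (f x) (g x) \<le> d1) \<Longrightarrow> g \<in> a" using Int by blast
    obtain d2 where d2: "0 < d2" "\<And>g. bilip \<Lambda> g \<Longrightarrow> (\<forall>x. D (f x) (g x) \<le> d2) \<Longrightarrow> g \<in> b" using Int by blast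
    show ?case by (rule exI[of _ "min d1 d2"]) (use d1 d2 in auto)
  next
    case (UN K)
    then obtain k where "k \<in> K" "f \<in> k" by blast
    then show ?case using UN.IH[of k] by blast
  next
    case (Basis s)
    show ?case
    proof (cases "s = Hset \<A> \<alpha>")
      case True
      then show ?thesis using bilip_Hset \<alpha> by (intro exI[of _ 1]) auto
    next
      case False
      then show ?thesis using HW_subbasis_bilip_stable[OF _ Basis(2) f \<alpha> \<Lambda>] Basis(1) by blast
    qed
  qed
qed

section \<open>Comparison with the compact-open topology\<close>

lemma topspace_HW: "topspace (HW_top \<A> \<alpha>) = Hset \<A> \<alpha>"
proof -
  have "\<Union>(HW_subbasis \<A> \<alpha>) \<subseteq> Hset \<A> \<alpha>"
    by (auto simp: HW_subbasis_def HW_nbhd_def)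
  then show ?thesis by (auto simp: HW_top_def topology_generated_by_topspace)
qed

text \<open>Around each point of \<open>C\<close> a subbasic neighbourhood built on a small compact
  set controls the sup distance in a target chart, which keeps the images of nearby points inside
  \<open>W\<close>; finitely many such sets cover \<open>C\<close>.\<close>

lemma openin_HW_maps_compact_into_open:
  assumes C: "compact C" and W: "open W"
  shows "openin (HW_top \<A> \<alpha>) {g \<in> Hset \<A> \<alpha>. g ` C \<subseteq> W}"
proof (subst openin_subopen, intro ballI)
  fix f assume "f \<in> {g \<in> Hset \<A> \<alpha>. g ` C \<subseteq> W}"
  then have f: "f \<in> Hset \<A> \<alpha>" "f ` C \<subseteq> W" by auto
  have contf: "continuous_on UNIV f" using f(1) by (simp add: Hset_def)
  have "\<exists>NB. open (fst NB) \<and> x \<in> fst NB \<and> openin (HW_top \<A> \<alpha>) (snd NB) \<and> f \<in> snd NB \<and> (\<forall>g\<in>snd NB. g ` fst NB \<subseteq> W)"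
    if x: "x \<in> C" for x
  proof -
    obtain U \<phi> where U: "(U, \<phi>) \<in> mcharts \<A>" "x \<in> U" using chart_cover by blast
    obtain V \<psi> where V: "(V, \<psi>) \<in> mcharts \<A>" "f x \<in> V" using chart_cover by blast
    note cU = mcharts_is_chart[OF U(1)] and cV = mcharts_is_chart[OF V(1)]
    have "open (f -` (V \<inter> W))"
      using contf is_chartD(1)[OF cV] W by (simp add: continuous_on_open_vimage open_Int)
    then have "open (U \<inter> f -` (V \<inter> W))" using is_chartD(1)[OF cU] by blast
    moreover have "{x} \<subseteq> U \<inter> f -` (V \<inter> W)" using U V f(2) x by auto
    ultimately obtain N where N: "open N" "{x} \<subseteq> N" "closure N \<subseteq> U \<inter> f -` (V \<inter> W)"
      using compact_neighbourhood_in_open[OF compact_UNIV, of "{x}" "U \<inter> f -` (V \<inter> W)"] by auto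
    let ?K = "closure N"
    have K: "compact ?K" by (rule closed_compact) simp
    have "compact (\<psi> ` f ` ?K)"
    proof (rule compact_continuous_image)
      show "compact (f ` ?K)" by (rule compact_continuous_image[OF continuous_on_subset[OF contf] K]) simp
      show "continuous_on (f ` ?K) \<psi>" by (rule continuous_on_subset[OF is_chartD(4)[OF cV]]) (use N in auto)
    qed
    moreover have "\<psi> ` f ` ?K \<subseteq> \<psi> ` (V \<inter> W)" using N(3) by blast
    ultimately obtain e where e: "0 < e" "(\<Union>v\<in>\<psi> ` f ` ?K. ball v e) \<subseteq> \<psi> ` (V \<inter> W)"
      using compact_subset_open_imp_ball_epsilon_subset[OF _ open_chart_image[OF cV W]] by blast
    \<comment> \<open>The empty set is admissible for \<open>L\<close>, being the closure of the
      empty open set, and makes the conditions on the inverse void.\<close>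
    let ?B = "HW_nbhd \<A> \<alpha> f (U, \<phi>) (V, \<psi>) ?K {} e"
    have "?B \<in> HW_subbasis \<A> \<alpha>"
      unfolding HW_subbasis_def
    proof (rule CollectI, rule exI[of _ f], rule exI[of _ U], rule exI[of _ \<phi>], rule exI[of _ V], rule exI[of _ \<psi>],
        rule exI[of _ ?K], rule exI[of _ "{}"], rule exI[of _ e], intro conjI)
      show "f ` U \<inter> V \<noteq> {}" using U(2) V(2) by blast
      show "?K \<subseteq> U \<inter> f -` V" using N(3) by blast
      show "\<exists>W. open W \<and> ?K = closure W" using N(1) by blast
      show "\<exists>W::'a set. open W \<and> {} = closure W" by (rule exI[of _ "{}"]) simp
    qed (use f(1) e(1) U(1) V(1) K in simp_all)
    then have oB: "openin (HW_top \<A> \<alpha>) ?B"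
      unfolding HW_top_def by (intro topology_generated_by_Basis) simp
    \<comment> \<open>A nonempty open set of Euclidean space is no singleton, so the chart image of
      \<open>?K\<close> has the second point required by
      \<open>norm_less_of_holder_norm_less\<close>.\<close>
    have pt: "\<exists>w\<in>\<phi> ` ?K. w \<noteq> v" if "v \<in> \<phi> ` ?K" for v
    proof -
      have "open (\<phi> ` (U \<inter> N))" by (rule open_chart_image[OF cU N(1)])
      moreover have "\<phi> x \<in> \<phi> ` (U \<inter> N)" using N U by auto
      ultimately obtain w where "w \<in> \<phi> ` (U \<inter> N)" "w \<noteq> v"
        using not_open_singleton[of v] by (metis empty_iff subset_singletonD subsetI singletonI)
      then show ?thesis using closure_subset by blast
    qed
    have fB: "f \<in> ?B"
    proof -
      have "holder_norm \<alpha> (\<phi> ` ?K) (\<lambda>x. \<psi> (f (inv_into U \<phi> x)) - \<psi> (f (inv_into U \<phi> x))) \<le> 0"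
        unfolding holder_norm_def by (auto intro!: add_nonpos_nonpos SUP_least)
      also have "\<dots> < ereal e" using e(1) by simp
      finally have 1: "holder_norm \<alpha> (\<phi> ` ?K) (\<lambda>x. \<psi> (f (inv_into U \<phi> x)) - \<psi> (f (inv_into U \<phi> x))) < ereal e" .
      have "holder_norm \<alpha> (\<psi> ` {}) (\<lambda>y. \<phi> (inv f (inv_into V \<psi> y)) - \<phi> (inv f (inv_into V \<psi> y))) \<le> 0"
        unfolding holder_norm_def by (auto intro!: add_nonpos_nonpos SUP_least)
      also have "\<dots> < ereal e" using e(1) by simp
      finally show ?thesis using 1 f(1) N(3) unfolding HW_nbhd_def by auto
    qed
    have "g ` N \<subseteq> W" if g: "g \<in> ?B" for g
    proof (intro subsetI, elim imageE)
      fix y z assume z: "y = g z" "z \<in> N"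
      have zK: "z \<in> ?K" using z closure_subset by blast
      then have zU: "z \<in> U" using N by blast
      have gz: "g z \<in> V" using g zK unfolding HW_nbhd_def by auto
      obtain w where w: "w \<in> \<phi> ` ?K" "w \<noteq> \<phi> z" using pt[of "\<phi> z"] zK by blast
      have "holder_norm \<alpha> (\<phi> ` ?K) (\<lambda>x. \<psi> (f (inv_into U \<phi> x)) - \<psi> (g (inv_into U \<phi> x))) < ereal e"
        using g unfolding HW_nbhd_def by auto
      from norm_less_of_holder_norm_less[OF this _ w, of] zK zU
      have "norm (\<psi> (f z) - \<psi> (g z)) < e" using is_chartD(3)[OF cU] by (simp add: inv_into_f_f)
      then have "\<psi> (g z) \<in> ball (\<psi> (f z)) e" by (simp add: dist_norm)
      moreover have "ball (\<psi> (f z)) e \<subseteq> \<psi> ` (V \<inter> W)" using e(2) zK by blast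
      ultimately obtain v where "v \<in> V" "v \<in> W" "\<psi> (g z) = \<psi> v" by blast
      then show "y \<in> W" using gz is_chartD(3)[OF cV] z by (metis inj_onD)
    qed
    then show ?thesis using N oB fB by (intro exI[of _ "(N, ?B)"]) auto
  qed
  then have "\<forall>x\<in>C. \<exists>NB. open (fst NB) \<and> x \<in> fst NB \<and> openin (HW_top \<A> \<alpha>) (snd NB) \<and> f \<in> snd NB \<and> (\<forall>g\<in>snd NB. g ` fst NB \<subseteq> W)"
    by blast
  from bchoice[OF this] obtain NB where NB: "\<forall>x\<in>C. open (fst (NB x)) \<and> x \<in> fst (NB x) \<and>
      openin (HW_top \<A> \<alpha>) (snd (NB x)) \<and> f \<in> snd (NB x) \<and> (\<forall>g\<in>snd (NB x). g ` fst (NB x) \<subseteq> W)" ..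
  have cov: "C \<subseteq> (\<Union>x\<in>C. fst (NB x))" using NB by blast
  have "\<And>x. x \<in> C \<Longrightarrow> open (fst (NB x))" using NB by blast
  from compactE_image[OF C this cov] obtain T where T: "T \<subseteq> C" "finite T" "C \<subseteq> (\<Union>x\<in>T. fst (NB x))" by blast
  let ?G = "(\<Inter>x\<in>T. snd (NB x)) \<inter> Hset \<A> \<alpha>"
  have H: "openin (HW_top \<A> \<alpha>) (Hset \<A> \<alpha>)"
    using openin_topspace[of "HW_top \<A> \<alpha>"] by (simp add: topspace_HW)
  have "openin (HW_top \<A> \<alpha>) ?G"
  proof (cases "T = {}")
    case False
    have "openin (HW_top \<A> \<alpha>) (\<Inter>x\<in>T. snd (NB x))"
      by (rule openin_INT2[OF T(2) False]) (use NB T(1) in blast)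
    then show ?thesis using H by (rule openin_Int)
  qed (use H in simp)
  moreover have "f \<in> ?G" using NB T(1) f(1) by blast
  moreover have "g ` C \<subseteq> W" if "g \<in> ?G" for g
  proof (intro subsetI, elim imageE)
    fix y z assume z: "y = g z" "z \<in> C"
    then obtain x where "x \<in> T" "z \<in> fst (NB x)" using T(3) by blast
    with NB T(1) that z show "y \<in> W" by blast
  qed
  ultimately show "\<exists>T. openin (HW_top \<A> \<alpha>) T \<and> f \<in> T \<and> T \<subseteq> {g \<in> Hset \<A> \<alpha>. g ` C \<subseteq> W}"
    by (intro exI[of _ ?G]) auto
qed

text \<open>For \<open>Suc p\<close> an open \<open>N\<close> with compact closure is inserted
  between the image of \<open>C\<close> under \<open>f\<close> and the preimage of \<open>W\<close>
  under \<open>f ^^ p\<close>. Sending \<open>C\<close> into \<open>N\<close>, and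
  \<open>closure N\<close> into \<open>W\<close> by the \<open>p\<close>-th iterate, are open
  conditions that together imply the desired one.\<close>

lemma openin_HW_funpow_maps_compact_into_open:
  assumes "compact C" "open W"
  shows "openin (HW_top \<A> \<alpha>) {g \<in> Hset \<A> \<alpha>. (g ^^ p) ` C \<subseteq> W}"
  using assms(1)
proof (induction p arbitrary: C)
  case 0
  show ?case
  proof (cases "C \<subseteq> W")
    case True
    then show ?thesis using openin_topspace[of "HW_top \<A> \<alpha>"] by (simp add: topspace_HW)
  qed simp
next
  case (Suc p)
  show ?case
  proof (subst openin_subopen, intro ballI)
    fix f assume "f \<in> {g \<in> Hset \<A> \<alpha>. (g ^^ Suc p) ` C \<subseteq> W}"
    then have f: "f \<in> Hset \<A> \<alpha>" "(f ^^ p) ` f ` C \<subseteq> W" by (auto simp: funpow_swap1)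
    have contf: "continuous_on UNIV f" using f(1) by (simp add: Hset_def)
    have "open ((f ^^ p) -` W)"
      using continuous_on_funpow[OF contf, of p] assms(2) by (simp add: continuous_on_open_vimage)
    moreover have "compact (f ` C)"
      by (rule compact_continuous_image[OF continuous_on_subset[OF contf] Suc.prems]) simp
    ultimately obtain N where N: "open N" "f ` C \<subseteq> N" "closure N \<subseteq> (f ^^ p) -` W"
      using compact_neighbourhood_in_open[OF compact_UNIV, of "f ` C" "(f ^^ p) -` W"] f(2) by blast
    let ?G = "{g \<in> Hset \<A> \<alpha>. g ` C \<subseteq> N} \<inter> {g \<in> Hset \<A> \<alpha>. (g ^^ p) ` closure N \<subseteq> W}"
    have "openin (HW_top \<A> \<alpha>) ?G"
      by (intro openin_Int openin_HW_maps_compact_into_open Suc.IH Suc.prems N closed_compact closed_closure)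
    moreover have "f \<in> ?G" using f N by blast
    moreover have "?G \<subseteq> {g \<in> Hset \<A> \<alpha>. (g ^^ Suc p) ` C \<subseteq> W}"
    proof
      fix g assume g: "g \<in> ?G"
      have "(g ^^ Suc p) z \<in> W" if "z \<in> C" for z
      proof -
        have "g z \<in> closure N" using g that closure_subset by blast
        then have "(g ^^ p) (g z) \<in> W" using g by blast
        then show ?thesis by (simp add: funpow_swap1)
      qed
      then show "g \<in> {g \<in> Hset \<A> \<alpha>. (g ^^ Suc p) ` C \<subseteq> W}" using g by blast
    qed
    ultimately show "\<exists>T. openin (HW_top \<A> \<alpha>) T \<and> f \<in> T \<and> T \<subseteq> {g \<in> Hset \<A> \<alpha>. (g ^^ Suc p) ` C \<subseteq> W}"
      by blast
  qed
qed

lemma openin_HW_crosses: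
  assumes fr: "horseshoe_frame m D' Q \<xi> a b"
  shows "openin (HW_top \<A> \<alpha>) {g \<in> Hset \<A> \<alpha>. crosses m D' Q \<xi> a b (g ^^ p)}"
proof -
  have D': "compact D'" and Q: "open Q" using fr unfolding horseshoe_frame_def by blast+
  have contU: "continuous_on (D' \<union> Q) \<xi>" using fr unfolding horseshoe_frame_def by blast
  have contD: "continuous_on D' \<xi>" and contQ: "continuous_on Q \<xi>"
    by (rule continuous_on_subset[OF contU], simp)+
  have oL: "open {y \<in> Q. \<xi> y < -1}" "open {y \<in> Q. 1 < \<xi> y}"
    using continuous_open_preimage[OF contQ Q, of "{..<-1}"] continuous_open_preimage[OF contQ Q, of "{1<..}"]
    by (simp_all add: Int_def vimage_def)
  have cl: "compact {x \<in> D'. \<xi> x = c}" for c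
    by (rule closedin_compact[OF D' continuous_closedin_preimage_constant[OF contD]])
  let ?S = "\<lambda>C W. {g \<in> Hset \<A> \<alpha>. (g ^^ p) ` C \<subseteq> W}"
  let ?L = "\<lambda>k. ?S {x \<in> D'. \<xi> x = a k} {y \<in> Q. \<xi> y < -1} \<inter>
    ?S {x \<in> D'. \<xi> x = b k} {y \<in> Q. 1 < \<xi> y}"
  have fin: "openin (HW_top \<A> \<alpha>) (?S D' Q \<inter> (\<Inter>k\<in>{..<n}. ?L k))" for n
  proof (induction n)
    case 0
    show ?case using openin_HW_funpow_maps_compact_into_open[OF D' Q] by simp
  next
    case (Suc n)
    have "openin (HW_top \<A> \<alpha>) ((?S D' Q \<inter> (\<Inter>k\<in>{..<n}. ?L k)) \<inter> (?L n))"
      by (intro openin_Int Suc openin_HW_funpow_maps_compact_into_open cl oL)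
    then show ?case by (simp only: lessThan_Suc INT_insert Int_ac)
  qed
  have "{g \<in> Hset \<A> \<alpha>. crosses m D' Q \<xi> a b (g ^^ p)} =
    ?S D' Q \<inter> (\<Inter>k\<in>{..<m}. ?L k)"
    unfolding crosses_def by blast
  with fin[of m] show ?thesis by simp
qed

end

section \<open>Local perturbations of bi-Lipschitz homeomorphisms\<close>

lemma supported_bilip_inv:
  assumes "supported_bilip C S h"
  shows "supported_bilip C S (inv h)"
proof -
  have b: "bij h" using assms by (simp add: supported_bilip_def)
  then have r: "h (inv h x) = x" for x by (simp add: bij_is_surj surj_f_inv_f)
  have l: "inv h (h x) = x" for x using b by (simp add: bij_is_inj inv_f_f)
  have "dist (inv h x) (inv h y) \<le> C * dist x y" "dist x y \<le> C * dist (inv h x) (inv h y)" for x y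
    using assms r unfolding supported_bilip_def by metis+
  moreover have "inv h x = x" if "x \<notin> S" for x
    using assms l[of x] that unfolding supported_bilip_def by auto
  ultimately show ?thesis using bij_imp_bij_inv[OF b] assms by (auto simp: supported_bilip_def)
qed

definition transplant :: "'a set \<Rightarrow> ('a \<Rightarrow> 'v) \<Rightarrow> ('v \<Rightarrow> 'v) \<Rightarrow> 'a \<Rightarrow> 'a" where
  "transplant U \<phi> h x = (if x \<in> U then inv_into U \<phi> (h (\<phi> x)) else x)"

lemma transplant_in_chart:
  assumes inj: "inj_on \<phi> U" and h: "supported_bilip C S h" and S: "S \<subseteq> \<phi> ` U" and x: "x \<in> U"
  shows "transplant U \<phi> h x \<in> U" "\<phi> (transplant U \<phi> h x) = h (\<phi> x)"
proof -
  have "h (\<phi> x) \<in> \<phi> ` U"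
  proof (cases "\<phi> x \<in> S")
    case True
    then show ?thesis using supported_bilip_maps_into[OF h True] S by blast
  next
    case False
    then show ?thesis using h x by (simp add: supported_bilip_def)
  qed
  then show "transplant U \<phi> h x \<in> U" "\<phi> (transplant U \<phi> h x) = h (\<phi> x)"
    using x by (simp_all add: transplant_def inv_into_into f_inv_into_f)
qed

lemma transplant_outside:
  assumes inj: "inj_on \<phi> U" and h: "supported_bilip C S h" and x: "x \<notin> U \<or> \<phi> x \<notin> S"
  shows "transplant U \<phi> h x = x"
  using x h inj by (auto simp: transplant_def supported_bilip_def inv_into_f_f)

lemma transplant_inverse:
  assumes inj: "inj_on \<phi> U" and h: "supported_bilip C S h" and S: "S \<subseteq> \<phi> ` U"
  shows "transplant U \<phi> (inv h) (transplant U \<phi> h x) = x" "transplant U \<phi> h (transplant U \<phi> (inv h) x) = x"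
proof -
  note h' = supported_bilip_inv[OF h]
  have b: "bij h" using h by (simp add: supported_bilip_def)
  have r: "h (inv h y) = y" and l: "inv h (h y) = y" for y
    using b by (simp_all add: bij_is_surj surj_f_inv_f bij_is_inj inv_f_f)
  show "transplant U \<phi> (inv h) (transplant U \<phi> h x) = x"
  proof (cases "x \<in> U")
    case True
    have "transplant U \<phi> (inv h) (transplant U \<phi> h x) = inv_into U \<phi> (inv h (h (\<phi> x)))"
      using transplant_in_chart[OF inj h S True] by (simp add: transplant_def[of U \<phi> "inv h"])
    then show ?thesis using True inj by (simp add: l inv_into_f_f)
  qed (simp add: transplant_def)
  show "transplant U \<phi> h (transplant U \<phi> (inv h) x) = x"
  proof (cases "x \<in> U")
    case True
    have "transplant U \<phi> h (transplant U \<phi> (inv h) x) = inv_into U \<phi> (h (inv h (\<phi> x)))"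
      using transplant_in_chart[OF inj h' S True] by (simp add: transplant_def[of U \<phi> h])
    then show ?thesis using True inj by (simp add: r inv_into_f_f)
  qed (simp add: transplant_def)
qed

lemma compact_space_accumulation_point:
  fixes X :: "nat \<Rightarrow> 'a::topological_space"
  assumes "compact (UNIV :: 'a set)"
  shows "\<exists>p. \<forall>W. open W \<longrightarrow> p \<in> W \<longrightarrow> infinite {k. X k \<in> W}"
proof (rule ccontr)
  assume "\<not> ?thesis"
  then have "\<forall>p. \<exists>W. open W \<and> p \<in> W \<and> finite {k. X k \<in> W}" by blast
  from choice[OF this] obtain W where W: "\<And>p. open (W p)" "\<And>p. p \<in> W p" "\<And>p. finite {k. X k \<in> W p}" by blast
  have "UNIV \<subseteq> (\<Union>p\<in>UNIV. W p)" using W(2) by blast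
  from compactE_image[OF assms W(1) this] obtain T where T: "finite T" "UNIV \<subseteq> (\<Union>p\<in>T. W p)" .
  have "k \<in> (\<Union>p\<in>T. {k. X k \<in> W p})" for k using subsetD[OF T(2) UNIV_I, of "X k"] by simp
  then have "UNIV = (\<Union>p\<in>T. {k. X k \<in> W p})" by blast
  also have "finite \<dots>" using T(1) W(3) by simp
  finally show False by simp
qed

text \<open>By the parallelogram identity the squared distances of \<open>y\<close> from
  \<open>v\<close> and \<open>w\<close> sum to at most \<open>2 * 9/25 + 1/2 = 61/50\<close> times
  the square of \<open>dist v w\<close>, less than \<open>2 * 16/25 = 64/50\<close> times it. The
  ball is the support of the push: a point in it is substantially closer to \<open>v\<close> or to
  \<open>w\<close> than these are to each other.\<close>

lemma midpoint_lens:
  fixes v w y :: "'v::real_inner"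
  assumes y: "y \<in> cball (midpoint v w) (3/5 * dist v w)"
  shows "dist y v \<le> 4/5 * dist v w \<or> dist y w \<le> 4/5 * dist v w"
proof (rule ccontr)
  assume "\<not> ?thesis"
  then have "4/5 * dist v w \<le> dist y v" "4/5 * dist v w \<le> dist y w" and lt: "4/5 * dist v w < dist y v" by auto
  then have "(4/5 * dist v w)\<^sup>2 < (dist y v)\<^sup>2" "(4/5 * dist v w)\<^sup>2 \<le> (dist y w)\<^sup>2"
    by (auto intro!: power_mono power_strict_mono)
  moreover have "(dist y v)\<^sup>2 + (dist y w)\<^sup>2 = 2 * (dist y (midpoint v w))\<^sup>2 + (dist v w)\<^sup>2 / 2"
    unfolding dist_norm power2_norm_eq_inner midpoint_def
    by (simp add: inner_simps inner_commute field_simps)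
  moreover have "(dist y (midpoint v w))\<^sup>2 \<le> (3/5 * dist v w)\<^sup>2"
    using y by (intro power_mono) (auto simp: dist_commute)
  moreover have "(4/5 * dist v w)\<^sup>2 = 16/25 * (dist v w)\<^sup>2" "(3/5 * dist v w)\<^sup>2 = 9/25 * (dist v w)\<^sup>2"
    by (simp_all add: power2_eq_square)
  ultimately have "2 * (16/25 * (dist v w)\<^sup>2) < 2 * (9/25 * (dist v w)\<^sup>2) + (dist v w)\<^sup>2 / 2"
    by linarith
  then show False using zero_le_power2[of "dist v w"] by linarith
qed

context lipschitz_manifold
begin

text \<open>The constant \<open>c\<close> depends on the chart ball only. If both points lie in the
  ball of radius \<open>R\<close>, distances are compared in the chart; if both lie off the ball of
  radius \<open>R / 2\<close>, nothing moves; otherwise one lies in the small ball and the other off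
  the large one, so their distance is at least some \<open>c0\<close>, while no distance exceeds
  \<open>B\<close>. The inverse is the transplant of \<open>inv h\<close>, with the same
  bounds.\<close>

lemma transplant_bilip:
  assumes U: "(U, \<phi>) \<in> mcharts \<A>" and sub: "cball z0 R \<subseteq> \<phi> ` U" and R: "0 < R"
  shows "\<exists>c>0. \<forall>C z r h. cball z r \<subseteq> cball z0 (R / 2) \<longrightarrow> 0 \<le> r \<longrightarrow> supported_bilip C (cball z r) h \<longrightarrow>
    bilip (c * (C + 1)) (transplant U \<phi> h) \<and> (\<forall>x. D x (transplant U \<phi> h x) \<le> c * r)"
proof -
  note cU = mcharts_is_chart[OF U]
  note inj = is_chartD(3)[OF cU]
  define P where "P = {x \<in> U. \<phi> x \<in> cball z0 R}"
  define Q where "Q = {x \<in> U. \<phi> x \<in> cball z0 (R / 2)}"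
  define P' where "P' = {x \<in> U. \<phi> x \<in> ball z0 R}"
  have cP: "compact P" unfolding P_def by (rule compact_chart_preimage[OF cU _ sub]) simp
  have "cball z0 (R / 2) \<subseteq> cball z0 R" using R by (intro subset_cball) simp
  then have cQ: "compact Q" unfolding Q_def by (intro compact_chart_preimage[OF cU]) (use sub in auto)
  have P': "open P'" unfolding P'_def by (rule open_chart_preimage[OF cU]) simp
  have QP': "Q \<subseteq> P'" using R by (auto simp: Q_def P'_def)
  have P'P: "P' \<subseteq> P" by (auto simp: P'_def P_def)
  obtain c1 where c1: "0 < c1" "\<And>x y. x \<in> P \<Longrightarrow> y \<in> P \<Longrightarrow> D x y \<le> c1 * dist (\<phi> x) (\<phi> y)"
    "\<And>x y. x \<in> P \<Longrightarrow> y \<in> P \<Longrightarrow> dist (\<phi> x) (\<phi> y) \<le> c1 * D x y"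
    using chart_bilip[OF U cP] unfolding P_def by blast
  obtain c0 where c0: "0 < c0" "\<And>x y. x \<in> Q \<Longrightarrow> D x y < c0 \<Longrightarrow> y \<in> P'"
    using D_nbhd[OF cQ QP' P'] by blast
  obtain B where B: "0 < B" "\<And>x y. D x y \<le> B" using D_bounded by blast
  define c where "c = c1 * c1 + B / c0 + 1 + 2 * c1"
  have c: "0 < c" "c1 * c1 \<le> c" "B / c0 \<le> c" "1 \<le> c" "2 * c1 \<le> c"
    using c1(1) B(1) c0(1) by (auto simp: c_def intro!: add_pos_pos add_nonneg_nonneg)
  have lip: "D (transplant U \<phi> h x) (transplant U \<phi> h y) \<le> c * (C + 1) * D x y"
    if h: "supported_bilip C (cball z0 (R / 2)) h" for C h x y
  proof -
    let ?T = "transplant U \<phi> h"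
    have C: "0 \<le> C" using h by (simp add: supported_bilip_def)
    have sub2: "cball z0 (R / 2) \<subseteq> \<phi> ` U" using sub \<open>cball z0 (R / 2) \<subseteq> cball z0 R\<close> by blast
    have hR: "supported_bilip C (cball z0 R) h"
      using h \<open>cball z0 (R / 2) \<subseteq> cball z0 R\<close> unfolding supported_bilip_def by blast
    have TQ: "?T x = x" if "x \<notin> Q" for x
      by (rule transplant_outside[OF inj h]) (use that in \<open>auto simp: Q_def\<close>)
    have far: "D (?T x) (?T y) \<le> c * (C + 1) * D x y" if "x \<in> Q" "y \<notin> P" for x y
    proof -
      have "c0 \<le> D x y" using c0(2)[of x y] that P'P by force
      then have "B \<le> B / c0 * D x y" using c0(1) B(1) by (simp add: field_simps)
      also have "\<dots> \<le> c * (C + 1) * D x y"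
        using c C by (intro mult_right_mono order_trans[OF c(3)]) (auto simp: mult_le_cancel_left1)
      finally show ?thesis using B(2)[of "?T x" "?T y"] by linarith
    qed
    consider "x \<in> P" "y \<in> P" | "x \<notin> Q" "y \<notin> Q" | "x \<in> Q" "y \<notin> P" | "y \<in> Q" "x \<notin> P"
      using QP' P'P by blast
    then show ?thesis
    proof cases
      case 1
      then have xU: "x \<in> U" "y \<in> U" by (auto simp: P_def)
      have TP: "?T x \<in> P" if "x \<in> P" for x
        using transplant_in_chart[OF inj hR sub, of x] supported_bilip_maps_into[OF hR, of "\<phi> x"] that
        unfolding P_def by simp
      have "D (?T x) (?T y) \<le> c1 * dist (h (\<phi> x)) (h (\<phi> y))"
        using c1(2)[OF TP TP, OF 1] transplant_in_chart(2)[OF inj h sub2] xU by simp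
      also have "\<dots> \<le> c1 * (C * (c1 * D x y))"
      proof (intro mult_left_mono)
        have "dist (h (\<phi> x)) (h (\<phi> y)) \<le> C * dist (\<phi> x) (\<phi> y)" using h by (simp add: supported_bilip_def)
        also have "\<dots> \<le> C * (c1 * D x y)" using c1(3)[OF 1] C by (intro mult_left_mono)
        finally show "dist (h (\<phi> x)) (h (\<phi> y)) \<le> C * (c1 * D x y)" .
      qed (use c1 in simp)
      also have "\<dots> = (c1 * c1) * C * D x y" by simp
      also have "\<dots> \<le> c * (C + 1) * D x y"
        using c C c1(1) by (intro mult_right_mono mult_mono) auto
      finally show ?thesis .
    next
      case 2
      have "1 * 1 * D x y \<le> c * (C + 1) * D x y" using c C by (intro mult_right_mono mult_mono) auto
      then show ?thesis using TQ 2 by simp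
    next
      case 3
      then show ?thesis by (rule far)
    next
      case 4
      then show ?thesis using far[of y x] by (simp add: D_sym)
    qed
  qed
  show ?thesis
  proof (rule exI[of _ c], intro conjI c(1) allI impI)
    fix C z r and h :: "real^'n \<Rightarrow> real^'n"
    assume zr: "cball z r \<subseteq> cball z0 (R / 2)" and r: "0 \<le> r" and h: "supported_bilip C (cball z r) h"
    let ?T = "transplant U \<phi> h"
    have h2: "supported_bilip C (cball z0 (R / 2)) h" using h zr unfolding supported_bilip_def by blast
    have h2': "supported_bilip C (cball z0 (R / 2)) (inv h)" by (rule supported_bilip_inv[OF h2])
    have C: "0 \<le> C" using h by (simp add: supported_bilip_def)
    have subz: "cball z r \<subseteq> \<phi> ` U" using zr sub \<open>cball z0 (R / 2) \<subseteq> cball z0 R\<close> by blast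
    note Ti = transplant_inverse[OF inj h subz]
    have "bij ?T" by (rule bij_betw_byWitness[where f' = "transplant U \<phi> (inv h)"]) (use Ti in auto)
    moreover have "D x y \<le> c * (C + 1) * D (?T x) (?T y)" for x y
      using lip[OF h2', of "?T x" "?T y"] by (simp add: Ti)
    ultimately show "bilip (c * (C + 1)) ?T" using lip[OF h2] c C by (simp add: bilip_def)
    fix x
    show "D x (?T x) \<le> c * r"
    proof (cases "x \<in> U \<and> \<phi> x \<in> cball z r")
      case True
      have hx: "h (\<phi> x) \<in> cball z r" by (rule supported_bilip_maps_into[OF h]) (use True in simp)
      have TU: "?T x \<in> U" "\<phi> (?T x) = h (\<phi> x)" using transplant_in_chart[OF inj h subz, of x] True by auto
      have "cball z r \<subseteq> cball z0 R" using zr \<open>cball z0 (R / 2) \<subseteq> cball z0 R\<close> by blast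
      then have "x \<in> P" "?T x \<in> P" using True TU hx unfolding P_def by auto
      then have "D x (?T x) \<le> c1 * dist (\<phi> x) (h (\<phi> x))" using c1(2)[of x "?T x"] TU by simp
      also have "\<dots> \<le> c1 * (2 * r)"
        using True hx c1(1) dist_triangle3[of "\<phi> x" "h (\<phi> x)" z] by (intro mult_left_mono) auto
      also have "\<dots> \<le> c * r" using c(5) r mult_right_mono[OF c(5) r] by simp
      finally show ?thesis .
    next
      case False
      then have "?T x = x" by (intro transplant_outside[OF inj h]) auto
      then show ?thesis using c r by simp
    qed
  qed
qed

text \<open>The minimised quantity \<open>q\<close> is the distance of two orbit points divided by
  the smaller of their distances to the sphere of radius \<open>R / 4\<close>. An intermediate orbit
  point in the support of the push would lie within \<open>4/5 * d\<close> of an end and still at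
  least \<open>9/10 * \<mu>\<close> from the sphere, giving a quotient at most 8/9 of the minimum.
  The weight keeps the support inside the sphere, so that every orbit point in it competes.\<close>

lemma closing:
  assumes f: "bilip L f"
  shows "\<exists>\<Lambda>. \<forall>\<delta>>0. \<exists>g. bilip \<Lambda> g \<and> (\<forall>x. D (f x) (g x) \<le> \<delta>) \<and> (\<exists>q n. 0 < n \<and> (g ^^ n) q = q)"
proof (cases "\<exists>q n. 0 < n \<and> (f ^^ n) q = q")
  case True
  then show ?thesis using f by (intro exI[of _ L] allI impI exI[of _ f]) auto
next
  case False
  \<comment> \<open>Any starting point will do; without periodic points its orbit never
    repeats.\<close>
  define X where "X k = (f ^^ k) (undefined :: 'a)" for k
  have X_Suc: "X (Suc k) = f (X k)" for k by (simp add: X_def)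
  have inj: "X i \<noteq> X j" if "i < j" for i j
  proof
    assume "X i = X j"
    then have "(f ^^ i) undefined = (f ^^ i) ((f ^^ (j - i)) undefined)"
      using that by (simp add: X_def flip: funpow_add[THEN fun_cong, unfolded o_apply])
    moreover have "inj (f ^^ i)" using bilip_funpow[OF f, of i] by (simp add: bilip_def bij_is_inj)
    ultimately have "(f ^^ (j - i)) undefined = (undefined :: 'a)" by (auto dest: injD)
    moreover have "0 < j - i" using that by simp
    ultimately show False using False by blast
  qed
  obtain p where p: "\<And>W. open W \<Longrightarrow> p \<in> W \<Longrightarrow> infinite {k. X k \<in> W}"
    using compact_space_accumulation_point[OF compact_UNIV, of X] by blast
  obtain U \<phi> where U: "(U, \<phi>) \<in> mcharts \<A>" "p \<in> U" using chart_cover by blast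
  note cU = mcharts_is_chart[OF U(1)]
  obtain R where R: "0 < R" "cball (\<phi> p) R \<subseteq> \<phi> ` U"
    using open_contains_cball_eq[OF is_chartD(2)[OF cU]] U(2) by blast
  let ?z = "\<phi> p"
  obtain c where c: "0 < c" "\<And>C z r h. cball z r \<subseteq> cball ?z (R / 2) \<Longrightarrow> 0 \<le> r \<Longrightarrow> supported_bilip C (cball z r) h \<Longrightarrow>
    bilip (c * (C + 1)) (transplant U \<phi> h) \<and> (\<forall>x. D x (transplant U \<phi> h x) \<le> c * r)"
    using transplant_bilip[OF U(1) R(2,1)] by blast
  show ?thesis
  proof (rule exI[of _ "c * (2 ^ 20 + 1) * L"], intro allI impI)
    fix \<delta> :: real assume \<delta>: "0 < \<delta>"
    \<comment> \<open>\<kappa> bounds the minimal quotient: 1/10 gives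
      \<open>d \<le> \<mu> / 10\<close>, needed in the comparison, and the other entry bounds the
      displacement by \<delta>.\<close>
    define \<kappa> where "\<kappa> = min (1/10) (\<delta> / (c * R))"
    have \<kappa>: "0 < \<kappa>" "\<kappa> \<le> 1/10" using \<delta> c(1) R(1) unfolding \<kappa>_def by (simp, intro min.cobounded1)
    have \<kappa>\<delta>: "c * R * \<kappa> \<le> \<delta>"
    proof -
      have "c * R * \<kappa> \<le> c * R * (\<delta> / (c * R))" using c(1) R(1) unfolding \<kappa>_def by (intro mult_left_mono min.cobounded2) simp
      then show ?thesis using c R by simp
    qed
    \<comment> \<open>Two points within \<eta> of the centre are at most \<open>2 * \<eta>\<close>
      apart and at least \<open>R / 8\<close> from the sphere, so their quotient is at most
      \<kappa>.\<close>
    define \<eta> where "\<eta> = \<kappa> * R / 16"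
    have \<eta>: "0 < \<eta>" "\<eta> \<le> R / 8" using \<kappa> R mult_right_mono[OF \<kappa>(2), of R] by (auto simp: \<eta>_def)
    have "infinite {k. X k \<in> {x \<in> U. \<phi> x \<in> ball ?z \<eta>}}"
      by (rule p[OF open_chart_preimage[OF cU]]) (use U \<eta> in auto)
    then obtain i j where ij: "X i \<in> U" "\<phi> (X i) \<in> ball ?z \<eta>" "X j \<in> U" "\<phi> (X j) \<in> ball ?z \<eta>" "i < j"
      unfolding infinite_nat_iff_unbounded by (metis (mono_tags, lifting) mem_Collect_eq)
    define \<rho> where "\<rho> k = R / 4 - dist ?z (\<phi> (X k))" for k
    define A where "A = {k \<in> {i..j}. X k \<in> U \<and> 0 < \<rho> k}"
    define q where "q ab = dist (\<phi> (X (fst ab))) (\<phi> (X (snd ab))) / min (\<rho> (fst ab)) (\<rho> (snd ab))" for ab :: "nat \<times> nat"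
    define S where "S = {ab \<in> A \<times> A. fst ab < snd ab}"
    have "finite A" by (simp add: A_def)
    then have fS: "finite S" by (simp add: S_def)
    have \<rho>ij: "R / 8 \<le> \<rho> i" "R / 8 \<le> \<rho> j" using ij \<eta> by (auto simp: \<rho>_def)
    then have ijS: "(i, j) \<in> S" using ij R by (auto simp: S_def A_def)
    have "q (i, j) \<le> \<kappa>"
    proof -
      have "dist (\<phi> (X i)) (\<phi> (X j)) \<le> dist ?z (\<phi> (X i)) + dist ?z (\<phi> (X j))" by (rule dist_triangle3)
      also have "\<dots> \<le> 2 * \<eta>" using ij by auto
      finally have "q (i, j) \<le> 2 * \<eta> / (R / 8)"
        unfolding q_def using \<rho>ij R \<eta> by (intro frac_le) auto
      then show ?thesis using R by (simp add: \<eta>_def)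
    qed
    obtain ab where ab: "ab \<in> S" "\<And>cd. cd \<in> S \<Longrightarrow> q ab \<le> q cd"
      using ex_is_arg_min_if_finite[OF fS, of q] ijS unfolding is_arg_min_linorder by blast
    obtain a b where abp: "ab = (a, b)" by (cases ab)
    have aA: "a \<in> A" and bA: "b \<in> A" and lt: "a < b" using ab(1) by (auto simp: S_def abp)
    define v w where "v = \<phi> (X a)" and "w = \<phi> (X b)"
    define d where "d = dist v w"
    define \<mu> where "\<mu> = min (\<rho> a) (\<rho> b)"
    have XU: "X a \<in> U" "X b \<in> U" using aA bA by (auto simp: A_def)
    have "v \<noteq> w" unfolding v_def w_def using is_chartD(3)[OF cU] XU inj[OF lt] by (auto dest: inj_onD)
    then have d: "0 < d" by (simp add: d_def)
    have \<mu>: "0 < \<mu>" "\<mu> \<le> R / 4" using aA bA by (auto simp: \<mu>_def A_def \<rho>_def min_def)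
    have qab: "q ab = d / \<mu>" by (simp add: q_def abp d_def \<mu>_def v_def w_def)
    have "d / \<mu> \<le> \<kappa>" using ab(2)[OF ijS] \<open>q (i, j) \<le> \<kappa>\<close> qab by linarith
    then have d\<mu>: "d \<le> \<kappa> * \<mu>" using \<mu> by (simp add: pos_divide_le_eq)
    also have "\<dots> \<le> 1/10 * \<mu>" using \<kappa> \<mu> by (intro mult_right_mono) auto
    finally have d10: "d \<le> \<mu> / 10" by simp
    have "\<kappa> * \<mu> \<le> \<kappa> * (R / 4)" using \<mu>(2) \<kappa>(1) by (intro mult_left_mono) auto
    then have dR: "d \<le> \<kappa> * R / 4" using d\<mu> by linarith
    let ?m = "midpoint v w"
    have avoid: "X k \<notin> U \<or> \<phi> (X k) \<notin> cball ?m (3/5 * d)" if k: "a < k" "k < b" for k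
    proof (rule ccontr)
      assume "\<not> ?thesis"
      then have kU: "X k \<in> U" and "\<phi> (X k) \<in> cball ?m (3/5 * dist v w)" by (auto simp: d_def)
      from midpoint_lens[OF this(2)] obtain e where e: "e = a \<or> e = b" "dist (\<phi> (X k)) (\<phi> (X e)) \<le> 4/5 * d"
        unfolding v_def w_def d_def by blast
      have "\<mu> \<le> \<rho> e" using e(1) by (auto simp: \<mu>_def)
      moreover have "dist ?z (\<phi> (X k)) \<le> dist ?z (\<phi> (X e)) + dist (\<phi> (X k)) (\<phi> (X e))"
        by (metis dist_commute dist_triangle)
      ultimately have \<rho>k: "9/10 * \<mu> \<le> \<rho> k" using e(2) d10 \<mu> unfolding \<rho>_def by linarith
      have "k \<in> {i..j}" using k aA bA by (auto simp: A_def)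
      then have kA: "k \<in> A" using kU \<rho>k \<mu> by (simp add: A_def)
      \<comment> \<open>Pairs in \<open>S\<close> are ordered in time: \<open>k\<close> is paired
        with the end it is close to, \<open>a\<close> before it or \<open>b\<close> after
        it.\<close>
      define cd where "cd = (if e = a then (a, k) else (k, b))"
      have "cd \<in> S" using e k kA aA bA by (auto simp: S_def cd_def)
      then have "d / \<mu> \<le> q cd" using ab(2)[of cd] qab by simp
      also have "q cd \<le> (4/5 * d) / (9/10 * \<mu>)"
      proof -
        have "q cd = dist (\<phi> (X k)) (\<phi> (X e)) / min (\<rho> k) (\<rho> e)"
          using e(1) by (auto simp: q_def cd_def dist_commute min.commute)
        also have "\<dots> \<le> (4/5 * d) / (9/10 * \<mu>)"
          using e(2) \<rho>k \<open>\<mu> \<le> \<rho> e\<close> \<mu> d by (intro frac_le) auto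
        finally show ?thesis .
      qed
      finally show False using d \<mu> by (simp add: field_simps)
    qed
    obtain h where h: "supported_bilip (2 ^ 20) (cball ?m (3/5 * d)) h" "h w = v"
      using supported_bilip_push[OF \<open>v \<noteq> w\<close>] unfolding d_def by blast
    have subm: "cball ?m (3/5 * d) \<subseteq> cball ?z (R / 2)"
    proof
      fix y assume y: "y \<in> cball ?m (3/5 * d)"
      have "dist ?z y \<le> dist ?z v + dist v ?m + dist ?m y"
        using dist_triangle[of ?z y v] dist_triangle[of v y ?m] by linarith
      moreover have "dist v ?m = d / 2" by (simp add: d_def dist_midpoint)
      moreover have "dist ?z v \<le> R / 4 - \<mu>" by (auto simp: \<mu>_def \<rho>_def v_def)
      ultimately show "y \<in> cball ?z (R / 2)" using y d10 \<mu> R by auto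
    qed
    let ?T = "transplant U \<phi> h"
    have T: "bilip (c * (2 ^ 20 + 1)) ?T" "\<And>x. D x (?T x) \<le> c * (3/5 * d)"
      using c(2)[OF subm _ h(1)] d by auto
    define g where "g = ?T \<circ> f"
    have "bilip (c * (2 ^ 20 + 1) * L) g" unfolding g_def by (rule bilip_comp[OF T(1) f])
    moreover have "D (f x) (g x) \<le> \<delta>" for x
    proof -
      have "D (f x) (g x) \<le> c * (3/5 * d)" using T(2) by (simp add: g_def)
      also have "\<dots> \<le> c * (\<kappa> * R)" using dR d c(1) by (intro mult_left_mono) auto
      also have "\<dots> \<le> \<delta>" using \<kappa>\<delta> by (simp add: mult_ac)
      finally show ?thesis .
    qed
    moreover have "(g ^^ (b - a)) (X a) = X a"
    proof -
      \<comment> \<open>Points strictly between \<open>X a\<close> and \<open>X b\<close> on the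
        orbit are not moved, so the orbit of \<open>X a\<close> under \<open>g\<close> follows
        \<open>X\<close> until the last step, where the push sends \<open>X b\<close> back to
        \<open>X a\<close>.\<close>
      have step: "?T (X k) = X k" if "a < k" "k < b" for k
        by (rule transplant_outside[OF is_chartD(3)[OF cU] h(1) avoid[OF that]])
      have orb: "(g ^^ t) (X a) = X (a + t)" if "t < b - a" for t
        using that
      proof (induction t)
        case (Suc t)
        then have "(g ^^ Suc t) (X a) = g (X (a + t))" by simp
        also have "\<dots> = ?T (X (Suc (a + t)))" by (simp add: g_def X_Suc)
        also have "\<dots> = X (Suc (a + t))" by (rule step) (use Suc.prems in auto)
        finally show ?case by simp
      qed simp
      obtain t where t: "b - a = Suc t" using lt by (cases "b - a") auto
      have "(g ^^ (b - a)) (X a) = g (X (a + t))" using orb[of t] t by simp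
      also have "\<dots> = ?T (X (Suc (a + t)))" by (simp add: g_def X_Suc)
      also have "Suc (a + t) = b" using t lt by simp
      also have "?T (X b) = X a"
        using XU h(2) is_chartD(3)[OF cU] by (simp add: transplant_def v_def w_def inv_into_f_f)
      finally show ?thesis .
    qed
    ultimately show "\<exists>g. bilip (c * (2 ^ 20 + 1) * L) g \<and> (\<forall>x. D (f x) (g x) \<le> \<delta>) \<and> (\<exists>q n. 0 < n \<and> (g ^^ n) q = q)"
      using lt by (intro exI[of _ g] conjI exI[of _ "X a"] exI[of _ "b - a"]) auto
  qed
qed

end

section \<open>Creating a horseshoe at a periodic point\<close>

lemma periodic_point_disjoint_nbhd:
  fixes f :: "'a::t2_space \<Rightarrow> 'a"
  assumes f: "continuous_on UNIV f" and q: "\<And>i. 0 < i \<Longrightarrow> i < n \<Longrightarrow> (f ^^ i) q \<noteq> q"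
  shows "\<exists>W. open W \<and> q \<in> W \<and> (\<forall>i x. 0 < i \<longrightarrow> i < n \<longrightarrow> x \<in> W \<longrightarrow> (f ^^ i) x \<notin> W)"
proof -
  have "\<exists>W. open W \<and> q \<in> W \<and> (\<forall>x\<in>W. (f ^^ i) x \<notin> W)" if i: "i \<in> {0<..<n}" for i
  proof -
    obtain A B where AB: "open A" "open B" "(f ^^ i) q \<in> A" "q \<in> B" "A \<inter> B = {}"
      using q[of i] i hausdorff[of "(f ^^ i) q" q] by auto
    have "open ((f ^^ i) -` A)"
      using continuous_on_funpow[OF f, of i] AB(1) by (simp add: continuous_on_open_vimage)
    then have "open (B \<inter> (f ^^ i) -` A)" using AB(2) by blast
    then show ?thesis using AB by (intro exI[of _ "B \<inter> (f ^^ i) -` A"]) auto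
  qed
  then have "\<forall>i\<in>{0<..<n}. \<exists>W. open W \<and> q \<in> W \<and> (\<forall>x\<in>W. (f ^^ i) x \<notin> W)" by blast
  from bchoice[OF this] obtain W where W: "\<forall>i\<in>{0<..<n}. open (W i) \<and> q \<in> W i \<and> (\<forall>x\<in>W i. (f ^^ i) x \<notin> W i)" ..
  have "open (\<Inter>i\<in>{0<..<n}. W i)" using W by (intro open_INT) auto
  moreover have "q \<in> (\<Inter>i\<in>{0<..<n}. W i)" using W by blast
  moreover have "(f ^^ i) x \<notin> (\<Inter>i\<in>{0<..<n}. W i)" if "0 < i" "i < n" "x \<in> (\<Inter>i\<in>{0<..<n}. W i)" for i x
  proof -
    have i: "i \<in> {0<..<n}" using that by simp
    then have "x \<in> W i" using that(3) by blast
    then show ?thesis using W i by blast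
  qed
  ultimately show ?thesis by blast
qed

lemma chart_cball_nbhd:
  assumes c: "is_chart (U, \<phi>)" and W: "open W" "q \<in> U \<inter> W"
  shows "\<exists>r>0. cball (\<phi> q) r \<subseteq> \<phi> ` U \<and> {x \<in> U. \<phi> x \<in> cball (\<phi> q) r} \<subseteq> W"
proof -
  have "\<phi> q \<in> \<phi> ` (U \<inter> W)" using W(2) by (rule imageI)
  then obtain r where r: "0 < r" "cball (\<phi> q) r \<subseteq> \<phi> ` (U \<inter> W)"
    using open_contains_cball_eq[OF open_chart_image[OF c W(1)]] by blast
  have "{x \<in> U. \<phi> x \<in> cball (\<phi> q) r} \<subseteq> W"
  proof (intro subsetI, elim CollectE conjE)
    fix x assume x: "x \<in> U" "\<phi> x \<in> cball (\<phi> q) r"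
    then obtain y where "y \<in> U" "y \<in> W" "\<phi> x = \<phi> y" using r(2) by blast
    with x(1) is_chartD(3)[OF c] show "x \<in> W" by (auto dest: inj_onD)
  qed
  with r show ?thesis by blast
qed

context lipschitz_manifold
begin

text \<open>In chart coordinates rescaled by \<open>s\<close> the return map becomes a \<Gamma>
  fixing 0, with a bi-Lipschitz constant \<open>L1\<close> independent of \<open>s\<close>. So
  \<open>C\<close>, \<open>A\<close> and \<tau> are obtained before \<delta>, and only the scale at
  which the perturbation is transplanted depends on \<delta>.\<close>

lemma horseshoe_at_periodic_point:
  assumes f: "bilip L f" and n: "0 < n" "(f ^^ n) q = q" "\<And>i. 0 < i \<Longrightarrow> i < n \<Longrightarrow> (f ^^ i) q \<noteq> q"
    and dim: "CARD('n) \<ge> 2" and m: "0 < m"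
  shows "\<exists>\<Lambda>. \<forall>\<delta>>0. \<exists>g D' Q \<xi> a b. bilip \<Lambda> g \<and> (\<forall>x. D (f x) (g x) \<le> \<delta>) \<and>
    horseshoe_frame m D' Q \<xi> a b \<and> crosses m D' Q \<xi> a b (g ^^ n)"
proof -
  have contf: "continuous_on UNIV f" by (rule bilip_continuous[OF f])
  obtain i j :: 'n where ij: "i \<noteq> j"
    using card_le_Suc0_iff_eq[of "UNIV :: 'n set"] dim by force
  define e1 e2 :: "real^'n" where "e1 = axis i 1" and "e2 = axis j 1"
  have e: "norm e1 = 1" "norm e2 = 1" "e1 \<bullet> e2 = 0" using ij by (auto simp: e1_def e2_def inner_axis_axis)
  have e11: "e1 \<bullet> e1 = 1" by (simp add: e1_def inner_axis_axis)
  define p where "p y = y - (y \<bullet> e1) *\<^sub>R e1" for y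
  obtain U \<phi> where U: "(U, \<phi>) \<in> mcharts \<A>" "q \<in> U" using chart_cover by blast
  note cU = mcharts_is_chart[OF U(1)]
  note inj = is_chartD(3)[OF cU]
  let ?z = "\<phi> q"
  obtain W where W: "open W" "q \<in> W" "\<And>i x. 0 < i \<Longrightarrow> i < n \<Longrightarrow> x \<in> W \<Longrightarrow> (f ^^ i) x \<notin> W"
    using periodic_point_disjoint_nbhd[OF contf n(3)] by blast
  obtain R where R: "0 < R" "cball ?z R \<subseteq> \<phi> ` U" "{x \<in> U. \<phi> x \<in> cball ?z R} \<subseteq> W"
    using chart_cball_nbhd[OF cU W(1)] U(2) W(2) by blast
  obtain c where c: "0 < c" "\<And>C z r h. cball z r \<subseteq> cball ?z (R / 2) \<Longrightarrow> 0 \<le> r \<Longrightarrow> supported_bilip C (cball z r) h \<Longrightarrow>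
    bilip (c * (C + 1)) (transplant U \<phi> h) \<and> (\<forall>x. D x (transplant U \<phi> h x) \<le> c * r)"
    using transplant_bilip[OF U(1) R(2,1)] by blast
  define P where "P = {x \<in> U. \<phi> x \<in> cball ?z R}"
  have cP: "compact P" unfolding P_def by (rule compact_chart_preimage[OF cU _ R(2)]) simp
  have PU: "P \<subseteq> U" by (auto simp: P_def)
  obtain c1 where c1: "0 < c1" "\<And>x y. x \<in> P \<Longrightarrow> y \<in> P \<Longrightarrow> D x y \<le> c1 * dist (\<phi> x) (\<phi> y)"
    "\<And>x y. x \<in> P \<Longrightarrow> y \<in> P \<Longrightarrow> dist (\<phi> x) (\<phi> y) \<le> c1 * D x y"
    using chart_bilip[OF U(1) cP PU] by blast
  define G where "G = f ^^ n"
  have G: "bilip (L ^ n) G" unfolding G_def by (rule bilip_funpow[OF f])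
  have Gq: "G q = q" by (simp add: G_def n(2))
  have "open (G -` {x \<in> U. \<phi> x \<in> ball ?z R})"
    using open_vimage[OF open_chart_preimage[OF cU open_ball] bilip_continuous[OF G]] .
  moreover have "q \<in> U \<inter> G -` {x \<in> U. \<phi> x \<in> ball ?z R}" using U(2) R(1) Gq by simp
  ultimately obtain r1 where r1: "0 < r1" "{x \<in> U. \<phi> x \<in> cball ?z r1} \<subseteq> G -` {x \<in> U. \<phi> x \<in> ball ?z R}"
    using chart_cball_nbhd[OF cU] by blast
  have GP: "G x \<in> P" if "x \<in> U" "\<phi> x \<in> cball ?z r1" for x
    using r1(2) that unfolding P_def by auto
  define L1 where "L1 = c1 * L ^ n * c1 + 1"
  have Ln: "0 \<le> L ^ n" using G by (simp add: bilip_def)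
  have L1: "1 \<le> L1" using c1(1) Ln by (simp add: L1_def)
  obtain C A \<tau> where A: "2 \<le> A" "0 < \<tau>" "\<tau> \<le> 1"
    and hp: "\<And>\<Gamma> :: real^'n \<Rightarrow> real^'n. \<Gamma> 0 = 0 \<and> (\<forall>x\<in>cball 0 2. \<forall>y\<in>cball 0 2. norm (\<Gamma> x - \<Gamma> y) \<le> L1 * norm (x - y) \<and>
              norm (x - y) \<le> L1 * norm (\<Gamma> x - \<Gamma> y)) \<Longrightarrow>
      (\<exists>h. supported_bilip C (cball 0 A) h \<and>
        (\<forall>x. \<bar>x \<bullet> e1\<bar> \<le> 1 \<and> norm (p x) \<le> \<tau> \<longrightarrow>
            norm (h (\<Gamma> x)) \<le> A \<and> norm (p (h (\<Gamma> x))) < \<tau> \<and>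
            (\<forall>k<m. (x \<bullet> e1 = real (2 * k) / real (2 * m) \<longrightarrow> h (\<Gamma> x) \<bullet> e1 < -1) \<and>
                   (x \<bullet> e1 = real (2 * k + 1) / real (2 * m) \<longrightarrow> 1 < h (\<Gamma> x) \<bullet> e1))))"
    using horseshoe_perturbation[OF e L1 m] unfolding p_def by blast
  show ?thesis
  proof (rule exI[of _ "c * (C + 1) * L"], intro allI impI)
    fix \<delta> :: real assume \<delta>: "0 < \<delta>"
    \<comment> \<open>The three entries put the support, of radius \<open>s * A\<close>, into the
      ball of radius \<open>R / 2\<close>; make the return map send the ball of radius
      \<open>2 * s\<close> into \<open>P\<close>; and bound the displacement
      \<open>c * (s * A)\<close> by \<delta>.\<close>
    define s where "s = min (R / (2 * A)) (min (r1 / 2) (\<delta> / (c * A)))"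
    have s: "0 < s" using R(1) r1(1) \<delta> c(1) A(1) by (simp add: s_def)
    have sA: "s * A \<le> R / 2"
    proof -
      have "s * A \<le> R / (2 * A) * A" using A(1) unfolding s_def by (intro mult_right_mono min.cobounded1) simp
      then show ?thesis using A(1) by simp
    qed
    have s1: "2 * s \<le> r1"
    proof -
      have "s \<le> r1 / 2" unfolding s_def by (meson min.cobounded1 min.coboundedI2)
      then show ?thesis by simp
    qed
    have s\<delta>: "c * (s * A) \<le> \<delta>"
    proof -
      have "s \<le> \<delta> / (c * A)" unfolding s_def by (meson min.cobounded2 min.coboundedI2)
      then have "s * (c * A) \<le> \<delta> / (c * A) * (c * A)" using A(1) c(1) by (intro mult_right_mono) auto
      then show ?thesis using A(1) c(1) by (simp add: mult_ac)
    qed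
    have s2: "2 * s \<le> R" using sA mult_left_mono[OF A(1) less_imp_le[OF s]] s by linarith
    define Y where "Y x = (1 / s) *\<^sub>R (\<phi> x - ?z)" for x
    have \<phi>Y: "\<phi> x = ?z + s *\<^sub>R Y x" for x using s by (simp add: Y_def)
    have distY: "dist ?z (\<phi> x) = s * norm (Y x)" for x
      unfolding \<phi>Y[of x] using s by (simp add: dist_norm)
    define inv\<phi> where "inv\<phi> y = inv_into U \<phi> (?z + s *\<^sub>R y)" for y
    have inv\<phi>: "inv\<phi> y \<in> U" "Y (inv\<phi> y) = y" if y: "s * norm y \<le> R" for y
    proof -
      have "?z + s *\<^sub>R y \<in> cball ?z R" using y s by (simp add: dist_norm)
      then have "?z + s *\<^sub>R y \<in> \<phi> ` U" using R(2) by blast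
      then show "inv\<phi> y \<in> U" "Y (inv\<phi> y) = y"
        using s by (simp_all add: inv\<phi>_def Y_def inv_into_into f_inv_into_f)
    qed
    have inv\<phi>Y: "inv\<phi> (Y x) = x" if "x \<in> U" for x
      using that inj by (simp add: inv\<phi>_def inv_into_f_f flip: \<phi>Y)
    define \<Gamma> where "\<Gamma> y = Y (G (inv\<phi> y))" for y
    have small: "s * norm y \<le> R" "s * norm y \<le> r1" if "norm y \<le> 2" for y :: "real^'n"
      using mult_left_mono[OF that less_imp_le[OF s]] s1 s2 by linarith+
    have distYY: "dist (\<phi> x) (\<phi> y) = s * norm (Y x - Y y)" for x y
      using s unfolding \<phi>Y[of x] \<phi>Y[of y] by (simp add: dist_norm flip: scaleR_diff_right)
    have "\<Gamma> 0 = 0 \<and> (\<forall>x\<in>cball 0 2. \<forall>y\<in>cball 0 2. norm (\<Gamma> x - \<Gamma> y) \<le> L1 * norm (x - y) \<and>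
              norm (x - y) \<le> L1 * norm (\<Gamma> x - \<Gamma> y))"
    proof (intro conjI ballI)
      show "\<Gamma> 0 = 0" using U(2) inj Gq by (simp add: \<Gamma>_def inv\<phi>_def inv_into_f_f Y_def)
      fix x y :: "real^'n" assume "x \<in> cball 0 2" "y \<in> cball 0 2"
      then have xy: "norm x \<le> 2" "norm y \<le> 2" by auto
      let ?x = "inv\<phi> x" and ?y = "inv\<phi> y"
      have i: "?x \<in> U" "?y \<in> U" "Y ?x = x" "Y ?y = y" using inv\<phi> small xy by auto
      have "\<phi> ?x \<in> cball ?z r1" "\<phi> ?y \<in> cball ?z r1" using small xy i by (simp_all add: distY)
      then have g: "G ?x \<in> P" "G ?y \<in> P" using GP i by auto
      have P: "?x \<in> P" "?y \<in> P" using i small xy by (simp_all add: P_def distY)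
      have up: "D (G ?x) (G ?y) \<le> L ^ n * D ?x ?y" and lo: "D ?x ?y \<le> L ^ n * D (G ?x) (G ?y)"
        using G by (auto simp: bilip_def)
      have "dist (\<phi> (G ?x)) (\<phi> (G ?y)) \<le> c1 * D (G ?x) (G ?y)" by (rule c1(3)[OF g])
      also have "\<dots> \<le> c1 * (L ^ n * D ?x ?y)" using up c1(1) by (intro mult_left_mono) auto
      also have "\<dots> \<le> c1 * (L ^ n * (c1 * dist (\<phi> ?x) (\<phi> ?y)))"
        using c1(2)[OF P] c1(1) Ln by (intro mult_left_mono) auto
      also have "\<dots> = (c1 * L ^ n * c1) * dist (\<phi> ?x) (\<phi> ?y)" by simp
      also have "\<dots> \<le> L1 * dist (\<phi> ?x) (\<phi> ?y)" by (intro mult_right_mono) (auto simp: L1_def)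
      finally show "norm (\<Gamma> x - \<Gamma> y) \<le> L1 * norm (x - y)" using s by (simp add: distYY i \<Gamma>_def)
      have "dist (\<phi> ?x) (\<phi> ?y) \<le> c1 * D ?x ?y" by (rule c1(3)[OF P])
      also have "\<dots> \<le> c1 * (L ^ n * D (G ?x) (G ?y))" using lo c1(1) by (intro mult_left_mono) auto
      also have "\<dots> \<le> c1 * (L ^ n * (c1 * dist (\<phi> (G ?x)) (\<phi> (G ?y))))"
        using c1(2)[OF g] c1(1) Ln by (intro mult_left_mono) auto
      also have "\<dots> = (c1 * L ^ n * c1) * dist (\<phi> (G ?x)) (\<phi> (G ?y))" by simp
      also have "\<dots> \<le> L1 * dist (\<phi> (G ?x)) (\<phi> (G ?y))" by (intro mult_right_mono) (auto simp: L1_def)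
      finally show "norm (x - y) \<le> L1 * norm (\<Gamma> x - \<Gamma> y)" using s by (simp add: distYY i \<Gamma>_def)
    qed
    from hp[OF this] obtain h0 where h0: "supported_bilip C (cball 0 A) h0"
      and h0': "\<And>x. \<bar>x \<bullet> e1\<bar> \<le> 1 \<Longrightarrow> norm (p x) \<le> \<tau> \<Longrightarrow> norm (h0 (\<Gamma> x)) \<le> A \<and> norm (p (h0 (\<Gamma> x))) < \<tau>"
      and h0l: "\<And>x k. \<bar>x \<bullet> e1\<bar> \<le> 1 \<Longrightarrow> norm (p x) \<le> \<tau> \<Longrightarrow> k < m \<Longrightarrow> x \<bullet> e1 = real (2 * k) / real (2 * m) \<Longrightarrow> h0 (\<Gamma> x) \<bullet> e1 < -1"
      and h0r: "\<And>x k. \<bar>x \<bullet> e1\<bar> \<le> 1 \<Longrightarrow> norm (p x) \<le> \<tau> \<Longrightarrow> k < m \<Longrightarrow> x \<bullet> e1 = real (2 * k + 1) / real (2 * m) \<Longrightarrow> 1 < h0 (\<Gamma> x) \<bullet> e1"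
      by blast
    define h where "h v = ?z + s *\<^sub>R h0 ((1 / s) *\<^sub>R (v - ?z))" for v
    have h: "supported_bilip C (cball ?z (s * A)) h"
      unfolding h_def by (rule scaleR_conjugate_supported_bilip[OF h0 s])
    have sub: "cball ?z (s * A) \<subseteq> cball ?z (R / 2)" using sA by (rule subset_cball)
    have "cball ?z (R / 2) \<subseteq> cball ?z R" using R(1) by (intro subset_cball) simp
    then have subU: "cball ?z (s * A) \<subseteq> \<phi> ` U" using sub R(2) by blast
    define T where "T = transplant U \<phi> h"
    have sA0: "0 \<le> s * A" using s A(1) by simp
    have T: "bilip (c * (C + 1)) T" "\<And>x. D x (T x) \<le> c * (s * A)"
      using c(2)[OF sub sA0 h] unfolding T_def by auto
    have YT: "T x \<in> U" "Y (T x) = h0 (Y x)" if "x \<in> U" for x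
      using transplant_in_chart[OF inj h subU that] s unfolding T_def by (simp_all add: Y_def h_def)
    define g where "g = T \<circ> f"
    have bg: "bilip (c * (C + 1) * L) g" unfolding g_def by (rule bilip_comp[OF T(1) f])
    have near: "D (f x) (g x) \<le> \<delta>" for x using T(2)[of "f x"] s\<delta> unfolding g_def by simp
    \<comment> \<open>In rescaled coordinates \<open>D'\<close> is a closed tube over [-1, 1].
      \<open>Q\<close> is an open tube of the same radius \<tau>, long enough for the images, which
      have norm at most \<open>A\<close> and overshoot -1 and 1.\<close>
    define D' where "D' = {x \<in> U. \<bar>Y x \<bullet> e1\<bar> \<le> 1 \<and> norm (p (Y x)) \<le> \<tau>}"
    define Q where "Q = {x \<in> U. norm (Y x) < 2 * A \<and> norm (p (Y x)) < \<tau>}"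
    define \<xi> where "\<xi> x = Y x \<bullet> e1" for x
    define a where "a k = real (2 * k) / real (2 * m)" for k
    define b where "b k = real (2 * k + 1) / real (2 * m)" for k
    have normD': "norm y \<le> 2" if "\<bar>y \<bullet> e1\<bar> \<le> 1" "norm (p y) \<le> \<tau>" for y
    proof -
      have "norm y \<le> norm ((y \<bullet> e1) *\<^sub>R e1) + norm (p y)" unfolding p_def by (rule norm_triangle_sub)
      then show ?thesis using that e(1) A(3) by simp
    qed
    have frame: "horseshoe_frame m D' Q \<xi> a b"
      unfolding horseshoe_frame_def
    proof (intro conjI)
      let ?Y = "\<lambda>v. (1 / s) *\<^sub>R (v - ?z)"
      let ?K = "cball ?z (2 * s) \<inter> {v. \<bar>?Y v \<bullet> e1\<bar> \<le> 1 \<and> norm (p (?Y v)) \<le> \<tau>}"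
      have "closed {v. \<bar>?Y v \<bullet> e1\<bar> \<le> 1 \<and> norm (p (?Y v)) \<le> \<tau>}"
        unfolding p_def by (intro closed_Collect_conj closed_Collect_le continuous_intros)
      then have K: "compact ?K" by (rule compact_Int_closed[OF compact_cball])
      have "cball ?z (2 * s) \<subseteq> cball ?z R" using s2 by (rule subset_cball)
      then have KU: "?K \<subseteq> \<phi> ` U" using R(2) by blast
      have "D' = {x \<in> U. \<phi> x \<in> ?K}"
      proof (intro set_eqI iffI)
        fix x assume "x \<in> D'"
        then have x: "x \<in> U" "\<bar>Y x \<bullet> e1\<bar> \<le> 1" "norm (p (Y x)) \<le> \<tau>" by (auto simp: D'_def)
        have "\<phi> x \<in> cball ?z (2 * s)" using normD'[OF x(2,3)] s by (simp add: distY)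
        then show "x \<in> {x \<in> U. \<phi> x \<in> ?K}" using x unfolding Y_def by blast
      next
        fix x assume "x \<in> {x \<in> U. \<phi> x \<in> ?K}"
        then show "x \<in> D'" unfolding D'_def Y_def by blast
      qed
      then show "compact D'" using compact_chart_preimage[OF cU K KU] by simp
      have "open {v. norm (?Y v) < 2 * A \<and> norm (p (?Y v)) < \<tau>}"
        unfolding p_def by (intro open_Collect_conj open_Collect_less continuous_intros)
      from open_chart_preimage[OF cU this] show "open Q" by (simp add: Q_def Y_def)
      have "continuous_on U \<xi>"
        unfolding \<xi>_def Y_def by (intro continuous_intros is_chartD(4)[OF cU])
      then show "continuous_on (D' \<union> Q) \<xi>"
        by (rule continuous_on_subset) (auto simp: D'_def Q_def)
      show "{x \<in> Q. \<bar>\<xi> x\<bar> \<le> 1} \<subseteq> D'" by (auto simp: Q_def D'_def \<xi>_def)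
      show "\<forall>k<m. - 1 \<le> a k \<and> a k \<le> b k \<and> b k \<le> 1"
      proof (intro allI impI conjI)
        fix k assume k: "k < m"
        have "0 \<le> a k" by (simp add: a_def)
        then show "- 1 \<le> a k" by simp
        show "a k \<le> b k" unfolding a_def b_def by (intro divide_right_mono) auto
        have "real (2 * k + 1) \<le> real (2 * m)" using k by (intro of_nat_mono) simp
        then show "b k \<le> 1" using m by (simp add: b_def)
      qed
      show "\<forall>j<m. \<forall>k<m. j \<noteq> k \<longrightarrow> {a j..b j} \<inter> {a k..b k} = {}"
      proof (intro allI impI)
        have lt: "b j < a k" if "j < k" for j k
          unfolding a_def b_def using that m by (intro divide_strict_right_mono) auto
        fix j k :: nat assume "j \<noteq> k"
        then consider "j < k" | "k < j" by linarith
        then show "{a j..b j} \<inter> {a k..b k} = {}"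
          by cases (use lt[of j k] lt[of k j] in auto)
      qed
      have pe: "p (t *\<^sub>R e1) = 0" for t by (simp add: p_def e11)
      define \<gamma> where "\<gamma> t = inv\<phi> ((3 * t - 3/2) *\<^sub>R e1)" for t :: real
      have nt: "norm ((3 * t - 3/2) *\<^sub>R e1) \<le> 3/2" if "t \<in> {0..1}" for t
      proof -
        have "\<bar>3 * t - 3/2\<bar> \<le> 3/2" unfolding abs_le_iff using that by simp
        then show ?thesis using e(1) by simp
      qed
      have \<gamma>: "\<gamma> t \<in> U" "Y (\<gamma> t) = (3 * t - 3/2) *\<^sub>R e1" if t: "t \<in> {0..1}" for t
      proof -
        have "norm ((3 * t - 3/2) *\<^sub>R e1) \<le> 2" using nt[OF t] by linarith
        from inv\<phi>[OF small(1)[OF this]] show "\<gamma> t \<in> U" "Y (\<gamma> t) = (3 * t - 3/2) *\<^sub>R e1"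
          by (simp_all add: \<gamma>_def)
      qed
      have "continuous_on {0..1} \<gamma>"
        unfolding \<gamma>_def inv\<phi>_def
      proof (rule continuous_on_compose2[OF is_chartD(5)[OF cU]])
        show "continuous_on {0..1} (\<lambda>t. ?z + s *\<^sub>R (3 * t - 3/2) *\<^sub>R e1)" by (intro continuous_intros)
        show "(\<lambda>t. ?z + s *\<^sub>R (3 * t - 3/2) *\<^sub>R e1) ` {0..1} \<subseteq> \<phi> ` U"
        proof (intro subsetI, elim imageE)
          fix v and t :: real assume v: "v = ?z + s *\<^sub>R (3 * t - 3/2) *\<^sub>R e1" and t: "t \<in> {0..1}"
          have "v = \<phi> (\<gamma> t)" unfolding v \<phi>Y[of "\<gamma> t"] \<gamma>(2)[OF t] ..
          then show "v \<in> \<phi> ` U" using \<gamma>(1)[OF t] by simp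
        qed
      qed
      moreover have "\<gamma> t \<in> Q" if t: "t \<in> {0..1}" for t
      proof -
        have "norm ((3 * t - 3/2) *\<^sub>R e1) < 2 * A" using nt[OF t] A(1) by linarith
        then show ?thesis using \<gamma>[OF t] A(2) by (simp only: Q_def mem_Collect_eq pe norm_zero simp_thms)
      qed
      then have "\<gamma> ` {0..1} \<subseteq> Q" by blast
      moreover have "\<xi> (\<gamma> 0) < -1" "1 < \<xi> (\<gamma> 1)" using \<gamma>(2)[of 0] \<gamma>(2)[of 1] by (simp_all add: \<xi>_def e11)
      ultimately show "\<exists>p::real \<Rightarrow> 'a. continuous_on {0..1} p \<and> p ` {0..1} \<subseteq> Q \<and> \<xi> (p 0) < -1 \<and> 1 < \<xi> (p 1)"
        by blast
    qed
    have D'W: "x \<in> W" if "x \<in> D'" for x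
    proof -
      have x: "x \<in> U" "norm (Y x) \<le> 2" using that normD' by (auto simp: D'_def)
      then have "\<phi> x \<in> cball ?z R" using small(1) by (simp add: distY)
      then show ?thesis using R(3) x(1) by blast
    qed
    have TW: "T x = x" if "x \<notin> W" for x
      unfolding T_def
    proof (rule transplant_outside[OF inj h])
      have "cball ?z (s * A) \<subseteq> cball ?z R" using sub \<open>cball ?z (R / 2) \<subseteq> cball ?z R\<close> by blast
      then show "x \<notin> U \<or> \<phi> x \<notin> cball ?z (s * A)" using R(3) that by blast
    qed
    \<comment> \<open>\<open>W\<close> contains the support of \<open>T\<close> and is disjoint from
      its first \<open>n - 1\<close> images under \<open>f\<close>, so along these \<open>n\<close>
      steps \<open>T\<close> acts only at the last one.\<close>
    have gn: "(g ^^ n) x = T (G x)" if x: "x \<in> D'" for x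
    proof -
      have orb: "(g ^^ i) x = (f ^^ i) x" if "i < n" for i
        using that
      proof (induction i)
        case (Suc i)
        then have "(g ^^ Suc i) x = g ((f ^^ i) x)" by simp
        also have "\<dots> = T ((f ^^ Suc i) x)" by (simp add: g_def)
        also have "\<dots> = (f ^^ Suc i) x"
          by (rule TW, rule W(3)) (use Suc.prems D'W[OF x] in auto)
        finally show ?case .
      qed simp
      obtain k where k: "n = Suc k" using n(1) by (cases n) auto
      then have "(g ^^ n) x = g ((f ^^ k) x)" using orb[of k] by simp
      then show ?thesis by (simp add: G_def g_def k)
    qed
    have Ygn: "(g ^^ n) x \<in> U" "Y ((g ^^ n) x) = h0 (\<Gamma> (Y x))" if x: "x \<in> D'" for x
    proof -
      have xU: "x \<in> U" "norm (Y x) \<le> 2" using x normD' by (auto simp: D'_def)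
      have "\<phi> x \<in> cball ?z r1" using small(2)[OF xU(2)] by (simp add: distY)
      then have "G x \<in> U" using GP[OF xU(1)] PU by blast
      from YT[OF this] show "(g ^^ n) x \<in> U" "Y ((g ^^ n) x) = h0 (\<Gamma> (Y x))"
        using inv\<phi>Y[OF xU(1)] by (simp_all add: gn[OF x] \<Gamma>_def)
    qed
    have inQ: "(g ^^ n) x \<in> Q" if x: "x \<in> D'" for x
    proof -
      have xY: "\<bar>Y x \<bullet> e1\<bar> \<le> 1" "norm (p (Y x)) \<le> \<tau>" using x by (auto simp: D'_def)
      have "norm (h0 (\<Gamma> (Y x))) < 2 * A" using h0'[OF xY] A(1) by linarith
      then show ?thesis using Ygn[OF x] h0'[OF xY] by (simp add: Q_def)
    qed
    have "crosses m D' Q \<xi> a b (g ^^ n)"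
      unfolding crosses_def
    proof (intro conjI allI impI subsetI; elim imageE CollectE conjE)
      fix y x assume "y = (g ^^ n) x" "x \<in> D'"
      then show "y \<in> Q" using inQ by simp
    next
      fix k y x assume k: "k < m" and y: "y = (g ^^ n) x" and x: "x \<in> D'" and xi: "\<xi> x = a k"
      have xY: "\<bar>Y x \<bullet> e1\<bar> \<le> 1" "norm (p (Y x)) \<le> \<tau>" using x by (auto simp: D'_def)
      have "h0 (\<Gamma> (Y x)) \<bullet> e1 < -1" by (rule h0l[OF xY k]) (use xi in \<open>simp add: \<xi>_def a_def\<close>)
      then show "y \<in> {y \<in> Q. \<xi> y < -1}" using inQ[OF x] Ygn[OF x] y by (simp add: \<xi>_def)
    next
      fix k y x assume k: "k < m" and y: "y = (g ^^ n) x" and x: "x \<in> D'" and xi: "\<xi> x = b k"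
      have xY: "\<bar>Y x \<bullet> e1\<bar> \<le> 1" "norm (p (Y x)) \<le> \<tau>" using x by (auto simp: D'_def)
      have "1 < h0 (\<Gamma> (Y x)) \<bullet> e1" by (rule h0r[OF xY k]) (use xi in \<open>simp add: \<xi>_def b_def\<close>)
      then show "y \<in> {y \<in> Q. 1 < \<xi> y}" using inQ[OF x] Ygn[OF x] y by (simp add: \<xi>_def)
    qed
    with bg near frame show "\<exists>g D' Q \<xi> a b. bilip (c * (C + 1) * L) g \<and> (\<forall>x. D (f x) (g x) \<le> \<delta>) \<and>
      horseshoe_frame m D' Q \<xi> a b \<and> crosses m D' Q \<xi> a b (g ^^ n)"
      by (intro exI[of _ g] exI[of _ D'] exI[of _ Q] exI[of _ \<xi>] exI[of _ a] exI[of _ b]) blast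
  qed
qed

section \<open>Open dense sets of large entropy\<close>

definition robust_entropy :: "real \<Rightarrow> real \<Rightarrow> ('a \<Rightarrow> 'a) set" where
  "robust_entropy \<alpha> N = {f \<in> Hset \<A> \<alpha>. \<exists>p m D' Q \<xi> a b. 0 < p \<and> 0 < m \<and> N * real p \<le> ln (real m) \<and>
     horseshoe_frame m D' Q \<xi> a b \<and> crosses m D' Q \<xi> a b (f ^^ p)}"

text \<open>The \<open>p\<close>, \<open>m\<close> and frame that witness membership of
  \<open>f\<close> serve for all nearby maps too, by \<open>openin_HW_crosses\<close>.\<close>

lemma openin_robust_entropy: "openin (HW_top \<A> \<alpha>) (robust_entropy \<alpha> N)"
proof (subst openin_subopen, intro ballI)
  fix f assume "f \<in> robust_entropy \<alpha> N"
  then obtain p m D' Q \<xi> a b where *: "f \<in> Hset \<A> \<alpha>" "0 < p" "0 < m" "N * real p \<le> ln (real m)"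
    "horseshoe_frame m D' Q \<xi> a b" "crosses m D' Q \<xi> a b (f ^^ p)"
    unfolding robust_entropy_def by (elim CollectE exE conjE)
  have "{g \<in> Hset \<A> \<alpha>. crosses m D' Q \<xi> a b (g ^^ p)} \<subseteq> robust_entropy \<alpha> N"
    unfolding robust_entropy_def using * by blast
  then show "\<exists>T. openin (HW_top \<A> \<alpha>) T \<and> f \<in> T \<and> T \<subseteq> robust_entropy \<alpha> N"
    using openin_HW_crosses[OF *(5), of \<alpha> p] *(1,6) by blast
qed

lemma robust_entropy_htop:
  assumes "f \<in> robust_entropy \<alpha> N"
  shows "ereal N \<le> htop f"
proof -
  obtain p m D' Q \<xi> a b where *: "f \<in> Hset \<A> \<alpha>" "0 < p" "0 < m" "N * real p \<le> ln (real m)"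
    "horseshoe_frame m D' Q \<xi> a b" "crosses m D' Q \<xi> a b (f ^^ p)"
    using assms unfolding robust_entropy_def by (elim CollectE exE conjE)
  have "continuous_on UNIV f" using *(1) by (simp add: Hset_def)
  from htop_ge_horseshoe[OF *(5,6) this *(2,3)] have "ereal (ln (real m) / real p) \<le> htop f" .
  moreover have "N \<le> ln (real m) / real p" using *(2,4) by (simp add: pos_le_divide_eq)
  ultimately show ?thesis by (meson ereal_less_eq(3) order_trans)
qed

text \<open>The first perturbation creates a periodic point of uncontrolled period; only then is the
  number \<open>m\<close> of legs chosen, with \<open>N * k \<le> ln m\<close> for the least period
  \<open>k\<close>. Each perturbation has its own constant \<Lambda>, for which the openness of
  \<open>G\<close> is invoked anew.\<close>

lemma robust_entropy_dense:
  assumes \<alpha>: "0 \<le> \<alpha>" "\<alpha> < 1" and dim: "CARD('n) \<ge> 2"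
    and G: "openin (HW_top \<A> \<alpha>) G" "f \<in> G" "f \<in> Hset \<A> 1"
  shows "\<exists>g\<in>G. g \<in> Hset \<A> 1 \<inter> robust_entropy \<alpha> N"
proof -
  have nn: "0 \<le> \<Lambda>" if "bilip \<Lambda> g" for \<Lambda> g using that by (simp add: bilip_def)
  obtain L where f: "bilip L f" using Hset_1_bilip[OF G(3)] by blast
  obtain \<Lambda>1 where \<Lambda>1: "\<And>\<delta>. 0 < \<delta> \<Longrightarrow> \<exists>g. bilip \<Lambda>1 g \<and> (\<forall>x. D (f x) (g x) \<le> \<delta>) \<and> (\<exists>q n. 0 < n \<and> (g ^^ n) q = q)"
    using closing[OF f] by blast
  have "0 \<le> \<Lambda>1" using \<Lambda>1[of 1] nn by auto
  from openin_HW_bilip_stable[OF G(1,2) f \<alpha> this] obtain \<delta>1 where \<delta>1: "0 < \<delta>1"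
    "\<And>g. bilip \<Lambda>1 g \<Longrightarrow> (\<forall>x. D (f x) (g x) \<le> \<delta>1) \<Longrightarrow> g \<in> G" by blast
  obtain g q n where g: "bilip \<Lambda>1 g" "\<forall>x. D (f x) (g x) \<le> \<delta>1" "0 < n" "(g ^^ n) q = q"
    using \<Lambda>1[OF \<delta>1(1)] by blast
  \<comment> \<open>Minimality makes the intermediate iterates of \<open>q\<close> differ from
    \<open>q\<close>, as the horseshoe construction requires.\<close>
  define k where "k = (LEAST k. 0 < k \<and> (g ^^ k) q = q)"
  have k: "0 < k" "(g ^^ k) q = q"
    using LeastI[of "\<lambda>k. 0 < k \<and> (g ^^ k) q = q" n] g(3,4) unfolding k_def by auto
  have kmin: "(g ^^ i) q \<noteq> q" if "0 < i" "i < k" for i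
    using not_less_Least[of i "\<lambda>k. 0 < k \<and> (g ^^ k) q = q"] that unfolding k_def by auto
  obtain m :: nat where m: "exp (N * real k) \<le> real m" using real_arch_simple by blast
  then have m0: "0 < m" using less_le_trans[OF exp_gt_zero m] by simp
  have lnm: "N * real k \<le> ln (real m)" using m m0 by (subst ln_ge_iff) auto
  obtain \<Lambda>2 where \<Lambda>2: "\<And>\<delta>. 0 < \<delta> \<Longrightarrow> \<exists>h D' Q \<xi> a b. bilip \<Lambda>2 h \<and> (\<forall>x. D (g x) (h x) \<le> \<delta>) \<and>
    horseshoe_frame m D' Q \<xi> a b \<and> crosses m D' Q \<xi> a b (h ^^ k)"
    using horseshoe_at_periodic_point[OF g(1) k kmin dim m0] by blast
  have "0 \<le> \<Lambda>2" using \<Lambda>2[of 1] nn by auto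
  from openin_HW_bilip_stable[OF G(1) \<delta>1(2)[OF g(1,2)] g(1) \<alpha> this] obtain \<delta>2 where \<delta>2: "0 < \<delta>2"
    "\<And>h. bilip \<Lambda>2 h \<Longrightarrow> (\<forall>x. D (g x) (h x) \<le> \<delta>2) \<Longrightarrow> h \<in> G" by blast
  obtain h D' Q \<xi> a b where h: "bilip \<Lambda>2 h" "\<forall>x. D (g x) (h x) \<le> \<delta>2"
    "horseshoe_frame m D' Q \<xi> a b" "crosses m D' Q \<xi> a b (h ^^ k)"
    using \<Lambda>2[OF \<delta>2(1)] by blast
  have "h \<in> Hset \<A> \<alpha>" using bilip_Hset[OF h(1)] \<alpha>(2) by simp
  then have "h \<in> robust_entropy \<alpha> N"
    unfolding robust_entropy_def using k(1) m0 lnm h(3,4) by blast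
  then show ?thesis using \<delta>2(2)[OF h(1,2)] bilip_Hset[OF h(1), of 1] by auto
qed

text \<open>Density needs testing at maps in \<open>Hset \<A> 1\<close> only: an open set meeting
  the closure meets this set, and the perturbed map found there is again bi-Lipschitz, hence in the
  closure.\<close>

lemma generic_infinite_entropy:
  assumes \<alpha>: "0 \<le> \<alpha>" "\<alpha> < 1" and dim: "CARD('n) \<ge> 2"
  shows "generic_in (subtopology (HW_top \<A> \<alpha>) (Hclos \<A> 1 \<alpha>)) {f. htop f = \<infinity>}"
proof -
  let ?H = "HW_top \<A> \<alpha>" and ?C = "Hclos \<A> 1 \<alpha>"
  let ?X = "subtopology ?H ?C"
  have sub: "Hset \<A> 1 \<subseteq> Hset \<A> \<alpha>" using Hset_1_bilip bilip_Hset \<alpha> by (meson less_imp_le subsetI)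
  then have HC: "Hset \<A> 1 \<subseteq> ?C"
    unfolding Hclos_def by (intro closure_of_subset) (simp add: topspace_HW)
  have "?C \<subseteq> topspace ?H" unfolding Hclos_def by (rule closure_of_subset_topspace)
  then have top: "topspace ?X = ?C" by auto
  define \<G> where "\<G> = range (\<lambda>N::nat. robust_entropy \<alpha> (real N) \<inter> ?C)"
  show ?thesis
    unfolding generic_in_def
  proof (intro exI[of _ \<G>] conjI ballI)
    show "countable \<G>" by (simp add: \<G>_def)
    fix B assume "B \<in> \<G>"
    then obtain N :: nat where B: "B = robust_entropy \<alpha> (real N) \<inter> ?C" by (auto simp: \<G>_def)
    show "openin ?X B" unfolding B openin_subtopology using openin_robust_entropy by blast
    have "f \<in> ?X closure_of B" if f: "f \<in> ?C" for f
      unfolding in_closure_of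
    proof (intro conjI allI impI)
      show "f \<in> topspace ?X" using f top by simp
      fix T assume T: "f \<in> T \<and> openin ?X T"
      then obtain G where G: "openin ?H G" "T = G \<inter> ?C" unfolding openin_subtopology by blast
      with T f obtain f' where "f' \<in> Hset \<A> 1" "f' \<in> G" unfolding Hclos_def in_closure_of by blast
      then obtain g where "g \<in> G" "g \<in> Hset \<A> 1" "g \<in> robust_entropy \<alpha> (real N)"
        using robust_entropy_dense[OF \<alpha> dim G(1)] by blast
      then show "\<exists>y. y \<in> B \<and> y \<in> T" using HC G(2) B by blast
    qed
    then show "?X closure_of B = topspace ?X" using closure_of_subset_topspace[of ?X B] top by blast
  next
    show "topspace ?X \<inter> \<Inter>\<G> \<subseteq> {f. htop f = \<infinity>}"
    proof
      fix f assume "f \<in> topspace ?X \<inter> \<Inter>\<G>"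
      then have "f \<in> robust_entropy \<alpha> (real N)" for N :: nat by (auto simp: \<G>_def)
      then have "ereal (real N) \<le> htop f" for N :: nat by (rule robust_entropy_htop)
      then have "htop f = \<infinity>" by (intro ereal_top) (meson ereal_less_eq(3) order_trans real_arch_simple)
      then show "f \<in> {f. htop f = \<infinity>}" by simp
    qed
  qed
qed

end

theorem theoremA:
  fixes \<A> :: "('a::{t2_space, second_countable_topology}, 'n::finite) chart set"
    and \<alpha> :: real
  assumes "smooth_atlas \<A>"
    and "compact (UNIV :: 'a set)"
    and "CARD('n) \<ge> 2"
    and "0 \<le> \<alpha>" and "\<alpha> < 1"
  shows "generic_in (subtopology (HW_top \<A> \<alpha>) (Hclos \<A> 1 \<alpha>))
           {f. htop f = \<infinity>}"
proof -
  obtain D where "lipschitz_manifold D \<A>"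
    using smooth_atlas_lipschitz_manifold[OF assms(1,2)] by blast
  then interpret lipschitz_manifold D \<A> .
  show ?thesis by (rule generic_infinite_entropy[OF assms(4,5,3)])
qed

end
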